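(* Let $m\ge 1$ and let $\alpha_1,\ldots,\alpha_m \in (0,1)$ satisfy $\sum_{i=1}^m \alpha_i = 1$. Let $f:[0,1]^m\to\mathbb{C}$ be integrable with generalized Walsh expansion $f=\sum_{S\subseteq[m]}F_S$. Then $$\int_{A_1\times\cdots\times A_m} f = 0$$ for all partitions of $[0,1]$ into disjoint measurable sets $A_1,\ldots,A_m$ with $\lambda(A_i)=\alpha_i$ for $i=1,\ldots,m$, if and only if all of the following hold: (i) $F_\emptyset = 0$; (ii) for every $S\subseteq[m]$ with $|S|\ge 2$, $F_S$ is an alternating function with respect to the coordinates in $S$; (iii) for every $S\subseteq[m]$ with $1\le |S|\le m-1$ and every $\ell\in[m]\setminus S$, $$\frac{1}{\prod_{i\in S}\alpha_i}\,F_S(x) = \sum_{i\in S}\frac{1}{\prod_{j\in S_i}\alpha_j}\,F_{S_i}(x^{(i)})\quad\text{for almost every }x\in[0,1]^m,$$ where $S_i := (S\cup\{\ell\})\setminus\{i\}$ and $x^{(i)}$ is obtained from $x=(x_1,\ldots,x_m)$ by swapping the coordinates $x_\ell$ and $x_i$.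
   Context: $[m]=\{1,\ldots,m\}$, $\lambda$ is Lebesgue measure. Functions are identified when equal almost everywhere. For $x\in[0,1]^m$ and $S\subseteq[m]$, $x_S$ is the restriction of $x$ to the coordinates in $S$; a function $g:[0,1]^S\to\mathbb{C}$ is identified with its extension $x\mapsto g(x_S)$ on $[0,1]^m$. The generalized Walsh expansion of an integrable $f:[0,1]^m\to\mathbb{C}$ is the unique expansion $f=\sum_{S\subseteq[m]}F_S$ such that (1) each $F_S$ depends only on the coordinates in $S$, and (2) $\int_0^1 F_S(x)\,dx_i = 0$ for every $S$ and every $i\in S$; explicitly $F_S(y)=\sum_{T\subseteq S}(-1)^{|S\setminus T|}\int_{[0,1]^{[m]\setminus T}} f(y_T,x_{[m]\setminus T})\,dx_{[m]\setminus T}$. A function is alternating with respect to the coordinates in $S$ if interchanging the values of any two coordinates in $S$ changes its sign (almost everywhere). *)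

theory Defs
  imports "HOL-Analysis.Analysis"
begin

text \<open>Coordinates are indexed by [m] = {1..m}; points of [0,1]^S are extensional
  functions nat => real (undefined outside S).  Unit cube [0,1]^S with Lebesgue measure:\<close>
definition cube :: "nat set \<Rightarrow> (nat \<Rightarrow> real) measure" where
  "cube S = PiM S (\<lambda>_. lebesgue_on {0..1})"

definition partial_int :: "nat \<Rightarrow> nat set \<Rightarrow> ((nat \<Rightarrow> real) \<Rightarrow> complex) \<Rightarrow> (nat \<Rightarrow> real) \<Rightarrow> complex" where
  "partial_int m T f y = (\<integral>x. f (merge T ({1..m} - T) (y, x)) \<partial>cube ({1..m} - T))"

definition walsh :: "nat \<Rightarrow> ((nat \<Rightarrow> real) \<Rightarrow> complex) \<Rightarrow> nat set \<Rightarrow> (nat \<Rightarrow> real) \<Rightarrow> complex" where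
  "walsh m f S y = (\<Sum>T\<in>Pow S. (-1) ^ card (S - T) * partial_int m T f y)"

definition swap_coords :: "nat \<Rightarrow> nat \<Rightarrow> (nat \<Rightarrow> real) \<Rightarrow> (nat \<Rightarrow> real)" where
  "swap_coords i j x = x(i := x j, j := x i)"

definition alternating_on :: "nat \<Rightarrow> nat set \<Rightarrow> ((nat \<Rightarrow> real) \<Rightarrow> complex) \<Rightarrow> bool" where
  "alternating_on m S g \<longleftrightarrow>
     (\<forall>i\<in>S. \<forall>j\<in>S. i \<noteq> j \<longrightarrow> (AE x in cube {1..m}. g (swap_coords i j x) = - g x))"

end

theory Submission
  imports Defs "HOL-Probability.Infinite_Product_Measure" "HOL-Combinatorics.Transposition"
begin

text \<open>Everything is tested against products: for bounded measurable \<open>\<phi>\<^sub>1, \<dots>, \<phi>\<^sub>m\<close> the integral of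
  \<open>\<phi>\<^sub>1(x\<^sub>1) \<cdots> \<phi>\<^sub>m(x\<^sub>m) F\<^sub>S(x)\<close> is the integral of \<open>f\<close> against the product in which the factors indexed
  by \<open>S\<close> are centred and the others are replaced by their means.

  Sufficiency: for a partition \<open>A\<close> let \<open>d(S)\<close> be the integral of \<open>F\<^sub>S\<close> over \<open>A\<^sub>1 \<times> \<dots> \<times> A\<^sub>m\<close>, and let \<open>D\<close> be
  the sum of \<open>d(S)\<close> over \<open>|S| = k\<close>. Mean zero in slot \<open>i \<in> S\<close> together with antisymmetry expresses
  \<open>d(S)\<close> through the same integrals with \<open>A\<^sub>\<ell>\<close>, \<open>\<ell> \<notin> S\<close>, in slot \<open>i\<close>; condition (iii) expresses it through
  the very same quantities with the opposite sign. Summing, \<open>k D = - (m - k) D\<close>, so \<open>D = 0\<close>.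

  Necessity: by downward induction on \<open>k\<close> the components with \<open>|S| > k\<close> contribute nothing.
  Exchanging small sets of equal measure between the cells of a partition and taking a mixed difference
  of order \<open>k\<close> kills all components with \<open>|S| < k\<close>. If the \<open>i\<close>-th exchange (\<open>i \<in> S\<close>) is between the
  cells \<open>i\<close> and \<open>\<ell>\<close>, what is left is (iii); if exchange \<open>i\<close> and exchange \<open>j\<close> are both between the cells
  \<open>i\<close> and \<open>j\<close>, and every other one is between its own cell and cell \<open>i\<close>, what is left is antisymmetry
  in \<open>i\<close> and \<open>j\<close>.\<close>

section \<open>Product test functions\<close>

text \<open>A partition probes \<open>f\<close> only on products of disjoint sets of fixed measures,
  never across the diagonals. The diagonals are null, so products of dyadic intervals with pairwise
  distinct indices still determine an integrable function almost everywhere. Intervals of one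
  generation have equal measure and can trade places between cells without changing any \<alpha> i;
  at a fine generation every cell has room for all 2m of them. What an exchange reveals is a
  difference of two indicators, a factor of mean zero. Products of such factors miss any part of a
  function that is constant in one of the variables concerned, and F_S has no such part in the
  variables of S.

  The weights in (iii) come from the slots outside S: F_S ignores these coordinates, so on a
  partition it picks up a factor \<alpha> j for each j outside S, and dividing by the product of all
  \<alpha> j leaves the reciprocal of the product over S.

  Conditions (ii) and (iii) at one level make that level vanish on every partition, so the
  computation behind sufficiency also drives the downward induction of necessity.\<close>

abbreviation unit_leb :: "real measure" where
  "unit_leb \<equiv> lebesgue_on {0..1}"

lemma prob_space_unit_leb: "prob_space unit_leb"
  by (rule prob_spaceI) (simp add: emeasure_restrict_space)

interpretation unit_product: product_prob_space "\<lambda>_::nat. unit_leb" UNIV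
  by (intro product_prob_space.intro product_prob_space_axioms.intro product_sigma_finite.intro
        prob_space_imp_sigma_finite prob_space_unit_leb)

lemma prob_space_cube: "prob_space (cube I)"
  unfolding cube_def by (intro prob_space_PiM prob_space_unit_leb)

lemma space_cube: "space (cube I) = (\<Pi>\<^sub>E i\<in>I. {0..1})"
  by (simp add: cube_def space_PiM)

lemma cube_component: "x \<in> space (cube I) \<Longrightarrow> i \<in> I \<Longrightarrow> x i \<in> {0..1}"
  by (auto simp: space_cube PiE_iff)

text \<open>Measurability refers to Lebesgue sets because the cells of a partition are only Lebesgue
  measurable. The bound keeps products of test functions with an integrable function
  integrable.\<close>

definition test_fun :: "(real \<Rightarrow> complex) \<Rightarrow> bool" where
  "test_fun \<phi> \<longleftrightarrow> \<phi> \<in> borel_measurable unit_leb \<and> (\<exists>B. \<forall>x\<in>{0..1}. norm (\<phi> x) \<le> B)"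

definition mean :: "(real \<Rightarrow> complex) \<Rightarrow> complex" where
  "mean \<phi> = integral\<^sup>L unit_leb \<phi>"

definition tensor_int :: "nat set \<Rightarrow> (nat \<Rightarrow> real \<Rightarrow> complex) \<Rightarrow> ((nat \<Rightarrow> real) \<Rightarrow> complex) \<Rightarrow> complex" where
  "tensor_int I \<phi> g = (LINT x|cube I. (\<Prod>i\<in>I. \<phi> i (x i)) * g x)"

lemma test_fun_measurable: "test_fun \<phi> \<Longrightarrow> \<phi> \<in> borel_measurable unit_leb"
  by (simp add: test_fun_def)

lemma test_fun_const [simp]: "test_fun (\<lambda>_. c)"
  by (auto simp: test_fun_def)

lemma test_fun_diff [intro]: "test_fun \<phi> \<Longrightarrow> test_fun \<psi> \<Longrightarrow> test_fun (\<lambda>x. \<phi> x - \<psi> x)"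
  unfolding test_fun_def by (auto intro: borel_measurable_diff order_trans[OF norm_triangle_ineq4 add_mono])

lemma test_fun_indicator [intro]:
  assumes "A \<in> sets lebesgue"
  shows "test_fun (indicator A)"
proof -
  have "A \<inter> {0..1} \<in> sets unit_leb"
    using assms by (auto simp: sets_restrict_space)
  then have "(indicator A :: real \<Rightarrow> complex) \<in> borel_measurable unit_leb"
    by (subst borel_measurable_indicator_iff) simp
  then show ?thesis
    by (auto simp: test_fun_def indicator_def intro!: exI[of _ 1])
qed

lemma integrable_test_fun: "test_fun \<phi> \<Longrightarrow> integrable unit_leb \<phi>"
  unfolding test_fun_def by (auto intro!: unit_product.M.integrable_const_bound AE_I2)

lemma mean_const [simp]: "mean (\<lambda>_. c) = c"
  unfolding mean_def by (simp add: prob_space.prob_space[OF prob_space_unit_leb] measure_restrict_space)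

lemma mean_diff: "test_fun \<phi> \<Longrightarrow> test_fun \<psi> \<Longrightarrow> mean (\<lambda>x. \<phi> x - \<psi> x) = mean \<phi> - mean \<psi>"
  by (simp add: mean_def integrable_test_fun)

lemma mean_indicator:
  assumes "A \<in> sets lebesgue" "A \<subseteq> {0..1}"
  shows "mean (indicator A) = measure lebesgue A"
proof -
  have "A \<in> sets unit_leb"
    using assms by (auto simp: sets_restrict_space)
  moreover have "measure unit_leb A = measure lebesgue A"
    using assms by (simp add: measure_restrict_space)
  ultimately show ?thesis
    using assms(2) integral_complex_of_real[of unit_leb "indicator A"]
    by (simp add: mean_def Int_absorb2 of_real_indicator)
qed

lemma measurable_tensor:
  assumes "\<And>i. i \<in> I \<Longrightarrow> test_fun (\<phi> i)"
  shows "(\<lambda>x. \<Prod>i\<in>I. \<phi> i (x i)) \<in> borel_measurable (cube I)"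
  unfolding cube_def
  by (intro borel_measurable_prod measurable_compose[OF measurable_component_singleton]
      test_fun_measurable assms)

lemma tensor_bounded:
  assumes "finite I" "\<And>i. i \<in> I \<Longrightarrow> test_fun (\<phi> i)"
  obtains B where "\<And>x. x \<in> space (cube I) \<Longrightarrow> norm (\<Prod>i\<in>I. \<phi> i (x i)) \<le> B"
proof -
  obtain b where b: "\<And>i x. i \<in> I \<Longrightarrow> x \<in> {0..1} \<Longrightarrow> norm (\<phi> i x) \<le> b i"
    using assms(2) unfolding test_fun_def by metis
  have "norm (\<Prod>i\<in>I. \<phi> i (x i)) \<le> (\<Prod>i\<in>I. b i)" if "x \<in> space (cube I)" for x
    unfolding prod_norm[symmetric] using b cube_component[OF that] by (intro prod_mono) auto
  then show thesis using that by blast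
qed

lemma integrable_tensor:
  assumes "finite I" "\<And>i. i \<in> I \<Longrightarrow> test_fun (\<phi> i)" "integrable (cube I) g"
  shows "integrable (cube I) (\<lambda>x. (\<Prod>i\<in>I. \<phi> i (x i)) * g x)"
proof -
  obtain B where B: "\<And>x. x \<in> space (cube I) \<Longrightarrow> norm (\<Prod>i\<in>I. \<phi> i (x i)) \<le> B"
    using tensor_bounded assms(1,2) by blast
  show ?thesis
  proof (rule Bochner_Integration.integrable_bound)
    show "integrable (cube I) (\<lambda>x. B * norm (g x))"
      using assms(3) by simp
    show "(\<lambda>x. (\<Prod>i\<in>I. \<phi> i (x i)) * g x) \<in> borel_measurable (cube I)"
      using assms by (intro borel_measurable_times measurable_tensor) auto
    show "AE x in cube I. norm ((\<Prod>i\<in>I. \<phi> i (x i)) * g x) \<le> norm (B * norm (g x))"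
      using B by (intro AE_I2) (auto simp: norm_mult abs_mult intro!: mult_right_mono order_trans[OF _ abs_ge_self])
  qed
qed

lemma tensor_int_cong:
  assumes "\<And>i t. i \<in> I \<Longrightarrow> t \<in> {0..1} \<Longrightarrow> \<phi> i t = \<psi> i t" "\<And>x. x \<in> space (cube I) \<Longrightarrow> g x = h x"
  shows "tensor_int I \<phi> g = tensor_int I \<psi> h"
  unfolding tensor_int_def using assms cube_component[of _ I]
  by (intro Bochner_Integration.integral_cong refl arg_cong2[where f="(*)"] prod.cong) auto

lemma tensor_int_add:
  assumes "finite I" "\<And>i. i \<in> I \<Longrightarrow> test_fun (\<phi> i)" "integrable (cube I) g" "integrable (cube I) h"
  shows "tensor_int I \<phi> (\<lambda>x. g x + h x) = tensor_int I \<phi> g + tensor_int I \<phi> h"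
  unfolding tensor_int_def using assms by (simp add: distrib_left integrable_tensor)

lemma tensor_int_diff:
  assumes "finite I" "\<And>i. i \<in> I \<Longrightarrow> test_fun (\<phi> i)" "integrable (cube I) g" "integrable (cube I) h"
  shows "tensor_int I \<phi> (\<lambda>x. g x - h x) = tensor_int I \<phi> g - tensor_int I \<phi> h"
  unfolding tensor_int_def using assms by (simp add: right_diff_distrib integrable_tensor)

lemma tensor_int_cmult: "tensor_int I \<phi> (\<lambda>x. c * g x) = c * tensor_int I \<phi> g"
  unfolding tensor_int_def by (simp add: mult.left_commute)

lemma tensor_int_divide: "tensor_int I \<phi> (\<lambda>x. g x / c) = tensor_int I \<phi> g / c"
  unfolding tensor_int_def by simp

lemma tensor_int_sum:
  assumes "finite I" "\<And>i. i \<in> I \<Longrightarrow> test_fun (\<phi> i)" "\<And>a. a \<in> A \<Longrightarrow> integrable (cube I) (g a)"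
  shows "tensor_int I \<phi> (\<lambda>x. \<Sum>a\<in>A. g a x) = (\<Sum>a\<in>A. tensor_int I \<phi> (g a))"
  unfolding tensor_int_def sum_distrib_left using assms
  by (intro Bochner_Integration.integral_sum integrable_tensor)

text \<open>Since \<pi> is injective, reading off the coordinates \<pi> j maps the measure of
  \<open>cube K\<close> to that of \<open>cube J\<close>. By Fubini the slots of K outside the image
  integrate to their means, and the others are only renamed. It is applied to transpositions, to the
  inclusion of T in [m], and to the choice between two copies of a variable.\<close>

lemma tensor_int_reindex:
  fixes \<pi> :: "nat \<Rightarrow> nat"
  assumes "finite K" "finite J" "inj_on \<pi> J" "\<pi> ` J \<subseteq> K" "integrable (cube J) g"
  shows integrable_reindex: "integrable (cube K) (\<lambda>z. g (\<lambda>j\<in>J. z (\<pi> j)))"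
    and "(\<And>k. k \<in> K \<Longrightarrow> test_fun (\<phi> k)) \<Longrightarrow>
      tensor_int K \<phi> (\<lambda>z. g (\<lambda>j\<in>J. z (\<pi> j)))
        = (\<Prod>k\<in>K - \<pi> ` J. mean (\<phi> k)) * tensor_int J (\<phi> \<circ> \<pi>) g"
proof -
  have distr: "distr (cube K) (cube J) (\<lambda>\<omega>. \<lambda>n\<in>J. \<omega> (\<pi> n)) = cube J" if "\<pi> ` J \<subseteq> K" for K
    unfolding cube_def
    using distr_PiM_reindex[of K "\<lambda>_. unit_leb" \<pi> J] assms(3) that prob_space_unit_leb by auto
  have meas: "(\<lambda>\<omega>. \<lambda>n\<in>J. \<omega> (\<pi> n)) \<in> measurable (cube K) (cube J)" if "\<pi> ` J \<subseteq> K" for K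
    unfolding cube_def using that by (intro measurable_restrict measurable_component_singleton) auto
  show int: "integrable (cube K) (\<lambda>z. g (\<lambda>j\<in>J. z (\<pi> j)))"
    using integrable_distr[OF meas] distr assms(4,5) by auto
  assume \<phi>: "\<And>k. k \<in> K \<Longrightarrow> test_fun (\<phi> k)"
  define P Q where "P = \<pi> ` J" and "Q = K - \<pi> ` J"
  have PQ: "P \<inter> Q = {}" "P \<union> Q = K" "finite P" "finite Q"
    using assms by (auto simp: P_def Q_def)
  let ?F = "\<lambda>z. (\<Prod>k\<in>K. \<phi> k (z k)) * g (\<lambda>j\<in>J. z (\<pi> j))"
  have "tensor_int K \<phi> (\<lambda>z. g (\<lambda>j\<in>J. z (\<pi> j))) = integral\<^sup>L (PiM (P \<union> Q) (\<lambda>_. unit_leb)) ?F"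
    by (simp add: tensor_int_def cube_def PQ)
  also have "\<dots> = (\<integral>x. (\<integral>y. ?F (merge P Q (x, y)) \<partial>PiM Q (\<lambda>_. unit_leb)) \<partial>PiM P (\<lambda>_. unit_leb))"
    using integrable_tensor[OF assms(1) \<phi> int] PQ
    by (intro unit_product.product_integral_fold) (auto simp: cube_def)
  also have "\<dots> = (\<integral>x. (\<integral>y. ((\<Prod>k\<in>P. \<phi> k (x k)) * g (\<lambda>j\<in>J. x (\<pi> j))) * (\<Prod>k\<in>Q. \<phi> k (y k))
      \<partial>PiM Q (\<lambda>_. unit_leb)) \<partial>PiM P (\<lambda>_. unit_leb))"
  proof (intro Bochner_Integration.integral_cong refl)
    fix x y
    have "(\<Prod>k\<in>K. \<phi> k (merge P Q (x, y) k)) = (\<Prod>k\<in>P. \<phi> k (x k)) * (\<Prod>k\<in>Q. \<phi> k (y k))"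
      using PQ prod.union_disjoint[of P Q "\<lambda>k. \<phi> k (merge P Q (x, y) k)"]
      by (auto simp: merge_def intro!: arg_cong2[where f="(*)"] prod.cong)
    moreover have "(\<lambda>j\<in>J. merge P Q (x, y) (\<pi> j)) = (\<lambda>j\<in>J. x (\<pi> j))"
      by (auto simp: P_def merge_def)
    ultimately show "?F (merge P Q (x, y))
        = ((\<Prod>k\<in>P. \<phi> k (x k)) * g (\<lambda>j\<in>J. x (\<pi> j))) * (\<Prod>k\<in>Q. \<phi> k (y k))"
      by simp
  qed
  also have "\<dots> = (\<integral>x. (\<Prod>k\<in>P. \<phi> k (x k)) * g (\<lambda>j\<in>J. x (\<pi> j)) \<partial>PiM P (\<lambda>_. unit_leb))
      * (\<Prod>k\<in>Q. mean (\<phi> k))"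
  proof -
    have "(\<integral>y. (\<Prod>k\<in>Q. \<phi> k (y k)) \<partial>PiM Q (\<lambda>_. unit_leb)) = (\<Prod>k\<in>Q. mean (\<phi> k))"
      unfolding mean_def using PQ \<phi>
      by (intro unit_product.product_integral_prod integrable_test_fun) (auto simp: Q_def)
    then show ?thesis by simp
  qed
  also have "(\<integral>x. (\<Prod>k\<in>P. \<phi> k (x k)) * g (\<lambda>j\<in>J. x (\<pi> j)) \<partial>PiM P (\<lambda>_. unit_leb))
      = tensor_int J (\<phi> \<circ> \<pi>) g"
  proof -
    have "tensor_int J (\<phi> \<circ> \<pi>) g = integral\<^sup>L (distr (cube P) (cube J) (\<lambda>\<omega>. \<lambda>n\<in>J. \<omega> (\<pi> n)))
        (\<lambda>x. (\<Prod>i\<in>J. (\<phi> \<circ> \<pi>) i (x i)) * g x)"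
      unfolding tensor_int_def using distr[of P] by (simp add: P_def)
    also have "\<dots> = (\<integral>\<omega>. (\<Prod>i\<in>J. \<phi> (\<pi> i) (\<omega> (\<pi> i))) * g (\<lambda>n\<in>J. \<omega> (\<pi> n)) \<partial>cube P)"
      using assms \<phi> by (subst integral_distr[OF meas])
        (auto simp: P_def intro!: borel_measurable_times measurable_tensor)
    also have "\<dots> = (\<integral>x. (\<Prod>k\<in>P. \<phi> k (x k)) * g (\<lambda>j\<in>J. x (\<pi> j)) \<partial>cube P)"
      using assms(3) by (simp add: P_def prod.reindex)
    finally show ?thesis by (simp add: cube_def)
  qed
  finally show "tensor_int K \<phi> (\<lambda>z. g (\<lambda>j\<in>J. z (\<pi> j)))
        = (\<Prod>k\<in>K - \<pi> ` J. mean (\<phi> k)) * tensor_int J (\<phi> \<circ> \<pi>) g"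
    by (simp only: Q_def mult.commute)
qed

lemma swap_coords_eq_restrict:
  assumes "i \<in> I" "j \<in> I" "x \<in> space (cube I)"
  shows "(\<lambda>k\<in>I. x (Transposition.transpose i j k)) = swap_coords i j x"
  using assms by (auto simp: swap_coords_def Transposition.transpose_def fun_eq_iff space_cube PiE_iff extensional_def)

text \<open>A transposition is its own inverse, so a swap of coordinates passes to the test
  functions as the same transposition.\<close>

lemma
  assumes "finite I" "i \<in> I" "j \<in> I" "integrable (cube I) g"
  shows integrable_swap: "integrable (cube I) (\<lambda>x. g (swap_coords i j x))"
    and tensor_int_swap: "(\<And>k. k \<in> I \<Longrightarrow> test_fun (\<phi> k)) \<Longrightarrow>
      tensor_int I \<phi> (\<lambda>x. g (swap_coords i j x)) = tensor_int I (\<phi> \<circ> Transposition.transpose i j) g"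
proof -
  have im: "Transposition.transpose i j ` I = I"
    using assms by (simp add: Transposition.transpose_image_eq)
  have inj: "inj_on (Transposition.transpose i j) I"
    by simp
  note R = integrable_reindex[OF assms(1,1) inj eq_refl[OF im] assms(4)]
    tensor_int_reindex(2)[OF assms(1,1) inj eq_refl[OF im] assms(4)]
  show "integrable (cube I) (\<lambda>x. g (swap_coords i j x))"
    using R(1) assms(2,3) by (subst Bochner_Integration.integrable_cong[OF refl, of _ _ "\<lambda>z. g (\<lambda>k\<in>I. z (Transposition.transpose i j k))"])
      (auto simp: swap_coords_eq_restrict simp del: restrict_apply)
  assume "\<And>k. k \<in> I \<Longrightarrow> test_fun (\<phi> k)"
  then show "tensor_int I \<phi> (\<lambda>x. g (swap_coords i j x)) = tensor_int I (\<phi> \<circ> Transposition.transpose i j) g"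
    using R(2) im assms(2,3)
    by (subst tensor_int_cong[where \<psi>=\<phi> and h="\<lambda>z. g (\<lambda>k\<in>I. z (Transposition.transpose i j k))"])
      (auto simp: swap_coords_eq_restrict simp del: restrict_apply)
qed

section \<open>Walsh components tested against products\<close>

lemma partial_int_restrict: "partial_int m T f (\<lambda>i\<in>T. y i) = partial_int m T f y"
proof -
  have "merge T ({1..m} - T) (restrict y T, x) = merge T ({1..m} - T) (y, x)" for x
    by (auto simp: merge_def)
  then show ?thesis by (simp add: partial_int_def)
qed

text \<open>With the constant 1 in the slots outside T, Fubini turns the integral of
  \<open>f\<close> into one of its partial integral over the cube of T. Extending the partial
  integral to all coordinates then brings in the means of the remaining factors.\<close>

lemma
  assumes "T \<subseteq> {1..m}" and f: "integrable (cube {1..m}) f"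
  shows integrable_partial_int: "integrable (cube {1..m}) (partial_int m T f)"
    and tensor_int_partial_int: "(\<And>k. k \<in> {1..m} \<Longrightarrow> test_fun (\<phi> k)) \<Longrightarrow>
      tensor_int {1..m} \<phi> (partial_int m T f) = (\<Prod>k\<in>{1..m} - T. mean (\<phi> k)) *
        tensor_int {1..m} (\<lambda>i. if i \<in> T then \<phi> i else (\<lambda>_. 1)) f"
proof -
  define Q where "Q = {1..m} - T"
  let ?M = "\<lambda>_::nat. unit_leb"
  have TQ: "T \<inter> Q = {}" "T \<union> Q = {1..m}" "finite T" "finite Q"
    using assms finite_subset by (auto simp: Q_def)
  interpret T: finite_product_sigma_finite ?M T by standard fact
  interpret Q: finite_product_sigma_finite ?M Q by standard fact
  interpret P: pair_sigma_finite "PiM T ?M" "PiM Q ?M" ..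
  have "integrable (PiM T ?M \<Otimes>\<^sub>M PiM Q ?M) (\<lambda>x. f (merge T Q x))"
    using f TQ unit_product.distr_merge[OF TQ(1,3,4)]
    by (intro integrable_distr[OF measurable_merge]) (simp add: cube_def)
  from P.integrable_fst'[OF this] have intT: "integrable (cube T) (partial_int m T f)"
    unfolding partial_int_def[abs_def] cube_def Q_def .
  note R = integrable_reindex[OF _ TQ(3) inj_on_id2 _ intT, of "{1..m}", simplified]
    tensor_int_reindex(2)[OF _ TQ(3) inj_on_id2 _ intT, of "{1..m}", simplified]
  show "integrable (cube {1..m}) (partial_int m T f)"
    using R(1) assms(1) by (simp add: partial_int_restrict)
  assume \<phi>: "\<And>k. k \<in> {1..m} \<Longrightarrow> test_fun (\<phi> k)"
  let ?\<psi> = "\<lambda>i. if i \<in> T then \<phi> i else (\<lambda>_. 1)"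
  let ?F = "\<lambda>z. (\<Prod>k\<in>{1..m}. ?\<psi> k (z k)) * f z"
  have "tensor_int {1..m} ?\<psi> f = integral\<^sup>L (PiM (T \<union> Q) ?M) ?F"
    by (simp add: tensor_int_def cube_def TQ)
  also have "\<dots> = (\<integral>x. (\<integral>y. ?F (merge T Q (x, y)) \<partial>PiM Q ?M) \<partial>PiM T ?M)"
    using integrable_tensor[OF _ _ f, of ?\<psi>] \<phi> TQ
    by (intro unit_product.product_integral_fold) (auto simp: cube_def)
  also have "\<dots> = (\<integral>x. (\<integral>y. (\<Prod>k\<in>T. \<phi> k (x k)) * f (merge T Q (x, y)) \<partial>PiM Q ?M) \<partial>PiM T ?M)"
  proof (intro Bochner_Integration.integral_cong refl)
    fix x y
    have "(\<Prod>k\<in>{1..m}. ?\<psi> k (merge T Q (x, y) k)) = (\<Prod>k\<in>T. \<phi> k (x k))"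
      using TQ by (intro prod.mono_neutral_cong_right) (auto simp: merge_def)
    then show "?F (merge T Q (x, y)) = (\<Prod>k\<in>T. \<phi> k (x k)) * f (merge T Q (x, y))"
      by simp
  qed
  also have "\<dots> = tensor_int T \<phi> (partial_int m T f)"
    by (simp add: tensor_int_def partial_int_def cube_def Q_def)
  finally show "tensor_int {1..m} \<phi> (partial_int m T f) = (\<Prod>k\<in>{1..m} - T. mean (\<phi> k)) *
        tensor_int {1..m} ?\<psi> f"
    using R(2)[of \<phi>] \<phi> assms(1) by (simp add: partial_int_restrict comp_def)
qed

lemma integrable_walsh:
  assumes "S \<subseteq> {1..m}" "integrable (cube {1..m}) f"
  shows "integrable (cube {1..m}) (walsh m f S)"
  unfolding walsh_def using assms
  by (intro Bochner_Integration.integrable_sum integrable_mult_right integrable_partial_int) auto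

definition centred :: "nat set \<Rightarrow> (nat \<Rightarrow> real \<Rightarrow> complex) \<Rightarrow> nat \<Rightarrow> real \<Rightarrow> complex" where
  "centred S \<phi> i = (if i \<in> S then (\<lambda>x. \<phi> i x - mean (\<phi> i)) else (\<lambda>_. mean (\<phi> i)))"

text \<open>The inclusion-exclusion signs in \<open>walsh\<close> are those of the expanded product
  of the differences \<open>\<phi> i - mean (\<phi> i)\<close> over \<open>i \<in> S\<close>: the
  term of T keeps \<phi> i for \<open>i \<in> T\<close> and takes the mean for
  \<open>i \<in> S - T\<close>.\<close>

lemma tensor_int_walsh:
  assumes "S \<subseteq> {1..m}" and f: "integrable (cube {1..m}) f"
    and \<phi>: "\<And>k. k \<in> {1..m} \<Longrightarrow> test_fun (\<phi> k)"
  shows "tensor_int {1..m} \<phi> (walsh m f S) = tensor_int {1..m} (centred S \<phi>) f"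
proof -
  let ?I = "{1..m}"
  define \<psi> where "\<psi> T i = (if i \<in> T then \<phi> i else (\<lambda>_. 1))" for T i
  have fin: "finite S" using assms finite_subset by blast
  have sub: "T \<subseteq> ?I" if "T \<in> Pow S" for T using that assms by auto
  have c: "(-1) ^ card (S - T) * (\<Prod>k\<in>?I - T. mean (\<phi> k)) * (\<Prod>i\<in>?I. \<psi> T i (x i))
      = (-1) ^ (card S - card T) * (\<Prod>i\<in>T. \<phi> i (x i)) * (\<Prod>i\<in>S-T. mean (\<phi> i))
        * (\<Prod>i\<in>?I-S. mean (\<phi> i))" if "T \<in> Pow S" for T x
  proof -
    have "(\<Prod>i\<in>?I. \<psi> T i (x i)) = (\<Prod>i\<in>T. \<phi> i (x i))"
      using sub[OF that] by (intro prod.mono_neutral_cong_right) (auto simp: \<psi>_def)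
    moreover have "(\<Prod>k\<in>?I - T. mean (\<phi> k)) = (\<Prod>i\<in>S-T. mean (\<phi> i)) * (\<Prod>i\<in>?I-S. mean (\<phi> i))"
      using that assms fin by (subst prod.union_disjoint[symmetric]) (auto intro!: prod.cong)
    moreover have "card (S - T) = card S - card T"
      using that fin finite_subset by (intro card_Diff_subset) auto
    ultimately show ?thesis by simp
  qed
  have "tensor_int ?I \<phi> (walsh m f S)
      = (\<Sum>T\<in>Pow S. tensor_int ?I \<phi> (\<lambda>y. (-1) ^ card (S - T) * partial_int m T f y))"
    unfolding walsh_def[abs_def] using assms sub
    by (intro tensor_int_sum integrable_mult_right integrable_partial_int) auto
  also have "\<dots> = (\<Sum>T\<in>Pow S. (-1) ^ card (S - T) * ((\<Prod>k\<in>?I - T. mean (\<phi> k)) *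
        tensor_int ?I (\<psi> T) f))"
    unfolding tensor_int_cmult \<psi>_def
    by (intro sum.cong refl arg_cong2[where f="(*)"] tensor_int_partial_int sub f \<phi>)
  also have "\<dots> = (\<Sum>T\<in>Pow S. LINT x|cube ?I. ((-1) ^ card (S - T) * (\<Prod>k\<in>?I - T. mean (\<phi> k)))
      * ((\<Prod>i\<in>?I. \<psi> T i (x i)) * f x))"
    unfolding tensor_int_def by (simp add: mult.assoc)
  also have "\<dots> = (LINT x|cube ?I. (\<Sum>T\<in>Pow S. ((-1) ^ card (S - T) * (\<Prod>k\<in>?I - T. mean (\<phi> k)))
      * ((\<Prod>i\<in>?I. \<psi> T i (x i)) * f x)))"
    using f \<phi> by (intro Bochner_Integration.integral_sum[symmetric] integrable_mult_right integrable_tensor)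
      (auto simp: \<psi>_def)
  also have "\<dots> = tensor_int ?I (centred S \<phi>) f"
    unfolding tensor_int_def
  proof (intro Bochner_Integration.integral_cong refl)
    fix x
    have "(\<Prod>i\<in>?I. centred S \<phi> i (x i))
        = (\<Prod>i\<in>S. centred S \<phi> i (x i)) * (\<Prod>i\<in>?I-S. centred S \<phi> i (x i))"
      using assms(1) fin by (subst prod.union_disjoint[symmetric]) (auto intro!: prod.cong)
    also have "\<dots> = (\<Prod>i\<in>S. \<phi> i (x i) - mean (\<phi> i)) * (\<Prod>i\<in>?I-S. mean (\<phi> i))"
      by (auto simp: centred_def intro!: arg_cong2[where f="(*)"] prod.cong)
    also have "\<dots> = (\<Sum>T\<in>Pow S. (-1) ^ (card S - card T) * (\<Prod>i\<in>T. \<phi> i (x i)) * (\<Prod>i\<in>S-T. mean (\<phi> i))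
        * (\<Prod>i\<in>?I-S. mean (\<phi> i)))"
      unfolding prod_diff_conv_sum'[OF fin] sum_distrib_right ..
    also have "\<dots> = (\<Sum>T\<in>Pow S. (-1) ^ card (S - T) * (\<Prod>k\<in>?I - T. mean (\<phi> k)) * (\<Prod>i\<in>?I. \<psi> T i (x i)))"
      by (intro sum.cong refl c[symmetric])
    finally show "(\<Sum>T\<in>Pow S. ((-1) ^ card (S - T) * (\<Prod>k\<in>?I - T. mean (\<phi> k)))
      * ((\<Prod>i\<in>?I. \<psi> T i (x i)) * f x)) = (\<Prod>i\<in>?I. centred S \<phi> i (x i)) * f x"
      by (simp only: sum_distrib_right mult.assoc)
  qed
  finally show ?thesis .
qed

section \<open>Functions vanishing against products\<close>

text \<open>Tonelli applied to the indicator of the exceptional set: integrating first in coordinate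
  i already gives 0, whatever the other coordinates are.\<close>

lemma AE_cube_coordinateI:
  assumes "finite I" "i \<in> I" and Q: "Measurable.pred (cube I) Q"
    and AE: "\<And>x. AE t in unit_leb. Q (x(i := t))"
  shows "AE x in cube I. Q x"
proof -
  define J where "J = I - {i}"
  have J: "insert i J = I" "finite J" "i \<notin> J"
    using assms by (auto simp: J_def)
  have meas: "(\<lambda>x. indicator {x. \<not> Q x} x :: ennreal) \<in> borel_measurable (cube I)"
    using Q by measurable
  then have "integral\<^sup>N (cube (insert i J)) (indicator {x. \<not> Q x})
      = (\<integral>\<^sup>+x. (\<integral>\<^sup>+t. indicator {x. \<not> Q x} (x(i := t)) \<partial>unit_leb) \<partial>cube J)"
    unfolding cube_def using J by (intro unit_product.product_nn_integral_insert) auto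
  also have "\<dots> = (\<integral>\<^sup>+x. 0 \<partial>cube J)"
  proof (intro nn_integral_cong)
    fix x
    have "(\<integral>\<^sup>+t. indicator {x. \<not> Q x} (x(i := t)) \<partial>unit_leb) = (\<integral>\<^sup>+t. 0 \<partial>unit_leb)"
      using AE[of x] by (intro nn_integral_cong_AE) (auto simp: indicator_def)
    then show "(\<integral>\<^sup>+t. indicator {x. \<not> Q x} (x(i := t)) \<partial>unit_leb) = 0" by simp
  qed
  finally have "AE x in cube I. indicator {x. \<not> Q x} x = (0::ennreal)"
    using meas J by (subst nn_integral_0_iff_AE[symmetric]) auto
  then show ?thesis by (auto simp: indicator_def split: if_splits)
qed

lemma measurable_cube_component:
  assumes "i \<in> I"
  shows "(\<lambda>x. x i) \<in> borel_measurable (cube I)"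
proof -
  have "(\<lambda>t. t) \<in> borel_measurable unit_leb"
    by (intro measurable_restrict_space1 measurable_completion) simp
  from measurable_compose[OF measurable_component_singleton[of i I "\<lambda>_. unit_leb"] this]
  show ?thesis using assms by (simp add: cube_def)
qed

text \<open>The null set is taken Borel so that the event is measurable; a general Lebesgue null set
  is covered by such an N.\<close>

lemma AE_cube_not_in_null:
  assumes "finite I" "i \<in> I" "N \<in> null_sets lborel"
  shows "AE x in cube I. x i \<notin> N"
proof (rule AE_cube_coordinateI[OF assms(1,2)])
  have "N \<in> sets borel" using assms(3) by auto
  then show "Measurable.pred (cube I) (\<lambda>x. x i \<notin> N)"
    using measurable_cube_component[OF assms(2)] by measurable
  have "N \<in> null_sets lebesgue" using assms(3) by (rule null_sets_completionI)
  then have "AE t in lebesgue. t \<notin> N" by (rule AE_not_in)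
  then have "AE t in unit_leb. t \<notin> N" by (subst AE_restrict_space_iff) auto
  then show "AE t in unit_leb. (x(i := t)) i \<notin> N" for x :: "nat \<Rightarrow> real" by simp
qed

text \<open>With all coordinates but one fixed, that one avoids the finitely many other values
  almost surely. This is why intervals with pairwise distinct indices are enough for
  testing.\<close>

lemma AE_cube_distinct:
  assumes "finite I"
  shows "AE x in cube I. inj_on x I"
proof -
  have "AE x in cube I. x i \<noteq> x j" if "i \<in> I" "j \<in> I" "i \<noteq> j" for i j
  proof (rule AE_cube_coordinateI[OF assms that(1)])
    show "Measurable.pred (cube I) (\<lambda>x. x i \<noteq> x j)"
      unfolding pred_def using that by (intro borel_measurable_neq measurable_cube_component)
    have "AE t in unit_leb. t \<noteq> c" for c :: real
    proof -
      have "AE t in lebesgue. t \<noteq> c"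
        using AE_not_in[of "{c}" lebesgue] by simp
      then show ?thesis by (subst AE_restrict_space_iff) (auto elim: eventually_mono)
    qed
    then show "AE t in unit_leb. (x(i := t)) i \<noteq> (x(i := t)) j" for x :: "nat \<Rightarrow> real"
      using that by simp
  qed
  then have "AE x in cube I. \<forall>i\<in>I. \<forall>j\<in>I. i \<noteq> j \<longrightarrow> x i \<noteq> x j"
    using assms by (auto simp: AE_finite_all)
  then show ?thesis by eventually_elim (auto simp: inj_on_def)
qed

lemma prod_indicator:
  "finite I \<Longrightarrow> (\<Prod>i\<in>I. indicator (X i) (x i) :: complex) = of_bool (\<forall>i\<in>I. x i \<in> X i)"
  by (induction I rule: finite_induct) (auto simp: indicator_def)

lemma tensor_int_indicator:
  assumes "finite I"
  shows "tensor_int I (\<lambda>i. indicator (X i)) g = (LINT x:PiE I X|cube I. g x)"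
  unfolding tensor_int_def set_lebesgue_integral_def
proof (intro Bochner_Integration.integral_cong refl)
  fix x assume x: "x \<in> space (cube I)"
  have "(\<Prod>i\<in>I. indicator (X i) (x i) :: complex) = indicator (PiE I X) x"
    using assms x by (auto simp: prod_indicator indicator_def PiE_iff space_cube)
  then show "(\<Prod>i\<in>I. indicator (X i) (x i)) * g x = indicat_real (PiE I X) x *\<^sub>R g x"
    by (simp add: indicator_def)
qed

text \<open>Boxes form an intersection-stable generator of the product sigma-algebra, so by Dynkin's
  argument the integral of K vanishes over every measurable set, and an integrable function with
  this property is zero almost everywhere.\<close>

lemma AE_zero_if_tensor_int_zero:
  assumes "finite I" and K: "integrable (cube I) K"
    and zero: "\<And>X. (\<And>i. i \<in> I \<Longrightarrow> X i \<in> sets lebesgue) \<Longrightarrow> tensor_int I (\<lambda>i. indicator (X i)) K = 0"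
  shows "AE x in cube I. K x = 0"
proof (rule sigma_finite_measure.density_zero[OF prob_space_imp_sigma_finite[OF prob_space_cube] K])
  fix A assume A: "A \<in> sets (cube I)"
  let ?\<Omega> = "\<Pi>\<^sub>E i\<in>I. space unit_leb"
  have sets: "sets (cube I) = sigma_sets ?\<Omega> (prod_algebra I (\<lambda>_. unit_leb))"
    unfolding cube_def by (rule sets_PiM)
  have space: "?\<Omega> = space (cube I)" by (simp add: space_cube)
  have compl: "?\<Omega> - A \<in> sets (cube I)" if "A \<in> sets (cube I)" for A
    using that unfolding space by (rule sets.compl_sets)
  have set_int: "set_integrable (cube I) A K" if "A \<in> sets (cube I)" for A
    using K that unfolding set_integrable_def by (rule integrable_mult_indicator[rotated])
  \<comment> \<open>The whole cube is itself a box; the complement step of the induction subtracts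
    from it.\<close>
  have total: "(LINT x:?\<Omega>|cube I. K x) = 0"
    using zero[of "\<lambda>_. {0..1}"] assms(1) by (simp add: tensor_int_indicator)
  show "(LINT x:A|cube I. K x) = 0"
  proof (rule sigma_sets_induct_disjoint[where G="prod_algebra I (\<lambda>_. unit_leb)" and \<Omega>="?\<Omega>"])
    show "A \<in> sigma_sets ?\<Omega> (prod_algebra I (\<lambda>_. unit_leb))" using A sets by simp
    fix A assume "A \<in> prod_algebra I (\<lambda>_. unit_leb)"
    then obtain X where X: "A = PiE I X" "\<And>i. i \<in> I \<Longrightarrow> X i \<in> sets unit_leb"
      unfolding prod_algebra_eq_finite[OF assms(1)] by auto
    then show "(LINT x:A|cube I. K x) = 0"
      using zero[of X] assms(1) by (auto simp: sets_restrict_space_iff tensor_int_indicator)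
  next
    fix A assume A: "A \<in> sigma_sets ?\<Omega> (prod_algebra I (\<lambda>_. unit_leb))" "(LINT x:A|cube I. K x) = 0"
    then have AM: "A \<in> sets (cube I)" "?\<Omega> - A \<in> sets (cube I)" "A \<subseteq> ?\<Omega>"
      using compl[of A] space sets.sets_into_space[of A "cube I"] by (simp_all only: sets)
    have "(LINT x:A \<union> (?\<Omega> - A)|cube I. K x) = (LINT x:A|cube I. K x) + (LINT x:?\<Omega> - A|cube I. K x)"
      using AM by (intro set_integral_Un set_int) auto
    then show "(LINT x:?\<Omega> - A|cube I. K x) = 0"
      using A total AM by (simp add: Un_absorb1)
  next
    fix A :: "nat \<Rightarrow> (nat \<Rightarrow> real) set"
    assume A: "disjoint_family A" "range A \<subseteq> sigma_sets ?\<Omega> (prod_algebra I (\<lambda>_. unit_leb))"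
      "\<And>i. (LINT x:A i|cube I. K x) = 0"
    then have "A i \<in> sets (cube I)" for i using sets by auto
    then have "(LINT x:(\<Union>i. A i)|cube I. K x) = (\<Sum>i. LINT x:A i|cube I. K x)"
      using A(1) by (intro lebesgue_integral_countable_add set_int) (auto simp: disjoint_family_on_def)
    then show "(LINT x:(\<Union>i. A i)|cube I. K x) = 0" by (simp add: A)
  qed (use prod_algebra_sets_into_space[of I "\<lambda>_. unit_leb"] in
      \<open>simp_all add: Int_stable_prod_algebra set_lebesgue_integral_def\<close>)
qed

text \<open>One slot is upgraded from half-lines to Lebesgue sets. Half-lines generate the Borel
  sets, which Dynkin's argument covers; a Lebesgue set differs from a Borel one by a subset of a
  Borel null set, and coordinate j avoids that almost surely.\<close>

lemma tensor_int_zero_coordinate: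
  assumes "finite I" "j \<in> I" and K: "integrable (cube I) K"
    and \<phi>: "\<And>i. i \<in> I \<Longrightarrow> test_fun (\<phi> i)"
    and zero: "\<And>t. tensor_int I (\<phi>(j := indicator {..<t})) K = 0"
    and B: "B \<in> sets lebesgue"
  shows "tensor_int I (\<phi>(j := indicator B)) K = 0"
proof -
  define G where "G x = (\<Prod>i\<in>I. (\<phi>(j := \<lambda>_. 1)) i (x i)) * K x" for x
  define E where "E B = {x \<in> space (cube I). x j \<in> B}" for B
  have G: "integrable (cube I) G"
    unfolding G_def using \<phi> by (intro integrable_tensor assms K) auto
  have eq: "tensor_int I (\<phi>(j := indicator B)) K = (LINT x:E B|cube I. G x)" for B
    unfolding tensor_int_def set_lebesgue_integral_def
  proof (intro Bochner_Integration.integral_cong refl)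
    fix x assume "x \<in> space (cube I)"
    moreover have "(\<Prod>i\<in>I. (\<phi>(j := indicator B)) i (x i))
        = indicator B (x j) * (\<Prod>i\<in>I. (\<phi>(j := \<lambda>_. 1)) i (x i))"
      using assms(1,2) by (simp add: prod.remove)
    ultimately show "(\<Prod>i\<in>I. (\<phi>(j := indicator B)) i (x i)) * K x = indicat_real (E B) x *\<^sub>R G x"
      by (simp add: G_def E_def indicator_def)
  qed
  have meas: "E B \<in> sets (cube I)" if "B \<in> sets borel" for B
    unfolding E_def using measurable_cube_component[OF assms(2)] that by measurable
  have set_int: "set_integrable (cube I) A G" if "A \<in> sets (cube I)" for A
    using G that unfolding set_integrable_def by (rule integrable_mult_indicator[rotated])
  have borel: "sets (borel :: real measure) = sigma_sets UNIV (range lessThan)"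
    by (subst borel_Iio) simp
  have total: "(LINT x:E UNIV|cube I. G x) = 0"
  proof -
    \<comment> \<open>Coordinates lie in [0,1], so any threshold above 1 gives the whole
      cube.\<close>
    have "E UNIV = E {..<2}" using cube_component[OF _ assms(2)] by (fastforce simp: E_def)
    then show ?thesis using zero[of 2] eq[of "{..<2}"] by simp
  qed
  have zero_borel: "(LINT x:E B|cube I. G x) = 0" if "B \<in> sets borel" for B
  proof (rule sigma_sets_induct_disjoint[where G="range lessThan" and \<Omega>=UNIV and P = "\<lambda>B. (LINT x:E B|cube I. G x) = 0"])
    show "B \<in> sigma_sets UNIV (range lessThan)" using that borel by simp
    show "Int_stable (range lessThan :: real set set)"
    proof -
      have "{..<a} \<inter> {..<b} = {..<min a b}" for a b :: real by auto
      then show ?thesis by (auto simp: Int_stable_def)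
    qed
    show "(LINT x:E A|cube I. G x) = 0" if "A \<in> range lessThan" for A
      using that zero eq by force
    show "(LINT x:E (UNIV - A)|cube I. G x) = 0"
      if A: "A \<in> sigma_sets UNIV (range lessThan)" "(LINT x:E A|cube I. G x) = 0" for A
    proof -
      have AB: "A \<in> sets borel" "UNIV - A \<in> sets borel"
        using A borel sets.compl_sets[of A borel] by auto
      have "(LINT x:E A \<union> E (UNIV - A)|cube I. G x)
          = (LINT x:E A|cube I. G x) + (LINT x:E (UNIV - A)|cube I. G x)"
        using AB by (intro set_integral_Un set_int meas) (auto simp: E_def)
      moreover have "E A \<union> E (UNIV - A) = E UNIV" by (auto simp: E_def)
      ultimately show ?thesis using A total by simp
    qed
    show "(LINT x:E (\<Union>i. A i)|cube I. G x) = 0"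
      if A: "disjoint_family A" "range A \<subseteq> sigma_sets UNIV (range lessThan)"
        "\<And>i. (LINT x:E (A i)|cube I. G x) = 0" for A :: "nat \<Rightarrow> real set"
    proof -
      have AB: "A i \<in> sets borel" for i using A borel by auto
      have "(\<Union>i. E (A i)) \<in> sets (cube I)"
        using meas[OF AB] by (intro sets.countable_UN) auto
      moreover have "E (\<Union>i. A i) = (\<Union>i. E (A i))" by (auto simp: E_def)
      moreover from calculation(1)
      have "(LINT x:(\<Union>i. E (A i))|cube I. G x) = (\<Sum>i. LINT x:E (A i)|cube I. G x)"
        using A(1) by (intro lebesgue_integral_countable_add set_int meas AB)
          (auto simp: disjoint_family_on_def E_def)
      ultimately show ?thesis by (simp add: A)
    qed
  qed (simp_all add: E_def set_lebesgue_integral_def)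
  obtain S N N' where SN: "B = S \<union> N" "N \<subseteq> N'" "N' \<in> null_sets lborel" "S \<in> sets lborel"
    using B by (rule sets_completionE)
  have "test_fun (indicator S)"
    by (intro test_fun_indicator sets_completionI_sets SN(4))
  have "tensor_int I (\<phi>(j := indicator B)) K = tensor_int I (\<phi>(j := indicator S)) K"
    unfolding tensor_int_def
  proof (rule integral_cong_AE)
    show "AE x in cube I. (\<Prod>i\<in>I. (\<phi>(j := indicator B)) i (x i)) * K x
        = (\<Prod>i\<in>I. (\<phi>(j := indicator S)) i (x i)) * K x"
      using AE_cube_not_in_null[OF assms(1,2) SN(3)]
    proof eventually_elim
      case (elim x)
      then have "x j \<in> B \<longleftrightarrow> x j \<in> S" using SN by auto
      then show ?case by (auto simp: indicator_def intro!: disjI2 prod.cong)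
    qed
  qed (use B \<phi> K \<open>test_fun (indicator S)\<close> in \<open>auto intro!: borel_measurable_times measurable_tensor\<close>)
  then show ?thesis using zero_borel[of S] SN eq by simp
qed

lemma tensor_int_zero_if_thresholds:
  assumes "finite I" and K: "integrable (cube I) K"
    and zero: "\<And>t. tensor_int I (\<lambda>i. indicator {..<t i}) K = 0"
    and X: "\<And>i. i \<in> I \<Longrightarrow> X i \<in> sets lebesgue"
  shows "tensor_int I (\<lambda>i. indicator (X i)) K = 0"
proof -
  \<comment> \<open>J collects the slots already upgraded. The thresholds stay arbitrary in the
    induction because upgrading slot j calls on every threshold in that slot.\<close>
  have "tensor_int I (\<lambda>i. indicator (if i \<in> J then X i else {..<t i})) K = 0"
    if "finite J" "J \<subseteq> I" for J t
    using that
  proof (induction J arbitrary: t)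
    case empty
    then show ?case using zero by simp
  next
    case (insert j J)
    let ?\<phi> = "\<lambda>i. indicator (if i \<in> J then X i else {..<t i}) :: real \<Rightarrow> complex"
    have upd: "?\<phi>(j := indicator {..<s}) = (\<lambda>i. indicator (if i \<in> J then X i else {..<(t(j := s)) i}))" for s
      using insert.hyps by (auto simp: fun_eq_iff)
    have "tensor_int I (?\<phi>(j := indicator (X j))) K = 0"
    proof (rule tensor_int_zero_coordinate[OF assms(1) _ K])
      show "tensor_int I (?\<phi>(j := indicator {..<s})) K = 0" for s
        unfolding upd using insert by (intro insert.IH) auto
      show "test_fun (?\<phi> i)" if "i \<in> I" for i
        using X that by (intro test_fun_indicator) auto
    qed (use insert X in auto)
    moreover have "?\<phi>(j := indicator (X j)) = (\<lambda>i. indicator (if i \<in> insert j J then X i else {..<t i}))"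
      by (auto simp: fun_eq_iff)
    ultimately show ?case by simp
  qed
  from this[OF assms(1) subset_refl, of "\<lambda>_. 0"] show ?thesis
    by (subst tensor_int_cong[where \<psi>="\<lambda>i. indicator (if i \<in> I then X i else {..<0})" and h=K]) auto
qed

section \<open>Dyadic intervals and boxes with distinct indices\<close>

definition dyadic :: "nat \<Rightarrow> nat \<Rightarrow> real set" where
  "dyadic n p = {real p / 2 ^ n ..< (real p + 1) / 2 ^ n}"

text \<open>Half-open intervals of generation n tile the half-line, so a point determines its
  interval, whose index is the integer part of 2^n x. The indices below 2^n cover all of [0,1]
  except the point 1.\<close>

lemma mem_dyadic_iff: "x \<in> dyadic n p \<longleftrightarrow> 0 \<le> x \<and> p = nat \<lfloor>2 ^ n * x\<rfloor>"
proof -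
  have "x \<in> dyadic n p \<longleftrightarrow> real p \<le> 2 ^ n * x \<and> 2 ^ n * x < real p + 1"
    by (simp add: dyadic_def field_simps)
  also have "\<dots> \<longleftrightarrow> \<lfloor>2 ^ n * x\<rfloor> = int p"
    by (simp add: floor_eq_iff)
  also have "\<dots> \<longleftrightarrow> 0 \<le> x \<and> p = nat \<lfloor>2 ^ n * x\<rfloor>"
    by (auto simp: zero_le_mult_iff dest: arg_cong[of _ _ nat]) (metis of_nat_0_le_iff zero_le_floor zero_le_mult_iff zero_less_power zero_less_numeral not_le)
  finally show ?thesis .
qed

lemma dyadic_lebesgue [simp]: "dyadic n p \<in> sets lebesgue"
  by (simp add: dyadic_def)

lemma measure_dyadic: "measure lebesgue (dyadic n p) = 1 / 2 ^ n"
  by (simp add: dyadic_def field_simps)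

lemma dyadic_subset: 
  assumes "p < 2 ^ n" shows "dyadic n p \<subseteq> {0..1}"
proof -
  have "real p + 1 \<le> 2 ^ n" using assms by (metis Suc_eq_plus1 Suc_leI of_nat_1 of_nat_add of_nat_le_iff of_nat_numeral of_nat_power)
  then have "(real p + 1) / 2 ^ n \<le> 1" by simp
  moreover have "0 \<le> real p / 2 ^ n" by simp
  moreover have "{a..<b} \<subseteq> {0..1}" if "0 \<le> a" "b \<le> 1" for a b :: real
    using that by auto
  ultimately show ?thesis unfolding dyadic_def by blast
qed

lemma dyadic_disjoint: "p \<noteq> q \<Longrightarrow> dyadic n p \<inter> dyadic n q = {}"
  by (auto simp: mem_dyadic_iff)

text \<open>Once 2^n (b - a) is at least 1, the scaled points are at least 1 apart and so have
  different integer parts.\<close>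

lemma eventually_floor_less:
  fixes a b :: real
  assumes "0 \<le> a" "a < b"
  shows "\<forall>\<^sub>F n in sequentially. nat \<lfloor>2 ^ n * a\<rfloor> < nat \<lfloor>2 ^ n * b\<rfloor>"
proof -
  obtain N where "1 / (b - a) < 2 ^ N"
    using real_arch_pow[of 2 "1 / (b - a)"] by auto
  then have "1 \<le> (b - a) * 2 ^ N"
    using assms by (simp add: field_simps)
  also have "(b - a) * 2 ^ N \<le> (b - a) * 2 ^ n" if "N \<le> n" for n
    using assms that by (intro mult_left_mono power_increasing) auto
  finally have "1 \<le> (b - a) * 2 ^ n" if "N \<le> n" for n
    using that by blast
  then have "\<forall>\<^sub>F n in sequentially. 1 \<le> (b - a) * 2 ^ n"
    by (auto simp: eventually_sequentially)
  then show ?thesis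
  proof eventually_elim
    case (elim n)
    then have "\<lfloor>2 ^ n * a\<rfloor> + 1 \<le> \<lfloor>2 ^ n * b\<rfloor>"
      by (auto simp: le_floor_iff algebra_simps) linarith
    moreover have "0 \<le> \<lfloor>2 ^ n * a\<rfloor>" using assms by simp
    ultimately show ?case by linarith
  qed
qed

text \<open>The box below the thresholds is, up to a null set, the limit of unions of dyadic boxes
  whose sides have pairwise distinct indices; dominated convergence carries the zero integrals to
  the limit. Only large n matter for the limit, hence the freedom of \<open>n0\<close>.\<close>

lemma tensor_int_thresholds_zero_if_distinct_dyadic:
  assumes "finite I" and K: "integrable (cube I) K"
    and zero: "\<And>n p. n \<ge> n0 \<Longrightarrow> inj_on p I \<Longrightarrow> (\<And>i. i \<in> I \<Longrightarrow> p i < 2 ^ n) \<Longrightarrow>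
      tensor_int I (\<lambda>i. indicator (dyadic n (p i))) K = 0"
  shows "tensor_int I (\<lambda>i. indicator {..<t i}) K = 0"
proof -
  \<comment> \<open>The number of generation-n intervals lying below the threshold, capped so that
    all of them stay inside [0,1]; for a negative threshold \<open>nat\<close> makes it 0.\<close>
  define c where "c n i = min (2 ^ n) (nat \<lfloor>2 ^ n * t i\<rfloor>)" for n i
  define P where "P n = {p \<in> PiE I (\<lambda>i. {..<c n i}). inj_on p I}" for n
  define s where "s n x = (\<Sum>p\<in>P n. \<Prod>i\<in>I. indicator (dyadic n (p i)) (x i) :: complex)" for n x
  define r where "r x = (\<Prod>i\<in>I. indicator {..<t i} (x i) :: complex)" for x
  have finP: "finite (P n)" for n
    unfolding P_def using assms(1)
    by (intro finite_subset[OF _ finite_PiE[of I "\<lambda>i. {..<c n i}"]]) auto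
  have s_int: "integrable (cube I) (\<lambda>x. s n x * K x)" for n
    unfolding s_def sum_distrib_right using assms(1) K
    by (intro Bochner_Integration.integrable_sum integrable_tensor test_fun_indicator) auto
  have r_int: "integrable (cube I) (\<lambda>x. r x * K x)"
    unfolding r_def using assms(1) K by (intro integrable_tensor test_fun_indicator) auto
  have s_zero: "(LINT x|cube I. s n x * K x) = 0" if "n \<ge> n0" for n
  proof -
    have "(LINT x|cube I. s n x * K x) = (\<Sum>p\<in>P n. tensor_int I (\<lambda>i. indicator (dyadic n (p i))) K)"
      unfolding s_def sum_distrib_right tensor_int_def using assms(1) K
      by (intro Bochner_Integration.integral_sum integrable_tensor test_fun_indicator) auto
    also have "\<dots> = 0"
      using that by (intro sum.neutral ballI zero) (auto simp: P_def c_def PiE_iff)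
    finally show ?thesis .
  qed
  \<comment> \<open>A point lies in at most one of the boxes, so \<open>s n\<close> is an indicator
    and \<open>norm (K x)\<close> dominates the integrands.\<close>
  have s_eq: "s n x = of_bool ((\<lambda>i\<in>I. nat \<lfloor>2 ^ n * x i\<rfloor>) \<in> P n)" if x: "x \<in> space (cube I)" for n x
  proof -
    have "(\<Prod>i\<in>I. indicator (dyadic n (p i)) (x i) :: complex) = of_bool ((\<lambda>i\<in>I. nat \<lfloor>2 ^ n * x i\<rfloor>) = p)"
      if "p \<in> P n" for p
    proof -
      have "(\<Prod>i\<in>I. indicator (dyadic n (p i)) (x i) :: complex) = of_bool (\<forall>i\<in>I. x i \<in> dyadic n (p i))"
        using assms(1) by (rule prod_indicator)
      also have "(\<forall>i\<in>I. x i \<in> dyadic n (p i)) \<longleftrightarrow> (\<lambda>i\<in>I. nat \<lfloor>2 ^ n * x i\<rfloor>) = p"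
        using that cube_component[OF x]
        by (auto simp: mem_dyadic_iff P_def PiE_iff extensional_def fun_eq_iff restrict_def)
      finally show ?thesis .
    qed
    then have "s n x = (\<Sum>p\<in>P n. of_bool ((\<lambda>i\<in>I. nat \<lfloor>2 ^ n * x i\<rfloor>) = p))"
      unfolding s_def by (rule sum.cong[OF refl])
    also have "\<dots> = of_bool ((\<lambda>i\<in>I. nat \<lfloor>2 ^ n * x i\<rfloor>) \<in> P n)"
      using finP by (simp add: of_bool_def)
    finally show ?thesis .
  qed
  have "(\<lambda>n. LINT x|cube I. s n x * K x) \<longlonglongrightarrow> (LINT x|cube I. r x * K x)"
  proof (rule integral_dominated_convergence[where w="\<lambda>x. norm (K x)"])
    show "AE x in cube I. norm (s n x * K x) \<le> norm (K x)" for n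
      using s_eq by (intro AE_I2) (auto simp: norm_mult)
    \<comment> \<open>A coordinate equal to 1 would have index 2^n, which the cap in
      \<open>c\<close> excludes.\<close>
    have "AE x in cube I. \<forall>i\<in>I. x i \<notin> {1}"
      using assms(1) AE_cube_not_in_null[OF assms(1), of _ "{1}"] finite_imp_null_set_lborel[of "{1}"] by (auto simp: AE_finite_all)
    then show "AE x in cube I. (\<lambda>n. s n x * K x) \<longlonglongrightarrow> r x * K x"
      using AE_cube_distinct[OF assms(1)] AE_space
    proof eventually_elim
      case (elim x)
      have x: "0 \<le> x i" "x i < 1" if "i \<in> I" for i
        using elim that cube_component[OF elim(3) that] by force+
      \<comment> \<open>Below the threshold, point and threshold are eventually separated by a full
        interval; at or above it, monotonicity of the integer part excludes the index for every
        n.\<close>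
      have less: "\<forall>\<^sub>F n in sequentially. \<forall>i\<in>I. x i < t i \<longleftrightarrow> nat \<lfloor>2 ^ n * x i\<rfloor> < c n i"
      proof (intro eventually_ball_finite assms(1) ballI)
        fix i assume i: "i \<in> I"
        have pow: "nat \<lfloor>2 ^ n * x i\<rfloor> < 2 ^ n" for n
        proof -
          have "2 ^ n * x i < 2 ^ n" using x[OF i] by simp
          then have "\<lfloor>2 ^ n * x i\<rfloor> < 2 ^ n" by (simp add: floor_less_iff)
          then show ?thesis by (simp add: nat_less_iff x[OF i])
        qed
        show "\<forall>\<^sub>F n in sequentially. x i < t i \<longleftrightarrow> nat \<lfloor>2 ^ n * x i\<rfloor> < c n i"
        proof (cases "x i < t i")
          case True
          then show ?thesis using eventually_floor_less[OF x(1)[OF i] True] pow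
            by (auto simp: c_def elim: eventually_mono)
        next
          case False
          then have "nat \<lfloor>2 ^ n * t i\<rfloor> \<le> nat \<lfloor>2 ^ n * x i\<rfloor>" for n
            by (intro nat_mono floor_mono) simp
          then have "\<not> nat \<lfloor>2 ^ n * x i\<rfloor> < c n i" for n
            unfolding c_def not_less by (rule min.coboundedI2)
          then show ?thesis using False by simp
        qed
      qed
      \<comment> \<open>Distinct coordinates end up in different intervals, so dropping the boxes
        with a repeated index loses nothing in the limit.\<close>
      have "\<forall>\<^sub>F n in sequentially. \<forall>i\<in>I. \<forall>j\<in>I. i \<noteq> j \<longrightarrow> nat \<lfloor>2 ^ n * x i\<rfloor> \<noteq> nat \<lfloor>2 ^ n * x j\<rfloor>"
      proof (intro eventually_ball_finite assms(1) ballI)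
        fix i j assume ij: "i \<in> I" "j \<in> I"
        consider "i = j" | "x i < x j" | "x j < x i"
          using elim(2) ij by (metis inj_on_eq_iff linorder_neqE)
        then show "\<forall>\<^sub>F n in sequentially. i \<noteq> j \<longrightarrow> nat \<lfloor>2 ^ n * x i\<rfloor> \<noteq> nat \<lfloor>2 ^ n * x j\<rfloor>"
        proof cases
          case 2
          from eventually_floor_less[OF x(1)[OF ij(1)] 2] show ?thesis by (rule eventually_mono) (metis less_irrefl)
        next
          case 3
          from eventually_floor_less[OF x(1)[OF ij(2)] 3] show ?thesis by (rule eventually_mono) (metis less_irrefl)
        qed auto
      qed
      with less have "\<forall>\<^sub>F n in sequentially. s n x = r x"
      proof eventually_elim
        case (elim n)
        have "(\<lambda>i\<in>I. nat \<lfloor>2 ^ n * x i\<rfloor>) \<in> P n \<longleftrightarrow> (\<forall>i\<in>I. x i < t i)"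
          using elim by (auto simp: P_def PiE_iff inj_on_def)
        moreover have "r x = of_bool (\<forall>i\<in>I. x i < t i)"
          unfolding r_def using assms(1) by (simp add: prod_indicator)
        ultimately show ?case using s_eq[OF \<open>x \<in> space (cube I)\<close>] by simp
      qed
      then show ?case by (intro tendsto_eventually) (auto elim: eventually_mono)
    qed
  qed (use r_int s_int K in auto)
  moreover have "(\<lambda>n. LINT x|cube I. s n x * K x) \<longlonglongrightarrow> 0"
    using s_zero by (intro tendsto_eventually) (auto simp: eventually_sequentially)
  ultimately have "(LINT x|cube I. r x * K x) = 0"
    using LIMSEQ_unique by blast
  then show ?thesis by (simp add: tensor_int_def r_def)
qed

section \<open>Mixed differences in doubled variables\<close>

text \<open>Multilinearity in the slots of S; T is the set of those slots in which
  \<open>a i\<close> is kept.\<close>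

lemma tensor_int_expand_differences:
  assumes "finite I" "S \<subseteq> I" and H: "integrable (cube I) H"
    and a: "\<And>i. i \<in> I \<Longrightarrow> test_fun (a i)" and b: "\<And>i. i \<in> S \<Longrightarrow> test_fun (b i)"
  shows "tensor_int I (\<lambda>i. if i \<in> S then (\<lambda>x. a i x - b i x) else a i) H
      = (\<Sum>T\<in>Pow S. (-1) ^ card (S - T) * tensor_int I (\<lambda>i. if i \<in> S - T then b i else a i) H)"
proof -
  have fin: "finite S" using assms(1,2) finite_subset by blast
  let ?\<psi> = "\<lambda>T i. if i \<in> S - T then b i else a i"
  let ?\<Delta> = "\<lambda>i. if i \<in> S then (\<lambda>x. a i x - b i x) else a i"
  have "(\<Sum>T\<in>Pow S. (-1) ^ card (S - T) * tensor_int I (?\<psi> T) H)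
      = (\<Sum>T\<in>Pow S. LINT x|cube I. (-1) ^ card (S - T) * ((\<Prod>i\<in>I. ?\<psi> T i (x i)) * H x))"
    by (simp add: tensor_int_def)
  also have "\<dots> = (LINT x|cube I. (\<Sum>T\<in>Pow S. (-1) ^ card (S - T) * ((\<Prod>i\<in>I. ?\<psi> T i (x i)) * H x)))"
    using assms by (intro Bochner_Integration.integral_sum[symmetric] integrable_mult_right integrable_tensor) auto
  also have "\<dots> = tensor_int I ?\<Delta> H"
    unfolding tensor_int_def
  proof (intro Bochner_Integration.integral_cong refl)
    fix x
    have split: "(\<Prod>i\<in>I. h i) = (\<Prod>i\<in>S. h i) * (\<Prod>i\<in>I - S. h i)" for h :: "nat \<Rightarrow> complex"
      using assms(1,2) fin by (subst prod.union_disjoint[symmetric]) (auto intro!: prod.cong)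
    have "(\<Prod>i\<in>I. ?\<Delta> i (x i)) = (\<Prod>i\<in>S. a i (x i) - b i (x i)) * (\<Prod>i\<in>I - S. a i (x i))"
      unfolding split by (auto intro!: arg_cong2[where f="(*)"] prod.cong)
    also have "\<dots> = (\<Sum>T\<in>Pow S. (-1) ^ (card S - card T) * (\<Prod>i\<in>T. a i (x i)) * (\<Prod>i\<in>S - T. b i (x i))
        * (\<Prod>i\<in>I - S. a i (x i)))"
      unfolding prod_diff_conv_sum'[OF fin] sum_distrib_right ..
    also have "\<dots> = (\<Sum>T\<in>Pow S. (-1) ^ card (S - T) * (\<Prod>i\<in>I. ?\<psi> T i (x i)))"
    proof (intro sum.cong refl)
      fix T assume T: "T \<in> Pow S"
      have "(\<Prod>i\<in>S. ?\<psi> T i (x i)) = (\<Prod>i\<in>T. ?\<psi> T i (x i)) * (\<Prod>i\<in>S - T. ?\<psi> T i (x i))"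
        using T fin by (subst prod.union_disjoint[symmetric]) (auto intro!: prod.cong intro: finite_subset)
      also have "\<dots> = (\<Prod>i\<in>T. a i (x i)) * (\<Prod>i\<in>S - T. b i (x i))"
        by (auto intro!: arg_cong2[where f="(*)"] prod.cong)
      finally have "(\<Prod>i\<in>I. ?\<psi> T i (x i)) = (\<Prod>i\<in>T. a i (x i)) * (\<Prod>i\<in>S - T. b i (x i)) * (\<Prod>i\<in>I - S. a i (x i))"
        unfolding split by (auto intro!: arg_cong2[where f="(*)"] prod.cong)
      moreover have "card (S - T) = card S - card T"
        using T fin finite_subset by (intro card_Diff_subset) auto
      ultimately show "(-1) ^ (card S - card T) * (\<Prod>i\<in>T. a i (x i)) * (\<Prod>i\<in>S - T. b i (x i))
        * (\<Prod>i\<in>I - S. a i (x i)) = (-1) ^ card (S - T) * (\<Prod>i\<in>I. ?\<psi> T i (x i))"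
        by (simp add: mult.assoc)
    qed
    finally show "(\<Sum>T\<in>Pow S. (-1) ^ card (S - T) * ((\<Prod>i\<in>I. ?\<psi> T i (x i)) * H x)) = (\<Prod>i\<in>I. ?\<Delta> i (x i)) * H x"
      by (simp only: sum_distrib_right mult.assoc)
  qed
  finally show ?thesis ..
qed

text \<open>Exchanging sets between cells only gives information on differences of indicators of disjoint sets.
  To recover \<open>H\<close> we double the variables: \<open>D\<close> below is the mixed difference of \<open>H\<close> between two
  independent points \<open>(z\<^sub>1, \<dots>, z\<^sub>m)\<close> and \<open>(z\<^sub>m\<^sub>+\<^sub>1, \<dots>, z\<^sub>2\<^sub>m)\<close>. It vanishes
  almost everywhere, and integrating out the second point leaves \<open>H\<close>, because \<open>H\<close> has mean zero
  in each variable of \<open>S\<close>.\<close>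

lemma AE_zero_if_differences_vanish:
  assumes S: "S \<subseteq> {1..m}" and H: "integrable (cube {1..m}) H"
    and mean_zero: "\<And>\<phi> i. (\<And>k. k \<in> {1..m} \<Longrightarrow> test_fun (\<phi> k)) \<Longrightarrow> i \<in> S \<Longrightarrow> \<phi> i = (\<lambda>_. 1) \<Longrightarrow>
      tensor_int {1..m} \<phi> H = 0"
    and differences: "\<And>n p. n \<ge> n0 \<Longrightarrow> inj_on p {1..2 * m} \<Longrightarrow> (\<And>i. i \<in> {1..2 * m} \<Longrightarrow> p i < 2 ^ n) \<Longrightarrow>
      tensor_int {1..m} (\<lambda>i. if i \<in> S
          then (\<lambda>x. indicator (dyadic n (p i)) x - indicator (dyadic n (p (m + i))) x)
          else indicator (dyadic n (p i))) H = 0"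
  shows "AE x in cube {1..m}. H x = 0"
proof -
  define I K where "I = {1..m}" and "K = {1..2 * m}"
  \<comment> \<open>Slot i reads its value from the second copy, stored at m + i, exactly when i is
    in S - T.\<close>
  define idx where "idx T i = (if i \<in> S - T then m + i else i)" for T i
  define D where "D z = (\<Sum>T\<in>Pow S. (-1) ^ card (S - T) * H (\<lambda>i\<in>I. z (idx T i)))" for z
  have fin: "finite I" "finite K" "finite S"
    using S finite_subset by (auto simp: I_def K_def)
  have idx: "inj_on (idx T) I" "idx T ` I \<subseteq> K" for T
    using S by (auto simp: idx_def I_def K_def inj_on_def split: if_splits)
  have H': "integrable (cube I) H" using H by (simp add: I_def)
  note R = integrable_reindex[OF fin(2,1) idx H'] tensor_int_reindex(2)[OF fin(2,1) idx H']
  have D: "integrable (cube K) D"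
    unfolding D_def by (intro Bochner_Integration.integrable_sum integrable_mult_right R(1))
  have D_test: "tensor_int K \<phi> D = (\<Sum>T\<in>Pow S. (-1) ^ card (S - T) *
      ((\<Prod>k\<in>K - idx T ` I. mean (\<phi> k)) * tensor_int I (\<phi> \<circ> idx T) H))"
    if "\<And>k. k \<in> K \<Longrightarrow> test_fun (\<phi> k)" for \<phi>
  proof -
    have "tensor_int K \<phi> D
        = (\<Sum>T\<in>Pow S. (-1) ^ card (S - T) * tensor_int K \<phi> (\<lambda>z. H (\<lambda>i\<in>I. z (idx T i))))"
      unfolding D_def tensor_int_cmult[symmetric]
      using that fin by (intro tensor_int_sum integrable_mult_right R(1))
    then show ?thesis using R(2)[OF that] by simp
  qed
  have D_dyadic: "tensor_int K (\<lambda>i. indicator (dyadic n (p i))) D = 0"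
    if n: "n \<ge> n0" and p: "inj_on p K" "\<And>i. i \<in> K \<Longrightarrow> p i < 2 ^ n" for n p
  proof -
    let ?\<phi> = "\<lambda>i. indicator (dyadic n (p i)) :: real \<Rightarrow> complex"
    have mean: "(\<Prod>k\<in>K - idx T ` I. mean (?\<phi> k)) = (1 / 2 ^ n) ^ m" for T
    proof -
      have "mean (?\<phi> k) = 1 / 2 ^ n" if "k \<in> K" for k
        using p(2)[OF that] by (simp add: mean_indicator dyadic_subset measure_dyadic)
      moreover have "card (K - idx T ` I) = m"
        using idx[of T] fin by (simp add: card_Diff_subset card_image) (simp add: K_def I_def)
      ultimately show ?thesis by simp
    qed
    have "tensor_int K ?\<phi> D
        = (1 / 2 ^ n) ^ m * (\<Sum>T\<in>Pow S. (-1) ^ card (S - T) * tensor_int I (?\<phi> \<circ> idx T) H)"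
      by (subst D_test) (auto simp: mean sum_distrib_left intro!: sum.cong)
    also have "(\<Sum>T\<in>Pow S. (-1) ^ card (S - T) * tensor_int I (?\<phi> \<circ> idx T) H)
        = (\<Sum>T\<in>Pow S. (-1) ^ card (S - T) *
            tensor_int I (\<lambda>i. if i \<in> S - T then ?\<phi> (m + i) else ?\<phi> i) H)"
      by (intro sum.cong refl arg_cong2[where f="(*)"] arg_cong[where f="\<lambda>\<phi>. tensor_int I \<phi> H"])
        (auto simp: idx_def)
    also have "\<dots> = tensor_int I (\<lambda>i. if i \<in> S then (\<lambda>x. ?\<phi> i x - ?\<phi> (m + i) x) else ?\<phi> i) H"
      using S fin by (intro tensor_int_expand_differences[symmetric] H') (auto simp: I_def)
    also have "\<dots> = 0"
      using differences[OF n] p by (simp add: I_def K_def)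
    finally show ?thesis by simp
  qed
  have "AE z in cube K. D z = 0"
    by (rule AE_zero_if_tensor_int_zero[OF fin(2) D],
        rule tensor_int_zero_if_thresholds[OF fin(2) D
          tensor_int_thresholds_zero_if_distinct_dyadic[OF fin(2) D D_dyadic]])
  \<comment> \<open>Now that D is known to vanish almost everywhere, it may be tested against
    products whose factors are not disjoint.\<close>
  then have D_zero: "tensor_int K \<phi> D = 0" for \<phi>
    unfolding tensor_int_def by (intro integral_eq_zero_AE) auto
  show ?thesis
    unfolding I_def[symmetric]
  proof (rule AE_zero_if_tensor_int_zero[OF fin(1) H'])
    fix X :: "nat \<Rightarrow> real set" assume X: "\<And>i. i \<in> I \<Longrightarrow> X i \<in> sets lebesgue"
    \<comment> \<open>The constant 1 on the second copy integrates it out: every T other than S puts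
      a 1 into some slot of S, where \<open>mean_zero\<close> applies, and only T = S
      survives.\<close>
    define \<phi> where "\<phi> k = (if k \<in> I then indicator (X k) else (\<lambda>_. 1 :: complex))" for k
    have \<phi>: "test_fun (\<phi> k)" for k
      using X by (auto simp: \<phi>_def)
    have vanish: "tensor_int I (\<phi> \<circ> idx T) H = 0" if T: "T \<in> Pow S - {S}" for T
    proof -
      obtain i where i: "i \<in> S - T" using T by blast
      then have "(\<phi> \<circ> idx T) i = (\<lambda>_. 1)" using S by (auto simp: \<phi>_def idx_def I_def)
      then show ?thesis using mean_zero[of "\<phi> \<circ> idx T" i] \<phi> i by (simp add: I_def)
    qed
    have "idx S = id" by (auto simp: idx_def)
    have "0 = tensor_int K \<phi> D" by (simp add: D_zero)
    also have "\<dots> = (\<Sum>T\<in>{S}. (-1) ^ card (S - T) *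
      ((\<Prod>k\<in>K - idx T ` I. mean (\<phi> k)) * tensor_int I (\<phi> \<circ> idx T) H))"
      using \<phi> vanish fin by (subst D_test, simp, intro sum.mono_neutral_right) auto
    also have "\<dots> = tensor_int I \<phi> H"
      by (simp add: \<open>idx S = id\<close> \<phi>_def)
    also have "\<dots> = tensor_int I (\<lambda>i. indicator (X i)) H"
      by (intro tensor_int_cong) (auto simp: \<phi>_def)
    finally show "tensor_int I (\<lambda>i. indicator (X i)) H = 0" ..
  qed
qed

section \<open>Partitions with prescribed measures\<close>

lemma sum_alternating_superset:
  assumes "finite S" "U \<subseteq> S"
  shows "(\<Sum>E | E \<subseteq> S \<and> U \<subseteq> E. (-1) ^ card E) = (if U = S then (-1) ^ card S else 0 :: 'a :: comm_ring_1)"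
proof (cases "U = S")
  case True
  then have "{E. E \<subseteq> S \<and> U \<subseteq> E} = {S}" by auto
  then show ?thesis using True by simp
next
  case False
  \<comment> \<open>Adding or removing a fixed element of S - U pairs the even supersets with the
    odd ones.\<close>
  then have "card {E. E \<subseteq> S \<and> U \<subseteq> E \<and> even (card E)} = card {E. E \<subseteq> S \<and> U \<subseteq> E \<and> odd (card E)}"
    using assms by (intro card_subsupersets_even_odd) auto
  then show ?thesis
    using False assms(1) by (simp add: sum_alternating_cancels conj_assoc)
qed

lemma mixed_difference_prod:
  fixes P :: "'b \<Rightarrow> 'c :: comm_ring_1" and Q :: "'a \<Rightarrow> 'b \<Rightarrow> 'c"
  assumes "finite S" "finite T" "card T \<le> card S"
  shows "(\<Sum>E\<in>Pow S. (-1) ^ card E * (\<Prod>j\<in>T. P j + (\<Sum>i\<in>E. Q i j)))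
      = (-1) ^ card S * (\<Sum>\<sigma> | \<sigma> \<in> T \<rightarrow>\<^sub>E S \<and> bij_betw \<sigma> T S. \<Prod>j\<in>T. Q (\<sigma> j) j)"
proof -
  \<comment> \<open>A choice is an option value: \<open>None\<close> stands for \<open>P j\<close>
    and \<open>Some i\<close> for \<open>Q i j\<close>. Below, \<open>U g\<close> is the set of
    indices i that g uses, and g occurs in the expansion for E exactly when \<open>U g\<close> is
    contained in E.\<close>
  define q where "q x j = (case x of None \<Rightarrow> P j | Some i \<Rightarrow> Q i j)" for x j
  define G where "G E = T \<rightarrow>\<^sub>E insert None (Some ` E)" for E :: "'a set"
  define U where "U g = {i. Some i \<in> g ` T}" for g :: "'b \<Rightarrow> 'a option"
  have finG: "finite (G S)"
    using assms by (auto simp: G_def intro!: finite_PiE)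
  have US: "U g \<subseteq> S" if "g \<in> G S" for g
    using that by (fastforce simp: U_def G_def PiE_iff)
  have GE: "G E = {g \<in> G S. U g \<subseteq> E}" if "E \<subseteq> S" for E
  proof (intro set_eqI iffI)
    fix g assume "g \<in> G E"
    then show "g \<in> {g \<in> G S. U g \<subseteq> E}"
      using that by (fastforce simp: U_def G_def PiE_iff)
  next
    fix g assume g: "g \<in> {g \<in> G S. U g \<subseteq> E}"
    have "g j \<in> insert None (Some ` E)" if "j \<in> T" for j
    proof (cases "g j")
      case (Some i)
      then have "i \<in> U g" using that by (auto simp: U_def intro: rev_image_eqI)
      then show ?thesis using g Some by auto
    qed simp
    then show "g \<in> G E" using g by (auto simp: G_def PiE_iff)
  qed
  have expand: "(\<Prod>j\<in>T. P j + (\<Sum>i\<in>E. Q i j)) = (\<Sum>g | g \<in> G S \<and> U g \<subseteq> E. \<Prod>j\<in>T. q (g j) j)"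
    if E: "E \<subseteq> S" for E
  proof -
    have finE: "finite E" using assms(1) E finite_subset by blast
    have "P j + (\<Sum>i\<in>E. Q i j) = (\<Sum>x\<in>insert None (Some ` E). q x j)" for j
      using finE by (simp add: q_def sum.reindex image_iff)
    then have "(\<Prod>j\<in>T. P j + (\<Sum>i\<in>E. Q i j)) = (\<Sum>g\<in>G E. \<Prod>j\<in>T. q (g j) j)"
      unfolding G_def using assms(2) finE by (simp only:) (rule prod_sum_PiE, auto)
    then show ?thesis by (simp add: GE[OF E])
  qed
  have "(\<Sum>E\<in>Pow S. (-1) ^ card E * (\<Prod>j\<in>T. P j + (\<Sum>i\<in>E. Q i j)))
      = (\<Sum>E\<in>Pow S. \<Sum>g | g \<in> G S \<and> U g \<subseteq> E. (-1) ^ card E * (\<Prod>j\<in>T. q (g j) j))"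
    by (simp add: expand sum_distrib_left)
  also have "\<dots> = (\<Sum>g\<in>G S. \<Sum>E | E \<in> Pow S \<and> U g \<subseteq> E. (-1) ^ card E * (\<Prod>j\<in>T. q (g j) j))"
    using assms(1) finG by (intro sum.swap_restrict) auto
  also have "\<dots> = (\<Sum>g\<in>G S. (if U g = S then (-1) ^ card S else 0) * (\<Prod>j\<in>T. q (g j) j))"
    using assms(1) US by (simp add: sum_distrib_right[symmetric] sum_alternating_superset)
  also have "\<dots> = (\<Sum>g | g \<in> G S \<and> U g = S. (-1) ^ card S * (\<Prod>j\<in>T. q (g j) j))"
    using finG by (intro sum.mono_neutral_cong_right) auto
  also have "\<dots> = (\<Sum>\<sigma> | \<sigma> \<in> T \<rightarrow>\<^sub>E S \<and> bij_betw \<sigma> T S. (-1) ^ card S * (\<Prod>j\<in>T. Q (\<sigma> j) j))"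
  proof (rule sum.reindex_bij_witness[where i="\<lambda>\<sigma>. \<lambda>j\<in>T. Some (\<sigma> j)" and j="\<lambda>g. \<lambda>j\<in>T. the (g j)"])
    fix g assume "g \<in> {g. g \<in> G S \<and> U g = S}"
    then have g: "g \<in> G S" "U g = S" by auto
    have "Some ` S \<subseteq> g ` T" using g(2) by (auto simp: U_def)
    moreover have card: "card (Some ` S) = card S" "card (g ` T) \<le> card T"
      using assms(2) by (simp_all add: card_image card_image_le)
    ultimately have im: "g ` T = Some ` S"
      using assms by (intro card_seteq[symmetric]) auto
    then have inj: "inj_on g T"
      using assms card by (intro eq_card_imp_inj_on) auto
    have some: "g j = Some (the (g j))" "the (g j) \<in> S" if "j \<in> T" for j
    proof -
      have "g j \<in> Some ` S" using im that by blast
      then show "g j = Some (the (g j))" "the (g j) \<in> S" by auto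
    qed
    show "(\<lambda>j\<in>T. Some ((\<lambda>j\<in>T. the (g j)) j)) = g"
      using g(1) some(1)[symmetric] by (auto simp: G_def PiE_iff extensional_def fun_eq_iff)
    have "inj_on (\<lambda>j\<in>T. the (g j)) T"
    proof (rule inj_onI)
      fix j j' assume "j \<in> T" "j' \<in> T" "(\<lambda>j\<in>T. the (g j)) j = (\<lambda>j\<in>T. the (g j)) j'"
      then have "g j = g j'" using some(1)[of j] some(1)[of j'] by (metis restrict_apply')
      then show "j = j'" using inj \<open>j \<in> T\<close> \<open>j' \<in> T\<close> by (auto dest: inj_onD)
    qed
    moreover have "(\<lambda>j\<in>T. the (g j)) ` T = S"
    proof (intro equalityI subsetI)
      fix i assume "i \<in> S"
      then have "Some i \<in> g ` T" by (simp add: im)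
      then obtain j where "j \<in> T" "g j = Some i" by (metis imageE)
      then show "i \<in> (\<lambda>j\<in>T. the (g j)) ` T" by (intro image_eqI[of _ _ j]) auto
    qed (use some(2) in auto)
    ultimately show "(\<lambda>j\<in>T. the (g j)) \<in> {\<sigma>. \<sigma> \<in> T \<rightarrow>\<^sub>E S \<and> bij_betw \<sigma> T S}"
      using some(2) by (auto simp: bij_betw_def)
    have "Q ((\<lambda>j\<in>T. the (g j)) j) j = q (g j) j" if "j \<in> T" for j
      using that some(1)[OF that] unfolding q_def by (metis option.simps(5) restrict_apply')
    then show "(-1) ^ card S * (\<Prod>j\<in>T. Q ((\<lambda>j\<in>T. the (g j)) j) j) = (-1) ^ card S * (\<Prod>j\<in>T. q (g j) j)"
      by (simp cong: prod.cong)
  next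
    fix \<sigma> assume \<sigma>: "\<sigma> \<in> {\<sigma>. \<sigma> \<in> T \<rightarrow>\<^sub>E S \<and> bij_betw \<sigma> T S}"
    then show "(\<lambda>j\<in>T. the ((\<lambda>j\<in>T. Some (\<sigma> j)) j)) = \<sigma>"
      by (auto simp: PiE_iff extensional_def fun_eq_iff)
    have "\<sigma> ` T = S" using \<sigma> by (auto simp: bij_betw_def)
    then show "(\<lambda>j\<in>T. Some (\<sigma> j)) \<in> {g. g \<in> G S \<and> U g = S}"
      by (auto simp: G_def U_def image_iff)
  qed
  finally show ?thesis by (simp add: sum_distrib_left)
qed

section \<open>Cutting Lebesgue sets into pieces of given measures\<close>

lemma lmeasurable_if_subset_unit:
  assumes "R \<in> sets lebesgue" "R \<subseteq> {0..1::real}"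
  shows "R \<in> lmeasurable"
proof (rule fmeasurableI2[OF _ assms(2,1)])
  show "{0..1::real} \<in> lmeasurable" using lmeasurable_cbox[of 0 "1::real"] by simp
qed

text \<open>The measure of the part of R up to t is 1-Lipschitz in t, is 0 at t = -1 and equals the
  measure of R at t = 1, so the intermediate value theorem provides the cut.\<close>

lemma exists_subset_of_measure:
  fixes R :: "real set"
  assumes R: "R \<in> sets lebesgue" "R \<subseteq> {0..1}" and r: "0 \<le> r" "r \<le> measure lebesgue R"
  obtains C where "C \<in> sets lebesgue" "C \<subseteq> R" "measure lebesgue C = r"
proof -
  define h where "h t = measure lebesgue (R \<inter> {..t})" for t
  have lm: "R \<inter> {..t} \<in> lmeasurable" for t
    using R by (intro lmeasurable_if_subset_unit sets.Int) (auto intro: sets_completionI_sets)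
  have "dist (h s) (h t) \<le> dist s t" for s t
  proof (induction s t rule: linorder_wlog)
    case (le s t)
    have "h t \<le> measure lebesgue ((R \<inter> {..s}) \<union> {s..t})"
      unfolding h_def using lm[of s] lm[of t] by (intro measure_mono_fmeasurable) auto
    also have "\<dots> \<le> h s + measure lebesgue {s..t}"
      unfolding h_def using lm[of s] by (intro measure_Un_le) auto
    finally have "h t \<le> h s + (t - s)" using le by simp
    moreover have "h s \<le> h t"
      unfolding h_def using lm[of s] lm[of t] le by (intro measure_mono_fmeasurable) auto
    ultimately show ?case using le by (simp add: dist_real_def)
  qed (simp add: dist_commute)
  moreover have "continuous_on {-1..1} h" if "\<And>s t. dist (h s) (h t) \<le> dist s t"
    using that
    unfolding continuous_on_iff
  proof (intro ballI allI impI)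
    fix x e :: real assume "0 < e" and *: "\<And>s t. dist (h s) (h t) \<le> dist s t"
    then show "\<exists>d>0. \<forall>x'\<in>{-1..1}. dist x' x < d \<longrightarrow> dist (h x') (h x) < e"
      by (intro exI[of _ e]) (auto intro: le_less_trans[OF *])
  qed
  moreover have "h (-1) = 0"
  proof -
    have "R \<inter> {..-1} = {}" using R(2) by fastforce
    then show ?thesis by (simp add: h_def)
  qed
  moreover have "h 1 = measure lebesgue R"
  proof -
    have "R \<inter> {..1} = R" using R(2) by fastforce
    then show ?thesis by (simp add: h_def)
  qed
  ultimately obtain t where "h t = r"
    using IVT'[of h "-1" r 1] r by force
  then show thesis using that[of "R \<inter> {..t}"] lm[of t] by (auto simp: h_def fmeasurable_def)
qed

text \<open>Pieces are cut off one at a time. The last piece takes all that is left, because the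
  union must be exactly R; this is why the induction starts from one piece, since even a null
  remainder has to go somewhere.\<close>

lemma exists_partition_of_measures:
  fixes R :: "real set"
  assumes "finite J" "J \<noteq> {}" "R \<in> sets lebesgue" "R \<subseteq> {0..1}"
    and "\<And>j. j \<in> J \<Longrightarrow> 0 \<le> r j" "(\<Sum>j\<in>J. r j) = measure lebesgue R"
  shows "\<exists>B. (\<forall>j\<in>J. B j \<in> sets lebesgue \<and> measure lebesgue (B j) = r j) \<and>
      disjoint_family_on B J \<and> (\<Union>j\<in>J. B j) = R"
  using assms
proof (induction J arbitrary: R rule: finite_ne_induct)
  case (singleton j)
  then show ?case by (intro exI[of _ "\<lambda>_. R"]) (auto simp: disjoint_family_on_def)
next
  case (insert j J)
  have sum: "(\<Sum>i\<in>J. r i) = measure lebesgue R - r j" "r j \<le> measure lebesgue R"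
    using insert.prems insert.hyps sum_nonneg[of J r] by auto
  then obtain C where C: "C \<in> sets lebesgue" "C \<subseteq> R" "measure lebesgue C = r j"
    using exists_subset_of_measure[of R "r j"] insert.prems by auto
  have "R \<in> lmeasurable"
    using insert.prems by (intro lmeasurable_if_subset_unit) auto
  then have "measure lebesgue (R - C) = measure lebesgue R - r j"
    using C measurable_measure_Diff[of R lebesgue C] by simp
  then have "\<exists>B. (\<forall>i\<in>J. B i \<in> sets lebesgue \<and> measure lebesgue (B i) = r i) \<and>
      disjoint_family_on B J \<and> (\<Union>i\<in>J. B i) = R - C"
    using insert.prems C(1) sum(1) by (intro insert.IH) auto
  then obtain B where B: "\<And>i. i \<in> J \<Longrightarrow> B i \<in> sets lebesgue \<and> measure lebesgue (B i) = r i"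
    "disjoint_family_on B J" "(\<Union>i\<in>J. B i) = R - C"
    by blast
  have BC: "B i \<inter> C = {}" if "i \<in> J" for i
    using B(3) that by auto
  show ?case
  proof (intro exI[of _ "B(j := C)"] conjI)
    show "\<forall>i\<in>insert j J. (B(j := C)) i \<in> sets lebesgue \<and> measure lebesgue ((B(j := C)) i) = r i"
      using B(1) C by simp
    have "disjoint_family_on (B(j := C)) J"
      using B(2) insert.hyps(3) by (simp add: disjoint_family_on_def)
    moreover have "C \<inter> (\<Union>i\<in>J. (B(j := C)) i) = {}"
      using BC insert.hyps(3) by auto
    ultimately show "disjoint_family_on (B(j := C)) (insert j J)"
      using insert.hyps(3) by (simp add: disjoint_family_on_insert)
    have "(\<Union>i\<in>J. (B(j := C)) i) = (\<Union>i\<in>J. B i)"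
      using insert.hyps(3) by (intro SUP_cong) auto
    then show "(\<Union>i\<in>insert j J. (B(j := C)) i) = R"
      using C(2) B(3) by (simp only: UN_insert fun_upd_same) blast
  qed
qed

definition prescribed_partition :: "nat \<Rightarrow> (nat \<Rightarrow> real) \<Rightarrow> (nat \<Rightarrow> real set) \<Rightarrow> bool" where
  "prescribed_partition m \<alpha> A \<longleftrightarrow> (\<forall>i\<in>{1..m}. A i \<in> sets lebesgue) \<and> disjoint_family_on A {1..m} \<and>
     (\<Union>i\<in>{1..m}. A i) = {0..1} \<and> (\<forall>i\<in>{1..m}. measure lebesgue (A i) = \<alpha> i)"

text \<open>One family A serves every assignment c of the pieces that gives cell j the same number
  \<open>N j\<close> of them: A j is cut from the rest of [0,1] with measure \<alpha> j - N j *
  \<delta>. Partitions obtained from different c then differ only in where the pieces lie, which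
  allows them to be compared in a mixed difference.\<close>

lemma exists_partition_with_prescribed_pieces:
  fixes E :: "'a \<Rightarrow> real set"
  assumes "m \<ge> 1" and \<alpha>: "(\<Sum>i\<in>{1..m}. \<alpha> i) = 1"
    and Z: "finite Z" "disjoint_family_on E Z"
    and E: "\<And>z. z \<in> Z \<Longrightarrow> E z \<in> sets lebesgue" "\<And>z. z \<in> Z \<Longrightarrow> E z \<subseteq> {0..1}"
      "\<And>z. z \<in> Z \<Longrightarrow> measure lebesgue (E z) = \<delta>"
    and N: "(\<Sum>j\<in>{1..m}. N j) = card Z" "\<And>j. j \<in> {1..m} \<Longrightarrow> real (N j) * \<delta> \<le> \<alpha> j"
  obtains A where
    "\<forall>c\<in>Z \<rightarrow> {1..m}. (\<forall>j\<in>{1..m}. card {z \<in> Z. c z = j} = N j) \<longrightarrow>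
      prescribed_partition m \<alpha> (\<lambda>j. A j \<union> (\<Union>z\<in>{z \<in> Z. c z = j}. E z))"
    "\<forall>j\<in>{1..m}. \<forall>z\<in>Z. A j \<inter> E z = {}"
proof -
  define R where "R = {0..1} - (\<Union>z\<in>Z. E z)"
  have lm: "E z \<in> lmeasurable" if "z \<in> Z" for z
    using E that by (intro lmeasurable_if_subset_unit) auto
  have union: "(\<Union>z\<in>Y. E z) \<in> lmeasurable" "measure lebesgue (\<Union>z\<in>Y. E z) = real (card Y) * \<delta>"
    if "Y \<subseteq> Z" for Y
  proof -
    have finY: "finite Y" using Z(1) that finite_subset by blast
    show "(\<Union>z\<in>Y. E z) \<in> lmeasurable" using finY lm that by (intro fmeasurable.finite_UN) auto
    have "measure lebesgue (\<Union>z\<in>Y. E z) = (\<Sum>z\<in>Y. measure lebesgue (E z))"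
      using finY that Z(2) E(1) fmeasurableD2[OF lm]
      by (intro measure_finite_Union) (auto simp: disjoint_family_on_def subset_iff)
    also have "\<dots> = real (card Y) * \<delta>" using E(3) that by (simp add: subset_iff)
    finally show "measure lebesgue (\<Union>z\<in>Y. E z) = real (card Y) * \<delta>" .
  qed
  have unit: "{0..1::real} \<in> lmeasurable"
    by (rule lmeasurable_if_subset_unit) auto
  have R: "R \<in> sets lebesgue" "R \<subseteq> {0..1}"
    using unit union(1)[of Z] by (auto simp: R_def fmeasurable_def)
  have "measure lebesgue R = measure lebesgue {0..1::real} - measure lebesgue (\<Union>z\<in>Z. E z)"
    unfolding R_def using union(1)[of Z] E(2) unit by (intro measurable_measure_Diff) (auto simp: fmeasurable_def)
  then have "measure lebesgue R = 1 - real (card Z) * \<delta>"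
    by (simp add: union(2)[of Z])
  also have "\<dots> = (\<Sum>j\<in>{1..m}. \<alpha> j - real (N j) * \<delta>)"
    using \<alpha> by (simp add: sum_subtractf sum_distrib_right[symmetric] N(1)[symmetric])
  finally have "\<exists>A. (\<forall>j\<in>{1..m}. A j \<in> sets lebesgue \<and> measure lebesgue (A j) = \<alpha> j - real (N j) * \<delta>) \<and>
      disjoint_family_on A {1..m} \<and> (\<Union>j\<in>{1..m}. A j) = R"
    using assms(1) N(2) R by (intro exists_partition_of_measures) auto
  then obtain A where A: "\<And>j. j \<in> {1..m} \<Longrightarrow> A j \<in> sets lebesgue \<and> measure lebesgue (A j) = \<alpha> j - real (N j) * \<delta>"
    "disjoint_family_on A {1..m}" "(\<Union>j\<in>{1..m}. A j) = R"
    by blast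
  have AE_disj: "A j \<inter> E z = {}" if "j \<in> {1..m}" "z \<in> Z" for j z
    using A(3) that by (auto simp: R_def)
  show thesis
  proof (rule that; intro ballI impI)
    fix c assume c: "c \<in> Z \<rightarrow> {1..m}" and "\<forall>j\<in>{1..m}. card {z \<in> Z. c z = j} = N j"
    then have card: "card {z \<in> Z. c z = j} = N j" if "j \<in> {1..m}" for j
      using that by blast
    let ?A = "\<lambda>j. A j \<union> (\<Union>z\<in>{z \<in> Z. c z = j}. E z)"
    have sub: "{z \<in> Z. c z = j} \<subseteq> Z" for j by auto
    have Alm: "A j \<in> lmeasurable" if "j \<in> {1..m}" for j
      using A that by (intro lmeasurable_if_subset_unit) (auto simp: R_def)
    have "measure lebesgue (?A j) = \<alpha> j" if j: "j \<in> {1..m}" for j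
    proof -
      have "measure lebesgue (?A j) = measure lebesgue (A j) + measure lebesgue (\<Union>z\<in>{z \<in> Z. c z = j}. E z)"
        using Alm[OF j] union(1)[OF sub[of j]] AE_disj[OF j]
        by (intro measure_Union) (auto simp: fmeasurableD fmeasurableD2 simp del: emeasure_completion)
      then show ?thesis using A(1)[OF j] union(2)[OF sub[of j]] card[OF j] by simp
    qed
    moreover have "?A j \<in> sets lebesgue" if j: "j \<in> {1..m}" for j
      using Alm[OF j] union(1)[OF sub[of j]] by (auto simp: fmeasurable_def)
    moreover have "disjoint_family_on ?A {1..m}"
      unfolding disjoint_family_on_def
    proof (intro ballI impI)
      fix i j assume ij: "i \<in> {1..m}" "j \<in> {1..m}" "i \<noteq> j"
      have "A i \<inter> A j = {}"
        using disjoint_family_onD[OF A(2)] ij by blast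
      moreover have "A i \<inter> (\<Union>z\<in>{z \<in> Z. c z = j}. E z) = {}"
        using AE_disj[OF ij(1)] by auto
      moreover have "(\<Union>z\<in>{z \<in> Z. c z = i}. E z) \<inter> A j = {}"
        using AE_disj[OF ij(2)] by auto
      moreover have "(\<Union>z\<in>{z \<in> Z. c z = i}. E z) \<inter> (\<Union>z\<in>{z \<in> Z. c z = j}. E z) = {}"
      proof (rule equals0I)
        fix x assume "x \<in> (\<Union>z\<in>{z \<in> Z. c z = i}. E z) \<inter> (\<Union>z\<in>{z \<in> Z. c z = j}. E z)"
        then obtain z z' where z: "z \<in> Z" "c z = i" "x \<in> E z" "z' \<in> Z" "c z' = j" "x \<in> E z'" by auto
        then have "z \<noteq> z'" using ij(3) by auto
        then show False using disjoint_family_onD[OF Z(2) z(1,4)] z by auto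
      qed
      ultimately show "?A i \<inter> ?A j = {}"
        by (simp only: Int_Un_distrib Int_Un_distrib2 Un_empty_left)
    qed
    moreover have "(\<Union>j\<in>{1..m}. ?A j) = {0..1}"
    proof -
      have "(\<Union>j\<in>{1..m}. \<Union>z\<in>{z \<in> Z. c z = j}. E z) = (\<Union>z\<in>Z. E z)"
        using c by auto
      then have "(\<Union>j\<in>{1..m}. ?A j) = R \<union> (\<Union>z\<in>Z. E z)"
        by (simp only: UN_Un_distrib A(3))
      then show ?thesis using E(2) by (auto simp: R_def)
    qed
    ultimately show "prescribed_partition m \<alpha> ?A" by (simp add: prescribed_partition_def)
  qed (rule AE_disj)
qed

section \<open>Walsh levels\<close>

declare One_nat_def [simp del]

lemma tensor_int_cong_AE:
  assumes "\<And>i. i \<in> I \<Longrightarrow> test_fun (\<phi> i)" "integrable (cube I) g" "integrable (cube I) h"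
    and "AE x in cube I. g x = h x"
  shows "tensor_int I \<phi> g = tensor_int I \<phi> h"
  unfolding tensor_int_def using assms
  by (intro integral_cong_AE borel_measurable_times measurable_tensor) (auto elim: eventually_mono)

lemma tensor_int_constant_slots:
  assumes "finite I" "T \<subseteq> I"
  shows "tensor_int I (\<lambda>j. if j \<in> T then \<phi> j else (\<lambda>_. c j)) g
      = (\<Prod>j\<in>I - T. c j) * tensor_int I (\<lambda>j. if j \<in> T then \<phi> j else (\<lambda>_. 1)) g"
proof -
  have "(\<Prod>j\<in>I. (if j \<in> T then \<phi> j else (\<lambda>_. c j)) (x j))
      = (\<Prod>j\<in>I - T. c j) * (\<Prod>j\<in>I. (if j \<in> T then \<phi> j else (\<lambda>_. 1)) (x j))" for x :: "nat \<Rightarrow> real"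
  proof -
    have "(\<Prod>j\<in>I. (if j \<in> T then \<phi> j else (\<lambda>_. c j)) (x j))
        = (\<Prod>j\<in>I. (if j \<in> I - T then c j else 1) * (if j \<in> T then \<phi> j else (\<lambda>_. 1)) (x j))"
      by (intro prod.cong) auto
    also have "\<dots> = (\<Prod>j\<in>I. if j \<in> I - T then c j else 1) * (\<Prod>j\<in>I. (if j \<in> T then \<phi> j else (\<lambda>_. 1)) (x j))"
      by (rule prod.distrib)
    also have "(\<Prod>j\<in>I. if j \<in> I - T then c j else 1) = (\<Prod>j\<in>I - T. c j)"
      using assms(1) by (intro prod.mono_neutral_cong_right) auto
    finally show ?thesis .
  qed
  then show ?thesis by (simp add: tensor_int_def mult.assoc)
qed

lemma tensor_int_slot_zero:
  assumes "finite I" "i \<in> I" "\<And>x. \<phi> i x = 0"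
  shows "tensor_int I \<phi> g = 0"
proof -
  have "(\<Prod>j\<in>I. \<phi> j (x j)) = 0" for x :: "nat \<Rightarrow> real"
    using assms by (intro prod_zero) auto
  then show ?thesis by (simp add: tensor_int_def)
qed

lemma tensor_int_slot_sum:
  assumes "finite I" "i \<in> I" "integrable (cube I) g"
    and \<phi>: "\<And>j. j \<in> I \<Longrightarrow> test_fun (\<phi> j)" and \<psi>: "\<And>a. a \<in> A \<Longrightarrow> test_fun (\<psi> a)"
  shows "tensor_int I (\<phi>(i := \<lambda>x. \<Sum>a\<in>A. \<psi> a x)) g = (\<Sum>a\<in>A. tensor_int I (\<phi>(i := \<psi> a)) g)"
proof -
  have "(\<Prod>j\<in>I. (\<phi>(i := \<lambda>x. \<Sum>a\<in>A. \<psi> a x)) j (x j)) = (\<Sum>a\<in>A. \<Prod>j\<in>I. (\<phi>(i := \<psi> a)) j (x j))"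
    for x :: "nat \<Rightarrow> real"
    using assms(1,2) by (simp add: prod.remove sum_distrib_right)
  then have "tensor_int I (\<phi>(i := \<lambda>x. \<Sum>a\<in>A. \<psi> a x)) g
      = (LINT x|cube I. (\<Sum>a\<in>A. (\<Prod>j\<in>I. (\<phi>(i := \<psi> a)) j (x j)) * g x))"
    by (simp only: tensor_int_def sum_distrib_right)
  also have "\<dots> = (\<Sum>a\<in>A. tensor_int I (\<phi>(i := \<psi> a)) g)"
    unfolding tensor_int_def using assms
    by (intro Bochner_Integration.integral_sum integrable_tensor) auto
  finally show ?thesis .
qed

section \<open>The defining properties of the Walsh expansion, tested against products\<close>

context
  fixes m :: nat and f :: "(nat \<Rightarrow> real) \<Rightarrow> complex"
  assumes f: "integrable (cube {1..m}) f"
begin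

text \<open>Separates the means of the factors outside S, the source of the weights, from a quantity
  that sees only the factors in S.\<close>

lemma tensor_int_walsh_slots:
  assumes "S \<subseteq> {1..m}" "\<And>k. k \<in> {1..m} \<Longrightarrow> test_fun (\<phi> k)"
  shows "tensor_int {1..m} \<phi> (walsh m f S) = (\<Prod>j\<in>{1..m} - S. mean (\<phi> j)) *
    tensor_int {1..m} (\<lambda>j. if j \<in> S then (\<lambda>x. \<phi> j x - mean (\<phi> j)) else (\<lambda>_. 1)) f"
proof -
  have "tensor_int {1..m} \<phi> (walsh m f S) = tensor_int {1..m} (centred S \<phi>) f"
    using assms by (intro tensor_int_walsh f)
  also have "centred S \<phi> = (\<lambda>j. if j \<in> S then (\<lambda>x. \<phi> j x - mean (\<phi> j)) else (\<lambda>_. mean (\<phi> j)))"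
    by (auto simp: centred_def)
  also have "tensor_int {1..m} \<dots> f = (\<Prod>j\<in>{1..m} - S. mean (\<phi> j)) *
    tensor_int {1..m} (\<lambda>j. if j \<in> S then (\<lambda>x. \<phi> j x - mean (\<phi> j)) else (\<lambda>_. 1)) f"
    using assms(1) by (intro tensor_int_constant_slots) auto
  finally show ?thesis .
qed

text \<open>Centring the constant 1 gives 0. This is the tested form of mean zero of F_S in the
  variable i.\<close>

lemma tensor_int_walsh_one:
  assumes "S \<subseteq> {1..m}" "\<And>k. k \<in> {1..m} \<Longrightarrow> test_fun (\<phi> k)" "i \<in> S" "\<phi> i = (\<lambda>_. 1)"
  shows "tensor_int {1..m} \<phi> (walsh m f S) = 0"
proof -
  have "tensor_int {1..m} (\<lambda>j. if j \<in> S then (\<lambda>x. \<phi> j x - mean (\<phi> j)) else (\<lambda>_. 1)) f = 0"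
    using assms(1,3,4) by (intro tensor_int_slot_zero[where i=i]) auto
  then show ?thesis
    by (subst tensor_int_walsh_slots[OF assms(1,2)]) auto
qed

text \<open>The tested form of the fact that F_S does not depend on coordinate l.\<close>

lemma tensor_int_walsh_free_slot:
  assumes S: "S \<subseteq> {1..m}" and \<phi>: "\<And>k. k \<in> {1..m} \<Longrightarrow> test_fun (\<phi> k)"
    and l: "l \<in> {1..m} - S" and \<psi>: "test_fun \<psi>"
  shows "tensor_int {1..m} (\<phi>(l := \<psi>)) (walsh m f S)
    = mean \<psi> * tensor_int {1..m} (\<phi>(l := \<lambda>_. 1)) (walsh m f S)"
proof -
  have eq: "(\<lambda>j. if j \<in> S then (\<lambda>x. (\<phi>(l := \<psi>)) j x - mean ((\<phi>(l := \<psi>)) j)) else (\<lambda>_. 1))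
      = (\<lambda>j. if j \<in> S then (\<lambda>x. (\<phi>(l := \<lambda>_. 1)) j x - mean ((\<phi>(l := \<lambda>_. 1)) j)) else (\<lambda>_. 1))"
    for \<psi> using l by auto
  have prod: "(\<Prod>j\<in>{1..m} - S. mean ((\<phi>(l := \<psi>)) j)) = mean \<psi> * (\<Prod>j\<in>{1..m} - S - {l}. mean (\<phi> j))"
    for \<psi> using l by (subst prod.remove[of _ l]) auto
  have "tensor_int {1..m} (\<phi>(l := \<psi>)) (walsh m f S) =
      mean \<psi> * (\<Prod>j\<in>{1..m} - S - {l}. mean (\<phi> j)) * tensor_int {1..m}
        (\<lambda>j. if j \<in> S then (\<lambda>x. (\<phi>(l := \<lambda>_. 1)) j x - mean ((\<phi>(l := \<lambda>_. 1)) j)) else (\<lambda>_. 1)) f"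
    if "test_fun \<psi>" for \<psi>
  proof -
    have "test_fun ((\<phi>(l := \<psi>)) k)" if "k \<in> {1..m}" for k
      using \<open>test_fun \<psi>\<close> \<phi> that by simp
    then show ?thesis
      by (simp only: tensor_int_walsh_slots[OF S] eq[of \<psi>] prod)
  qed
  from this[OF \<psi>] this[of "\<lambda>_. 1"] show ?thesis by simp
qed

text \<open>The tested form of f being the sum of its components: write every factor as its centred
  part plus its mean and expand.\<close>

lemma tensor_int_eq_sum_walsh:
  assumes \<phi>: "\<And>k. k \<in> {1..m} \<Longrightarrow> test_fun (\<phi> k)"
  shows "tensor_int {1..m} \<phi> f = (\<Sum>S\<in>Pow {1..m}. tensor_int {1..m} \<phi> (walsh m f S))"
proof -
  let ?I = "{1..m}"
  have "(\<Sum>S\<in>Pow ?I. tensor_int ?I \<phi> (walsh m f S)) = (\<Sum>S\<in>Pow ?I. tensor_int ?I (centred S \<phi>) f)"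
    using \<phi> f by (intro sum.cong refl tensor_int_walsh) auto
  also have "\<dots> = (LINT x|cube ?I. (\<Sum>S\<in>Pow ?I. (\<Prod>i\<in>?I. centred S \<phi> i (x i)) * f x))"
    unfolding tensor_int_def using \<phi> f
    by (intro Bochner_Integration.integral_sum[symmetric] integrable_tensor) (auto simp: centred_def)
  also have "\<dots> = tensor_int ?I \<phi> f"
    unfolding tensor_int_def
  proof (intro Bochner_Integration.integral_cong refl)
    fix x :: "nat \<Rightarrow> real"
    have "(\<Prod>i\<in>?I. \<phi> i (x i)) = (\<Prod>i\<in>?I. (\<phi> i (x i) - mean (\<phi> i)) + mean (\<phi> i))" by simp
    also have "\<dots> = (\<Sum>S\<in>Pow ?I. (\<Prod>i\<in>S. \<phi> i (x i) - mean (\<phi> i)) * (\<Prod>i\<in>?I - S. mean (\<phi> i)))"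
      by (rule prod_add) simp
    also have "\<dots> = (\<Sum>S\<in>Pow ?I. \<Prod>i\<in>?I. centred S \<phi> i (x i))"
    proof (intro sum.cong refl)
      fix S assume "S \<in> Pow ?I"
      then have "(\<Prod>i\<in>?I. centred S \<phi> i (x i)) = (\<Prod>i\<in>?I - S. centred S \<phi> i (x i)) * (\<Prod>i\<in>S. centred S \<phi> i (x i))"
        by (intro prod.subset_diff) auto
      moreover have "(\<Prod>i\<in>S. centred S \<phi> i (x i)) = (\<Prod>i\<in>S. \<phi> i (x i) - mean (\<phi> i))"
        by (intro prod.cong) (auto simp: centred_def)
      moreover have "(\<Prod>i\<in>?I - S. centred S \<phi> i (x i)) = (\<Prod>i\<in>?I - S. mean (\<phi> i))"
        by (intro prod.cong) (auto simp: centred_def)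
      ultimately show "(\<Prod>i\<in>S. \<phi> i (x i) - mean (\<phi> i)) * (\<Prod>i\<in>?I - S. mean (\<phi> i)) = (\<Prod>i\<in>?I. centred S \<phi> i (x i))"
        by (simp only: mult.commute)
    qed
    finally show "(\<Sum>S\<in>Pow ?I. (\<Prod>i\<in>?I. centred S \<phi> i (x i)) * f x) = (\<Prod>i\<in>?I. \<phi> i (x i)) * f x"
      by (simp add: sum_distrib_right)
  qed
  finally show ?thesis ..
qed

end

section \<open>The cells of a partition as test functions\<close>

lemma prescribed_partition_subset: "prescribed_partition m \<alpha> A \<Longrightarrow> i \<in> {1..m} \<Longrightarrow> A i \<subseteq> {0..1}"
  by (auto simp: prescribed_partition_def)

lemma prescribed_partition_test_fun:
  "prescribed_partition m \<alpha> A \<Longrightarrow> i \<in> {1..m} \<Longrightarrow> test_fun (indicator (A i))"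
  by (auto simp: prescribed_partition_def)

lemma prescribed_partition_mean:
  "prescribed_partition m \<alpha> A \<Longrightarrow> i \<in> {1..m} \<Longrightarrow> mean (indicator (A i)) = complex_of_real (\<alpha> i)"
  using prescribed_partition_subset[of m \<alpha> A i] by (simp add: mean_indicator prescribed_partition_def)

lemma prescribed_partition_sum_indicator:
  assumes "prescribed_partition m \<alpha> A" "x \<in> {0..1}"
  shows "(\<Sum>l\<in>{1..m}. indicator (A l) x :: complex) = 1"
proof -
  have "disjoint_family_on A {1..m}" "(\<Union>i\<in>{1..m}. A i) = {0..1}"
    using assms(1) by (auto simp: prescribed_partition_def)
  then obtain i where i: "i \<in> {1..m}" "x \<in> A i" using assms(2) by blast
  have "(\<Sum>l\<in>{1..m}. indicator (A l) x :: complex) = (\<Sum>l\<in>{i}. indicator (A l) x)"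
  proof (intro sum.mono_neutral_right ballI)
    fix l assume "l \<in> {1..m} - {i}"
    then have "A l \<inter> A i = {}"
      using disjoint_family_onD[OF \<open>disjoint_family_on A {1..m}\<close>, of l i] i by blast
    then show "(indicator (A l) x :: complex) = 0" using i by (auto simp: indicator_def)
  qed (use i in auto)
  then show ?thesis using i by simp
qed

text \<open>Antisymmetry and (iii) enter in tested form, with the swap of coordinates moved to the
  test functions. The count covers the top level too: for k = m no l lies outside S, and mean zero
  with antisymmetry alone gives \<open>d S = 0\<close>.\<close>

lemma sum_walsh_level_eq_0:
  assumes f: "integrable (cube {1..m}) f"
    and \<alpha>: "\<And>i. i \<in> {1..m} \<Longrightarrow> 0 < \<alpha> i"
    and A: "prescribed_partition m \<alpha> A"
    and k: "1 \<le> k" "k \<le> m"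
    and alternating: "\<And>S i j \<phi>. S \<subseteq> {1..m} \<Longrightarrow> card S = k \<Longrightarrow> i \<in> S \<Longrightarrow> j \<in> S \<Longrightarrow> i \<noteq> j \<Longrightarrow>
      (\<And>k. k \<in> {1..m} \<Longrightarrow> test_fun (\<phi> k)) \<Longrightarrow>
      tensor_int {1..m} (\<phi> \<circ> Transposition.transpose i j) (walsh m f S) = - tensor_int {1..m} \<phi> (walsh m f S)"
    and relation: "\<And>S l \<phi>. S \<subseteq> {1..m} \<Longrightarrow> card S = k \<Longrightarrow> l \<in> {1..m} - S \<Longrightarrow>
      (\<And>k. k \<in> {1..m} \<Longrightarrow> test_fun (\<phi> k)) \<Longrightarrow>
      tensor_int {1..m} \<phi> (walsh m f S) / complex_of_real (\<Prod>i\<in>S. \<alpha> i) =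
        (\<Sum>i\<in>S. tensor_int {1..m} (\<phi> \<circ> Transposition.transpose l i) (walsh m f (insert l S - {i}))
          / complex_of_real (\<Prod>j\<in>insert l S - {i}. \<alpha> j))"
  shows "(\<Sum>S | S \<subseteq> {1..m} \<and> card S = k. tensor_int {1..m} (\<lambda>i. indicator (A i)) (walsh m f S)) = 0"
proof -
  define I where "I = {1..m}"
  define \<phi> :: "nat \<Rightarrow> real \<Rightarrow> complex" where "\<phi> i = indicator (A i)" for i
  define d where "d S = tensor_int I \<phi> (walsh m f S)" for S
  \<comment> \<open>This is the integral of F_S with the cell A l in both slots i and l. Slot l is
    seen only through its mean, so interchanging the cells of slots i and l differs from it just by
    having \<alpha> i in place of \<alpha> l; the quotient corrects this and gives \<open>c\<close>
    the form that occurs in (iii).\<close>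
  define c where "c S i l = \<alpha> l / \<alpha> i * tensor_int I (\<phi> \<circ> Transposition.transpose i l) (walsh m f S)" for S i l
  define L where "L = {S. S \<subseteq> I \<and> card S = k}"
  have finI: "finite I" and finL: "finite L" by (auto simp: I_def L_def)
  have finS: "finite S" if "S \<in> L" for S
    using that finI finite_subset by (auto simp: L_def)
  have \<phi>: "test_fun (\<phi> i)" "mean (\<phi> i) = \<alpha> i" if "i \<in> I" for i
    using that A prescribed_partition_test_fun prescribed_partition_mean by (auto simp: \<phi>_def I_def)
  have \<alpha>0: "\<alpha> i \<noteq> 0" if "i \<in> I" for i using \<alpha>[of i] that by (auto simp: I_def)
  have walsh: "integrable (cube I) (walsh m f S)" if "S \<in> L" for S
    using that f by (auto simp: L_def I_def intro: integrable_walsh)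
  have replace: "d S + (\<Sum>l\<in>I - S. c S i l) = 0" if S: "S \<in> L" and i: "i \<in> S" for S i
  proof -
    have SI: "S \<subseteq> {1..m}" "S \<subseteq> I" "card S = k" "i \<in> I" using S i by (auto simp: L_def I_def)
    have one: "test_fun ((\<phi>(i := \<lambda>_. 1)) j)" if "j \<in> I" for j using \<phi> that by simp
    have "0 = tensor_int I (\<phi>(i := \<lambda>_. 1)) (walsh m f S)"
      using tensor_int_walsh_one[OF f SI(1), of "\<phi>(i := \<lambda>_. 1)" i] one i by (simp add: I_def)
    \<comment> \<open>The cells cover [0,1], so the constant 1 in slot i is the sum of their
      indicators.\<close>
    also have "\<dots> = tensor_int I (\<phi>(i := \<lambda>x. \<Sum>l\<in>I. \<phi> l x)) (walsh m f S)"
      using prescribed_partition_sum_indicator[OF A]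
      by (intro tensor_int_cong) (auto simp: \<phi>_def I_def)
    also have "\<dots> = (\<Sum>l\<in>I. tensor_int I (\<phi>(i := \<phi> l)) (walsh m f S))"
      using \<phi> SI finI walsh[OF S] by (intro tensor_int_slot_sum) auto
    also have "\<dots> = (\<Sum>l\<in>I - S. tensor_int I (\<phi>(i := \<phi> l)) (walsh m f S))
        + (\<Sum>l\<in>S. tensor_int I (\<phi>(i := \<phi> l)) (walsh m f S))"
      using SI finI by (intro sum.subset_diff)
    \<comment> \<open>For l in S other than i, the slots i and l hold the same cell, so antisymmetry
      makes the integral its own negative.\<close>
    also have "(\<Sum>l\<in>S. tensor_int I (\<phi>(i := \<phi> l)) (walsh m f S)) = (\<Sum>l\<in>{i}. tensor_int I (\<phi>(i := \<phi> l)) (walsh m f S))"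
    proof (intro sum.mono_neutral_right finS S ballI)
      fix l assume l: "l \<in> S - {i}"
      let ?\<psi> = "\<phi>(i := \<phi> l)"
      have "test_fun (?\<psi> k)" if "k \<in> {1..m}" for k
        using \<phi> SI l that by (auto simp: I_def)
      moreover have "?\<psi> \<circ> Transposition.transpose i l = ?\<psi>"
        using l by (auto simp: fun_eq_iff Transposition.transpose_def)
      ultimately have "tensor_int I ?\<psi> (walsh m f S) = - tensor_int I ?\<psi> (walsh m f S)"
        using alternating[of S i l ?\<psi>] SI i l by (simp add: I_def)
      then show "tensor_int I ?\<psi> (walsh m f S) = 0"
        by (simp add: equation_minus_iff eq_neg_iff_add_eq_0)
    qed (use i in auto)
    also have "(\<Sum>l\<in>I - S. tensor_int I (\<phi>(i := \<phi> l)) (walsh m f S)) = (\<Sum>l\<in>I - S. c S i l)"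
    proof (intro sum.cong refl)
      fix l assume l: "l \<in> I - S"
      then have il: "i \<noteq> l" using i by auto
      let ?\<psi> = "\<phi>(i := \<phi> l)"
      have \<psi>: "test_fun (?\<psi> k)" if "k \<in> {1..m}" for k
        using \<phi> l that by (auto simp: I_def)
      have l': "l \<in> {1..m} - S" using l by (simp add: I_def)
      have free: "tensor_int I (?\<psi>(l := \<eta>)) (walsh m f S) = mean \<eta> * tensor_int I (?\<psi>(l := \<lambda>_. 1)) (walsh m f S)"
        if "test_fun \<eta>" for \<eta>
        unfolding I_def by (rule tensor_int_walsh_free_slot[OF f SI(1) \<psi> l' that])
      have "?\<psi>(l := \<phi> l) = ?\<psi>" using il by (intro fun_upd_idem) simp
      then have "tensor_int I ?\<psi> (walsh m f S) = \<alpha> l * tensor_int I (?\<psi>(l := \<lambda>_. 1)) (walsh m f S)"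
        using free[of "\<phi> l"] \<phi>[of l] l by simp
      moreover have "\<phi> \<circ> Transposition.transpose i l = ?\<psi>(l := \<phi> i)"
        using il by (auto simp: fun_eq_iff Transposition.transpose_def)
      then have "tensor_int I (\<phi> \<circ> Transposition.transpose i l) (walsh m f S)
          = \<alpha> i * tensor_int I (?\<psi>(l := \<lambda>_. 1)) (walsh m f S)"
        using free[of "\<phi> i"] \<phi>[of i] SI by simp
      ultimately show "tensor_int I (\<phi>(i := \<phi> l)) (walsh m f S) = c S i l"
        using \<alpha>0[OF SI(4)] by (simp add: c_def)
    qed
    finally show ?thesis by (simp add: d_def add.commute)
  qed
  \<comment> \<open>Multiplying (iii) by the product over S leaves the quotient \<alpha> i /
    \<alpha> l in the i-th term, which is the factor built into \<open>c\<close> with the roles of i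
    and l reversed.\<close>
  have exchange: "d S = (\<Sum>i\<in>S. c (insert l S - {i}) l i)" if S: "S \<in> L" and l: "l \<in> I - S" for S l
  proof -
    have SI: "S \<subseteq> {1..m}" "card S = k" "l \<in> {1..m} - S" using S l by (auto simp: L_def I_def)
    have S0: "(\<Prod>i\<in>S. \<alpha> i) \<noteq> 0" using \<alpha>0 SI finS[OF S] by (auto simp: I_def)
    have prod: "(\<Prod>j\<in>insert l S - {i}. \<alpha> j) = (\<Prod>i\<in>S. \<alpha> i) * \<alpha> l / \<alpha> i" if "i \<in> S" for i
    proof -
      have "\<alpha> i * (\<Prod>j\<in>insert l S - {i}. \<alpha> j) = \<alpha> l * (\<Prod>i\<in>S. \<alpha> i)"
        using that finS[OF S] l by (subst prod.remove[symmetric]) auto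
      then show ?thesis using \<alpha>0[of i] that SI by (auto simp: field_simps I_def)
    qed
    have "d S = (\<Prod>i\<in>S. \<alpha> i) * (\<Sum>i\<in>S. tensor_int I (\<phi> \<circ> Transposition.transpose l i) (walsh m f (insert l S - {i}))
          / complex_of_real (\<Prod>j\<in>insert l S - {i}. \<alpha> j))"
      using relation[OF SI, of \<phi>] \<phi>(1) S0 by (simp add: I_def d_def divide_eq_eq mult.commute del: of_real_prod)
    also have "\<dots> = (\<Sum>i\<in>S. c (insert l S - {i}) l i)"
      unfolding sum_distrib_left
    proof (intro sum.cong refl)
      fix i assume "i \<in> S"
      then show "(\<Prod>i\<in>S. \<alpha> i) * (tensor_int I (\<phi> \<circ> Transposition.transpose l i) (walsh m f (insert l S - {i}))
          / complex_of_real (\<Prod>j\<in>insert l S - {i}. \<alpha> j)) = c (insert l S - {i}) l i"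
        using S0 \<alpha>0[of l] l unfolding prod[OF \<open>i \<in> S\<close>] c_def by (simp add: field_simps del: of_real_prod)
    qed
    finally show ?thesis .
  qed
  define X where "X = (SIGMA S:L. S \<times> (I - S))"
  have sumX: "(\<Sum>S\<in>L. \<Sum>i\<in>S. \<Sum>l\<in>I - S. h S i l) = (\<Sum>(S, i, l)\<in>X. h S i l)" for h :: "_ \<Rightarrow> _ \<Rightarrow> _ \<Rightarrow> complex"
    unfolding X_def using finL finS finI
    by (simp add: sum.cartesian_product sum.Sigma split_def)
  have "k * (\<Sum>S\<in>L. d S) = (\<Sum>S\<in>L. \<Sum>i\<in>S. d S)"
    by (simp add: L_def sum_distrib_left)
  also have "\<dots> = (\<Sum>S\<in>L. \<Sum>i\<in>S. - (\<Sum>l\<in>I - S. c S i l))"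
    using replace by (intro sum.cong refl) (simp add: eq_neg_iff_add_eq_0)
  also have "\<dots> = - (\<Sum>(S, i, l)\<in>X. c S i l)"
    unfolding sum_negf sumX ..
  also have "(\<Sum>(S, i, l)\<in>X. c S i l) = (\<Sum>(S, i, l)\<in>X. c (insert l S - {i}) l i)"
  \<comment> \<open>Trading i in S for l outside S, and reversing their roles, is an involution of
    the triples (S, i, l).\<close>
  proof (rule sum.reindex_bij_witness[where i="\<lambda>(S, i, l). (insert l S - {i}, l, i)" and j="\<lambda>(S, i, l). (insert l S - {i}, l, i)"])
    fix z assume "z \<in> X"
    then obtain S i l where z: "z = (S, i, l)" "S \<in> L" "i \<in> S" "l \<in> I - S"
      by (auto simp: X_def)
    have eq: "insert i (insert l S - {i}) - {l} = S" using z by auto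
    then show "(case case z of (S, i, l) \<Rightarrow> (insert l S - {i}, l, i) of (S, i, l) \<Rightarrow> (insert l S - {i}, l, i)) = z"
      by (simp add: z)
    show "(case z of (S, i, l) \<Rightarrow> (insert l S - {i}, l, i)) \<in> X"
      using z finS[OF z(2)] by (auto simp: X_def L_def card_insert_if card_Suc_Diff1)
    show "(case case z of (S, i, l) \<Rightarrow> (insert l S - {i}, l, i) of (S, i, l) \<Rightarrow> c (insert l S - {i}) l i)
        = (case z of (S, i, l) \<Rightarrow> c S i l)"
      using eq by (simp add: z)
  next
    fix z assume "z \<in> X"
    then obtain S i l where z: "z = (S, i, l)" "S \<in> L" "i \<in> S" "l \<in> I - S"
      by (auto simp: X_def)
    have eq: "insert i (insert l S - {i}) - {l} = S" using z by auto
    then show "(case case z of (S, i, l) \<Rightarrow> (insert l S - {i}, l, i) of (S, i, l) \<Rightarrow> (insert l S - {i}, l, i)) = z"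
      by (simp add: z)
    show "(case z of (S, i, l) \<Rightarrow> (insert l S - {i}, l, i)) \<in> X"
      using z finS[OF z(2)] by (auto simp: X_def L_def card_insert_if card_Suc_Diff1)
  qed
  also have "\<dots> = (\<Sum>S\<in>L. \<Sum>l\<in>I - S. \<Sum>i\<in>S. c (insert l S - {i}) l i)"
    unfolding sumX[symmetric] by (intro sum.cong refl sum.swap)
  also have "\<dots> = (\<Sum>S\<in>L. \<Sum>l\<in>I - S. d S)"
    by (intro sum.cong refl exchange[symmetric])
  also have "\<dots> = (m - k) * (\<Sum>S\<in>L. d S)"
    using finS finI by (simp add: L_def I_def card_Diff_subset sum_distrib_left)
  \<comment> \<open>The total coefficient is m, which is positive.\<close>
  finally have "(of_nat k + of_nat (m - k)) * (\<Sum>S\<in>L. d S) = 0"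
    by (simp add: distrib_right eq_neg_iff_add_eq_0)
  then have "(\<Sum>S\<in>L. d S) = 0"
    using k by (simp add: of_nat_diff)
  then show ?thesis by (simp add: L_def d_def I_def \<phi>_def[abs_def])
qed

section \<open>Exchanging small sets\<close>

text \<open>A single p on {1..2m} lists both intervals of every exchange, the partner of i sitting
  at m + i. This is the numbering of the doubled variables.\<close>

definition dyadic_diff :: "nat \<Rightarrow> nat \<Rightarrow> (nat \<Rightarrow> nat) \<Rightarrow> nat \<Rightarrow> real \<Rightarrow> complex" where
  "dyadic_diff m n p i x = indicator (dyadic n (p i)) x - indicator (dyadic n (p (m + i))) x"

lemma test_fun_dyadic_diff: "test_fun (dyadic_diff m n p i)"
  unfolding dyadic_diff_def[abs_def] by (intro test_fun_diff test_fun_indicator dyadic_lebesgue)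

text \<open>For each \<open>i \<in> S\<close> the intervals with indices \<open>p i\<close> and \<open>p (m + i)\<close> are placed in
  \<open>A (a i)\<close> and \<open>A (b i)\<close>, or, if \<open>i \<in> E\<close>, the other way round. Each of these partitions makes the
  sum over the levels up to \<open>card S\<close> vanish; their alternating sum over \<open>E \<subseteq> S\<close> retains only the top
  level, with a difference of indicators in each slot.\<close>

lemma swap_identity:
  assumes "m \<ge> 1" and f: "integrable (cube {1..m}) f" and \<alpha>: "(\<Sum>i\<in>{1..m}. \<alpha> i) = 1"
    and vanish: "\<And>A. prescribed_partition m \<alpha> A \<Longrightarrow>
      (\<Sum>T | T \<subseteq> {1..m} \<and> card T \<le> card S. tensor_int {1..m} (\<lambda>i. indicator (A i)) (walsh m f T)) = 0"
    and S: "S \<subseteq> {1..m}" and ab: "a \<in> S \<rightarrow> {1..m}" "b \<in> S \<rightarrow> {1..m}"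
    and p: "inj_on p {1..2 * m}" "\<And>i. i \<in> {1..2 * m} \<Longrightarrow> p i < 2 ^ n"
    and small: "\<And>j. j \<in> {1..m} \<Longrightarrow> 2 * real m / 2 ^ n \<le> \<alpha> j"
  shows "(\<Sum>T | T \<subseteq> {1..m} \<and> card T = card S. \<Sum>\<sigma> | \<sigma> \<in> T \<rightarrow>\<^sub>E S \<and> bij_betw \<sigma> T S.
      (\<Prod>j\<in>T. of_bool (b (\<sigma> j) = j) - of_bool (a (\<sigma> j) = j)) *
      tensor_int {1..m} (\<lambda>j. if j \<in> T then dyadic_diff m n p (\<sigma> j) else (\<lambda>_. complex_of_real (\<alpha> j))) f) = 0"
proof -
  define I where "I = {1..m}"
  \<comment> \<open>The pieces to be placed: (i, False) is the interval of p i and (i, True) that of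
    p (m + i). Performing exchange i swaps their cells one for one, so the counts \<open>N j\<close>
    below do not depend on E.\<close>
  define Z where "Z = S \<times> (UNIV :: bool set)"
  define D where "D z = dyadic n (p (if snd z then m + fst z else fst z))" for z :: "nat \<times> bool"
  define c where "c E z = (if (fst z \<in> E) = snd z then a (fst z) else b (fst z))" for E and z :: "nat \<times> bool"
  define N where "N j = (\<Sum>i\<in>S. of_bool (a i = j) + of_bool (b i = j) :: nat)" for j
  \<comment> \<open>Performing exchange i adds the difference function of i to the cell b i and
    subtracts it from the cell a i; the two effects cancel if the cells coincide.\<close>
  define s :: "nat \<Rightarrow> nat \<Rightarrow> complex" where "s i j = of_bool (b i = j) - of_bool (a i = j)" for i j
  let ?\<Delta> = "dyadic_diff m n p"
  have "finite S" using S finite_subset by blast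
  then have fin: "finite I" "finite S" "finite Z"
    by (auto simp: I_def Z_def)
  have sumZ: "(\<Sum>z\<in>Z. h z) = (\<Sum>i\<in>S. h (i, False) + h (i, True))" for h :: "nat \<times> bool \<Rightarrow> 'x :: comm_monoid_add"
  proof -
    have "(\<Sum>z\<in>Z. h z) = (\<Sum>i\<in>S. \<Sum>v\<in>UNIV. h (i, v))"
      unfolding Z_def by (simp only: sum.cartesian_product split_def prod.collapse)
    then show ?thesis by (simp add: UNIV_bool)
  qed
  have idx: "(if snd z then m + fst z else fst z) \<in> {1..2 * m}" if "z \<in> Z" for z
    using that S by (auto simp: Z_def)
  have D: "D z \<in> sets lebesgue" "D z \<subseteq> {0..1}" "measure lebesgue (D z) = 1 / 2 ^ n" if "z \<in> Z" for z
    using dyadic_subset[OF p(2)[OF idx[OF that]]] by (simp_all only: D_def measure_dyadic dyadic_lebesgue)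
  have disj: "disjoint_family_on D Z"
    unfolding disjoint_family_on_def
  proof (intro ballI impI)
    fix z z' assume z: "z \<in> Z" "z' \<in> Z" "z \<noteq> z'"
    then have "fst z \<in> {1..m}" "fst z' \<in> {1..m}"
      using S by (auto simp: Z_def)
    then have "(if snd z then m + fst z else fst z) \<noteq> (if snd z' then m + fst z' else fst z')"
      using z(3) by (auto simp: prod_eq_iff)
    then show "D z \<inter> D z' = {}"
      unfolding D_def using inj_onD[OF p(1) _ idx[OF z(1)] idx[OF z(2)]] by (intro dyadic_disjoint) auto
  qed
  have cI: "c E \<in> Z \<rightarrow> {1..m}" for E
  proof (rule funcsetI)
    fix z assume "z \<in> Z"
    then have "fst z \<in> S" by (auto simp: Z_def)
    from funcset_mem[OF ab(1) this] funcset_mem[OF ab(2) this]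
    show "c E z \<in> {1..m}" by (simp add: c_def)
  qed
  have card: "card {z \<in> Z. c E z = j} = N j" for E j
  proof -
    have "card {z \<in> Z. c E z = j} = (\<Sum>z\<in>{z \<in> Z. c E z = j}. 1)" by simp
    also have "\<dots> = (\<Sum>z\<in>Z. of_bool (c E z = j))"
      using fin(3) by (intro sum.mono_neutral_cong_left) auto
    also have "\<dots> = N j"
      unfolding sumZ N_def by (intro sum.cong) (auto simp: c_def)
    finally show ?thesis .
  qed
  have N1: "(\<Sum>j\<in>{1..m}. N j) = card Z"
  proof -
    have "(\<Sum>j\<in>{1..m}. N j) = (\<Sum>i\<in>S. \<Sum>j\<in>{1..m}. of_bool (a i = j) + of_bool (b i = j))"
      unfolding N_def by (rule sum.swap)
    also have "\<dots> = (\<Sum>i\<in>S. 2)"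
    proof (intro sum.cong refl)
      fix i assume "i \<in> S"
      from funcset_mem[OF ab(1) this] funcset_mem[OF ab(2) this]
      show "(\<Sum>j\<in>{1..m}. of_bool (a i = j) + of_bool (b i = j)) = (2 :: nat)"
        by (simp add: sum.distrib of_bool_def)
    qed
    finally show ?thesis by (simp add: Z_def card_cartesian_product)
  qed
  have N2: "real (N j) * (1 / 2 ^ n) \<le> \<alpha> j" if "j \<in> {1..m}" for j
  proof -
    \<comment> \<open>A cell receives at most two pieces from each of at most m exchanges, which
      explains the bound 2m / 2^n.\<close>
    have "N j \<le> (\<Sum>i\<in>S. 2)" unfolding N_def by (intro sum_mono) auto
    also have "\<dots> \<le> 2 * m" using card_mono[OF _ S] by simp
    finally have "real (N j) / 2 ^ n \<le> 2 * real m / 2 ^ n" by (intro divide_right_mono) auto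
    then show ?thesis using small[OF that] by simp
  qed
  obtain A where A: "\<forall>c\<in>Z \<rightarrow> {1..m}. (\<forall>j\<in>{1..m}. card {z \<in> Z. c z = j} = N j) \<longrightarrow>
      prescribed_partition m \<alpha> (\<lambda>j. A j \<union> (\<Union>z\<in>{z \<in> Z. c z = j}. D z))"
    "\<forall>j\<in>{1..m}. \<forall>z\<in>Z. A j \<inter> D z = {}"
    by (rule exists_partition_with_prescribed_pieces[OF assms(1) \<alpha> fin(3) disj D N1 N2])
  define B where "B E j = A j \<union> (\<Union>z\<in>{z \<in> Z. c E z = j}. D z)" for E j
  have B: "prescribed_partition m \<alpha> (B E)" for E
    unfolding B_def using A(1) cI card by blast
  have ind: "indicator (B E j) x = indicator (A j) x + (\<Sum>z\<in>Z. of_bool (c E z = j) * indicator (D z) x :: complex)"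
    if j: "j \<in> I" for E j x
  proof (cases "\<exists>z\<in>Z. x \<in> D z")
    case True
    then obtain z where z: "z \<in> Z" "x \<in> D z" by blast
    have uniq: "x \<notin> D z'" if "z' \<in> Z - {z}" for z'
      using disjoint_family_onD[OF disj, of z z'] z that by auto
    have "(\<Sum>z\<in>Z. of_bool (c E z = j) * indicator (D z) x :: complex) = (\<Sum>z\<in>{z}. of_bool (c E z = j) * indicator (D z) x)"
      using z fin uniq by (intro sum.mono_neutral_right) (auto simp: indicator_def)
    moreover have "x \<notin> A j" using A(2) j z unfolding I_def by blast
    moreover have "x \<in> B E j \<longleftrightarrow> c E z = j"
    proof -
      have "x \<in> B E j \<longleftrightarrow> (\<exists>z'\<in>Z. c E z' = j \<and> x \<in> D z')"
        using \<open>x \<notin> A j\<close> unfolding B_def by blast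
      then show ?thesis using z uniq by blast
    qed
    ultimately show ?thesis using z by (auto simp: indicator_def)
  next
    case False
    then have "(\<Sum>z\<in>Z. of_bool (c E z = j) * indicator (D z) x :: complex) = 0"
      by (intro sum.neutral) (auto simp: indicator_def)
    then show ?thesis using False by (auto simp: indicator_def B_def)
  qed
  have change: "indicator (B E j) x = indicator (B {} j) x + (\<Sum>i\<in>E. s i j * ?\<Delta> i x)"
    if j: "j \<in> I" and E: "E \<subseteq> S" for E j x
  proof -
    have "(\<Sum>z\<in>Z. of_bool (c E z = j) * indicator (D z) x :: complex)
        = (\<Sum>i\<in>S. (of_bool (c {} (i, False) = j) * indicator (D (i, False)) x
            + of_bool (c {} (i, True) = j) * indicator (D (i, True)) x) + (if i \<in> E then s i j * ?\<Delta> i x else 0))"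
      unfolding sumZ
      by (intro sum.cong refl) (simp add: c_def D_def s_def dyadic_diff_def algebra_simps)
    also have "\<dots> = (\<Sum>z\<in>Z. of_bool (c {} z = j) * indicator (D z) x) + (\<Sum>i\<in>S. if i \<in> E then s i j * ?\<Delta> i x else 0)"
      unfolding sumZ by (rule sum.distrib)
    also have "(\<Sum>i\<in>S. if i \<in> E then s i j * ?\<Delta> i x else 0) = (\<Sum>i\<in>E. s i j * ?\<Delta> i x)"
      using E fin by (intro sum.mono_neutral_cong_right) auto
    finally show ?thesis unfolding ind[OF j] by (simp add: add.assoc)
  qed
  define F where "F T E = tensor_int I (\<lambda>i. indicator (B E i)) (walsh m f T)" for T E
  define G where "G T \<sigma> = (\<Prod>j\<in>T. s (\<sigma> j) j) *
      tensor_int I (\<lambda>j. if j \<in> T then ?\<Delta> (\<sigma> j) else (\<lambda>_. complex_of_real (\<alpha> j))) f" for T \<sigma>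
  have level: "(\<Sum>E\<in>Pow S. (-1) ^ card E * F T E)
      = (-1) ^ card S * (\<Sum>\<sigma> | \<sigma> \<in> T \<rightarrow>\<^sub>E S \<and> bij_betw \<sigma> T S. G T \<sigma>)"
    if T: "T \<subseteq> {1..m}" "card T \<le> card S" for T
  proof -
    have finT: "finite T" using T finite_subset by auto
    have TI: "T \<subseteq> I" using T by (simp add: I_def)
    let ?\<phi> = "\<lambda>E j. indicator (B E j) :: real \<Rightarrow> complex"
    have split: "(\<Prod>j\<in>I. h j) = (\<Prod>j\<in>I - T. h j) * (\<Prod>j\<in>T. h j)" for h :: "nat \<Rightarrow> complex"
      by (rule prod.subset_diff[OF TI fin(1)])
    \<comment> \<open>All these partitions have the same measures, so centring subtracts \<alpha> j
      whatever E is. Each centred factor is therefore a fixed term plus a sum over E, the shape that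
      \<open>mixed_difference_prod\<close> requires.\<close>
    have cent: "(\<Prod>j\<in>I. centred T (?\<phi> E) j (x j))
        = (\<Prod>j\<in>I - T. complex_of_real (\<alpha> j)) *
          (\<Prod>j\<in>T. (indicator (B {} j) (x j) - complex_of_real (\<alpha> j)) + (\<Sum>i\<in>E. s i j * ?\<Delta> i (x j)))"
      if E: "E \<in> Pow S" for E x
    proof -
      have "(\<Prod>j\<in>I - T. centred T (?\<phi> E) j (x j)) = (\<Prod>j\<in>I - T. complex_of_real (\<alpha> j))"
        by (intro prod.cong refl) (simp add: centred_def prescribed_partition_mean[OF B] I_def)
      moreover have "(\<Prod>j\<in>T. centred T (?\<phi> E) j (x j))
          = (\<Prod>j\<in>T. (indicator (B {} j) (x j) - complex_of_real (\<alpha> j)) + (\<Sum>i\<in>E. s i j * ?\<Delta> i (x j)))"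
      proof (intro prod.cong refl)
        fix j assume "j \<in> T"
        then have "j \<in> I" "j \<in> {1..m}" using TI T by auto
        then show "centred T (?\<phi> E) j (x j)
            = (indicator (B {} j) (x j) - complex_of_real (\<alpha> j)) + (\<Sum>i\<in>E. s i j * ?\<Delta> i (x j))"
          using \<open>j \<in> T\<close> E change[of j E "x j"] by (simp add: centred_def prescribed_partition_mean[OF B])
      qed
      ultimately show ?thesis unfolding split by simp
    qed
    have test: "test_fun (centred T (?\<phi> E) j)" if "j \<in> I" for E j
      using prescribed_partition_test_fun[OF B, of j E] that by (auto simp: centred_def I_def)
    have testG: "test_fun (if j \<in> T then ?\<Delta> (\<sigma> j) else (\<lambda>_. complex_of_real (\<alpha> j)))" for j \<sigma>
      by (simp add: test_fun_dyadic_diff)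
    have "(\<Sum>E\<in>Pow S. (-1) ^ card E * F T E)
        = (\<Sum>E\<in>Pow S. LINT x|cube I. (-1) ^ card E * ((\<Prod>j\<in>I. centred T (?\<phi> E) j (x j)) * f x))"
    proof (intro sum.cong refl)
      fix E
      have "F T E = tensor_int I (centred T (?\<phi> E)) f"
        unfolding F_def I_def using prescribed_partition_test_fun[OF B]
        by (intro tensor_int_walsh T f)
      then show "(-1) ^ card E * F T E = (LINT x|cube I. (-1) ^ card E * ((\<Prod>j\<in>I. centred T (?\<phi> E) j (x j)) * f x))"
        by (simp add: tensor_int_def)
    qed
    also have "\<dots> = (LINT x|cube I. (\<Sum>E\<in>Pow S. (-1) ^ card E * ((\<Prod>j\<in>I. centred T (?\<phi> E) j (x j)) * f x)))"
      using test f fin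
      by (intro Bochner_Integration.integral_sum[symmetric] integrable_mult_right integrable_tensor) (auto simp: I_def)
    also have "\<dots> = (LINT x|cube I. (\<Sum>\<sigma> | \<sigma> \<in> T \<rightarrow>\<^sub>E S \<and> bij_betw \<sigma> T S. ((-1) ^ card S * (\<Prod>j\<in>T. s (\<sigma> j) j)) *
        ((\<Prod>j\<in>I. (if j \<in> T then ?\<Delta> (\<sigma> j) else (\<lambda>_. complex_of_real (\<alpha> j))) (x j)) * f x)))"
    proof (intro Bochner_Integration.integral_cong refl)
      fix x
      have "(\<Sum>E\<in>Pow S. (-1) ^ card E * ((\<Prod>j\<in>I. centred T (?\<phi> E) j (x j)) * f x))
          = (\<Prod>j\<in>I - T. complex_of_real (\<alpha> j)) * f x * (\<Sum>E\<in>Pow S. (-1) ^ card E *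
              (\<Prod>j\<in>T. (indicator (B {} j) (x j) - complex_of_real (\<alpha> j)) + (\<Sum>i\<in>E. s i j * ?\<Delta> i (x j))))"
        unfolding sum_distrib_left by (intro sum.cong refl) (simp add: cent mult_ac)
      also have "\<dots> = (\<Prod>j\<in>I - T. complex_of_real (\<alpha> j)) * f x * ((-1) ^ card S *
          (\<Sum>\<sigma> | \<sigma> \<in> T \<rightarrow>\<^sub>E S \<and> bij_betw \<sigma> T S. \<Prod>j\<in>T. s (\<sigma> j) j * ?\<Delta> (\<sigma> j) (x j)))"
        by (subst mixed_difference_prod[OF fin(2) finT T(2)]) (rule refl)
      also have "\<dots> = (\<Sum>\<sigma> | \<sigma> \<in> T \<rightarrow>\<^sub>E S \<and> bij_betw \<sigma> T S. ((-1) ^ card S * (\<Prod>j\<in>T. s (\<sigma> j) j)) *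
        ((\<Prod>j\<in>I. (if j \<in> T then ?\<Delta> (\<sigma> j) else (\<lambda>_. complex_of_real (\<alpha> j))) (x j)) * f x))"
        unfolding sum_distrib_left
      proof (intro sum.cong refl)
        fix \<sigma>
        have "(\<Prod>j\<in>I. (if j \<in> T then ?\<Delta> (\<sigma> j) else (\<lambda>_. complex_of_real (\<alpha> j))) (x j))
            = (\<Prod>j\<in>I - T. complex_of_real (\<alpha> j)) * (\<Prod>j\<in>T. ?\<Delta> (\<sigma> j) (x j))"
          unfolding split by (auto intro!: arg_cong2[where f="(*)"] prod.cong)
        then show "(\<Prod>j\<in>I - T. complex_of_real (\<alpha> j)) * f x * ((-1) ^ card S * (\<Prod>j\<in>T. s (\<sigma> j) j * ?\<Delta> (\<sigma> j) (x j)))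
          = ((-1) ^ card S * (\<Prod>j\<in>T. s (\<sigma> j) j)) *
            ((\<Prod>j\<in>I. (if j \<in> T then ?\<Delta> (\<sigma> j) else (\<lambda>_. complex_of_real (\<alpha> j))) (x j)) * f x)"
          by (simp only: prod.distrib mult_ac)
      qed
      finally show "(\<Sum>E\<in>Pow S. (-1) ^ card E * ((\<Prod>j\<in>I. centred T (?\<phi> E) j (x j)) * f x)) = \<dots>" .
    qed
    also have "\<dots> = (\<Sum>\<sigma> | \<sigma> \<in> T \<rightarrow>\<^sub>E S \<and> bij_betw \<sigma> T S. (-1) ^ card S * G T \<sigma>)"
      unfolding G_def tensor_int_def mult.assoc[symmetric] using testG f fin
      by (subst Bochner_Integration.integral_sum)
        (auto intro!: integrable_mult_right integrable_tensor[unfolded mult.assoc[symmetric]] simp: I_def mult.assoc)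
    finally show ?thesis by (simp add: sum_distrib_left)
  qed
  let ?LE = "{T. T \<subseteq> {1..m} \<and> card T \<le> card S}"
  let ?g = "\<lambda>T. \<Sum>\<sigma> | \<sigma> \<in> T \<rightarrow>\<^sub>E S \<and> bij_betw \<sigma> T S. G T \<sigma>"
  have "(\<Sum>E\<in>Pow S. (-1) ^ card E * (\<Sum>T\<in>?LE. F T E)) = 0"
    using vanish[OF B] by (intro sum.neutral ballI) (simp add: F_def I_def)
  also have "(\<Sum>E\<in>Pow S. (-1) ^ card E * (\<Sum>T\<in>?LE. F T E)) = (\<Sum>T\<in>?LE. \<Sum>E\<in>Pow S. (-1) ^ card E * F T E)"
    unfolding sum_distrib_left by (rule sum.swap)
  also have "\<dots> = (-1) ^ card S * (\<Sum>T\<in>?LE. ?g T)"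
    unfolding sum_distrib_left by (intro sum.cong refl) (simp add: level sum_distrib_left)
  \<comment> \<open>A set smaller than S has no bijection onto S, so the lower levels drop
    out.\<close>
  also have "(\<Sum>T\<in>?LE. ?g T) = (\<Sum>T | T \<subseteq> {1..m} \<and> card T = card S. ?g T)"
  proof (intro sum.mono_neutral_right ballI)
    fix T assume T: "T \<in> ?LE - {T. T \<subseteq> {1..m} \<and> card T = card S}"
    then have "\<not> bij_betw \<sigma> T S" for \<sigma> using bij_betw_same_card by auto
    then show "?g T = 0" by simp
  qed auto
  finally show ?thesis by (simp add: G_def I_def s_def)
qed

section \<open>Necessity\<close>

lemma mean_dyadic: "p i < 2 ^ n \<Longrightarrow> mean (indicator (dyadic n (p i))) = 1 / 2 ^ n"
  by (simp add: mean_indicator dyadic_subset measure_dyadic)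

lemma mean_dyadic_diff:
  assumes "p i < 2 ^ n" "p (m + i) < 2 ^ n"
  shows "mean (dyadic_diff m n p i) = 0"
proof -
  have "mean (dyadic_diff m n p i) = mean (indicator (dyadic n (p i))) - mean (indicator (dyadic n (p (m + i))))"
    unfolding dyadic_diff_def[abs_def] by (intro mean_diff test_fun_indicator dyadic_lebesgue)
  then show ?thesis using assms by (simp add: mean_dyadic)
qed

text \<open>Factors of mean zero are not changed by centring, and the other slots contribute only
  their common mean. Products of dyadic differences and single dyadic intervals are of this
  kind.\<close>

lemma tensor_int_walsh_balanced:
  assumes f: "integrable (cube {1..m}) f" and T: "T \<subseteq> {1..m}"
    and \<phi>: "\<And>j. j \<in> {1..m} \<Longrightarrow> test_fun (\<phi> j)"
    and mean: "\<And>j. j \<in> T \<Longrightarrow> mean (\<phi> j) = 0" "\<And>j. j \<in> {1..m} - T \<Longrightarrow> mean (\<phi> j) = \<delta>"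
  shows "tensor_int {1..m} \<phi> (walsh m f T)
    = \<delta> ^ (m - card T) * tensor_int {1..m} (\<lambda>j. if j \<in> T then \<phi> j else (\<lambda>_. 1)) f"
proof -
  have "(\<Prod>j\<in>{1..m} - T. mean (\<phi> j)) = \<delta> ^ (m - card T)"
    using mean(2) T finite_subset[OF T] by (simp add: card_Diff_subset)
  moreover have "tensor_int {1..m} (\<lambda>j. if j \<in> T then (\<lambda>x. \<phi> j x - mean (\<phi> j)) else (\<lambda>_. 1)) f
      = tensor_int {1..m} (\<lambda>j. if j \<in> T then \<phi> j else (\<lambda>_. 1)) f"
    using mean(1) by (intro tensor_int_cong) auto
  ultimately show ?thesis
    by (simp only: tensor_int_walsh_slots[OF f T \<phi>])
qed

lemma eventually_small:
  fixes \<alpha> :: "nat \<Rightarrow> real"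
  assumes "\<And>j. j \<in> {1..m} \<Longrightarrow> 0 < \<alpha> j"
  obtains n0 where "\<And>n j. n \<ge> n0 \<Longrightarrow> j \<in> {1..m} \<Longrightarrow> 2 * real m / 2 ^ n \<le> \<alpha> j"
proof -
  have "\<forall>\<^sub>F n in sequentially. \<forall>j\<in>{1..m}. 2 * real m / 2 ^ n \<le> \<alpha> j"
  proof (intro eventually_ball_finite ballI)
    fix j assume "j \<in> {1..m}"
    moreover have "(\<lambda>n. 2 * real m / 2 ^ n) \<longlonglongrightarrow> 0"
      by (intro LIMSEQ_divide_realpow_zero) simp
    ultimately have "\<forall>\<^sub>F n in sequentially. 2 * real m / 2 ^ n < \<alpha> j"
      using assms order_tendstoD(2) by blast
    then show "\<forall>\<^sub>F n in sequentially. 2 * real m / 2 ^ n \<le> \<alpha> j"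
      by (rule eventually_mono) simp
  qed simp
  then obtain N where "\<forall>n\<ge>N. \<forall>j\<in>{1..m}. 2 * real m / 2 ^ n \<le> \<alpha> j"
    unfolding eventually_sequentially by blast
  then show thesis using that[of N] by blast
qed

section \<open>Sums over bijections with few surviving terms\<close>

lemma finite_bijections: "finite T \<Longrightarrow> finite S \<Longrightarrow> finite {\<sigma>. \<sigma> \<in> T \<rightarrow>\<^sub>E S \<and> bij_betw \<sigma> T S}"
  by (rule finite_subset[OF _ finite_PiE[of T "\<lambda>_. S"]]) auto

lemma sum_bijections_eq:
  fixes h :: "nat set \<Rightarrow> (nat \<Rightarrow> nat) \<Rightarrow> complex"
  assumes "finite S"
    and Y: "Y \<subseteq> (SIGMA T:{T. T \<subseteq> {1..m} \<and> card T = card S}. {\<sigma>. \<sigma> \<in> T \<rightarrow>\<^sub>E S \<and> bij_betw \<sigma> T S})"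
    and zero: "\<And>T \<sigma>. T \<subseteq> {1..m} \<Longrightarrow> card T = card S \<Longrightarrow> \<sigma> \<in> T \<rightarrow>\<^sub>E S \<Longrightarrow> bij_betw \<sigma> T S \<Longrightarrow>
      (T, \<sigma>) \<notin> Y \<Longrightarrow> h T \<sigma> = 0"
  shows "(\<Sum>T | T \<subseteq> {1..m} \<and> card T = card S. \<Sum>\<sigma> | \<sigma> \<in> T \<rightarrow>\<^sub>E S \<and> bij_betw \<sigma> T S. h T \<sigma>)
    = (\<Sum>z\<in>Y. h (fst z) (snd z))"
proof -
  let ?X = "SIGMA T:{T. T \<subseteq> {1..m} \<and> card T = card S}. {\<sigma>. \<sigma> \<in> T \<rightarrow>\<^sub>E S \<and> bij_betw \<sigma> T S}"
  have fin: "finite {T. T \<subseteq> {1..m} \<and> card T = card S}" by simp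
  have finB: "\<forall>T\<in>{T. T \<subseteq> {1..m} \<and> card T = card S}. finite {\<sigma>. \<sigma> \<in> T \<rightarrow>\<^sub>E S \<and> bij_betw \<sigma> T S}"
    using assms(1) finite_subset[of _ "{1..m}"] by (intro ballI finite_bijections) auto
  have "(\<Sum>T | T \<subseteq> {1..m} \<and> card T = card S. \<Sum>\<sigma> | \<sigma> \<in> T \<rightarrow>\<^sub>E S \<and> bij_betw \<sigma> T S. h T \<sigma>)
      = (\<Sum>z\<in>?X. h (fst z) (snd z))"
    by (subst sum.Sigma[OF fin finB]) (simp add: split_def)
  also have "\<dots> = (\<Sum>z\<in>Y. h (fst z) (snd z))"
    using Y zero fin finB by (intro sum.mono_neutral_right finite_SigmaI) auto
  finally show ?thesis .
qed

text \<open>The state of the downward induction: levels above k have already been discarded, and the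
  remaining ones still sum to zero on every partition. For k = m, \<open>vanish\<close> expresses
  the vanishing of all partition integrals.\<close>

locale vanishing_top_levels =
  fixes m :: nat and \<alpha> :: "nat \<Rightarrow> real" and f :: "(nat \<Rightarrow> real) \<Rightarrow> complex" and k :: nat
  assumes m: "m \<ge> 1"
    and f: "integrable (cube {1..m}) f"
    and \<alpha>_pos: "\<And>j. j \<in> {1..m} \<Longrightarrow> 0 < \<alpha> j" and \<alpha>_sum: "(\<Sum>i\<in>{1..m}. \<alpha> i) = 1"
    and vanish: "\<And>A. prescribed_partition m \<alpha> A \<Longrightarrow>
      (\<Sum>T | T \<subseteq> {1..m} \<and> card T \<le> k. tensor_int {1..m} (\<lambda>i. indicator (A i)) (walsh m f T)) = 0"
begin

definition slots :: "nat set \<Rightarrow> (nat \<Rightarrow> real \<Rightarrow> complex) \<Rightarrow> complex" where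
  "slots T \<phi> = tensor_int {1..m} (\<lambda>j. if j \<in> T then \<phi> j else (\<lambda>_. 1)) f"

lemma slots_cong: "(\<And>j. j \<in> T \<Longrightarrow> \<phi> j = \<psi> j) \<Longrightarrow> slots T \<phi> = slots T \<psi>"
  unfolding slots_def by (intro tensor_int_cong) auto

text \<open>The constant slots outside T contribute the product of \<alpha> over the complement of
  T. Dividing by the product over all of [m] turns this into the reciprocal weight of (iii).\<close>

lemma swap_identity_slots:
  assumes S: "S \<subseteq> {1..m}" "card S = k" and ab: "a \<in> S \<rightarrow> {1..m}" "b \<in> S \<rightarrow> {1..m}"
    and p: "inj_on p {1..2 * m}" "\<And>i. i \<in> {1..2 * m} \<Longrightarrow> p i < 2 ^ n"
    and small: "\<And>j. j \<in> {1..m} \<Longrightarrow> 2 * real m / 2 ^ n \<le> \<alpha> j"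
  shows "(\<Sum>T | T \<subseteq> {1..m} \<and> card T = card S. \<Sum>\<sigma> | \<sigma> \<in> T \<rightarrow>\<^sub>E S \<and> bij_betw \<sigma> T S.
      (\<Prod>j\<in>T. of_bool (b (\<sigma> j) = j) - of_bool (a (\<sigma> j) = j)) *
      (slots T (\<lambda>j. dyadic_diff m n p (\<sigma> j)) / complex_of_real (\<Prod>j\<in>T. \<alpha> j))) = 0"
    (is "?L = 0")
proof -
  have prod: "(\<Prod>j\<in>{1..m} - T. complex_of_real (\<alpha> j)) = (\<Prod>j\<in>{1..m}. complex_of_real (\<alpha> j)) / complex_of_real (\<Prod>j\<in>T. \<alpha> j)"
    if T: "T \<subseteq> {1..m}" for T
  proof -
    have "(\<Prod>j\<in>T. complex_of_real (\<alpha> j)) \<noteq> 0"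
      using \<alpha>_pos T finite_subset[OF T] by fastforce
    moreover have "(\<Prod>j\<in>{1..m}. complex_of_real (\<alpha> j))
        = (\<Prod>j\<in>{1..m} - T. complex_of_real (\<alpha> j)) * (\<Prod>j\<in>T. complex_of_real (\<alpha> j))"
      using T by (intro prod.subset_diff) auto
    ultimately show ?thesis by simp
  qed
  have nz: "(\<Prod>j\<in>{1..m}. complex_of_real (\<alpha> j)) \<noteq> 0"
    using \<alpha>_pos by fastforce
  have "(\<Prod>j\<in>{1..m}. complex_of_real (\<alpha> j)) * ?L
      = (\<Sum>T | T \<subseteq> {1..m} \<and> card T = card S. \<Sum>\<sigma> | \<sigma> \<in> T \<rightarrow>\<^sub>E S \<and> bij_betw \<sigma> T S.
      (\<Prod>j\<in>T. of_bool (b (\<sigma> j) = j) - of_bool (a (\<sigma> j) = j)) *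
      tensor_int {1..m} (\<lambda>j. if j \<in> T then dyadic_diff m n p (\<sigma> j) else (\<lambda>_. complex_of_real (\<alpha> j))) f)"
    unfolding sum_distrib_left
  proof (intro sum.cong refl)
    fix T \<sigma> assume "T \<in> {T. T \<subseteq> {1..m} \<and> card T = card S}"
    then have T: "T \<subseteq> {1..m}" by simp
    have "tensor_int {1..m} (\<lambda>j. if j \<in> T then dyadic_diff m n p (\<sigma> j) else (\<lambda>_. complex_of_real (\<alpha> j))) f
        = (\<Prod>j\<in>{1..m} - T. complex_of_real (\<alpha> j)) * slots T (\<lambda>j. dyadic_diff m n p (\<sigma> j))"
      unfolding slots_def using T by (intro tensor_int_constant_slots) auto
    then show "(\<Prod>j\<in>{1..m}. complex_of_real (\<alpha> j)) * ((\<Prod>j\<in>T. of_bool (b (\<sigma> j) = j) - of_bool (a (\<sigma> j) = j)) *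
        (slots T (\<lambda>j. dyadic_diff m n p (\<sigma> j)) / complex_of_real (\<Prod>j\<in>T. \<alpha> j)))
      = (\<Prod>j\<in>T. of_bool (b (\<sigma> j) = j) - of_bool (a (\<sigma> j) = j)) *
      tensor_int {1..m} (\<lambda>j. if j \<in> T then dyadic_diff m n p (\<sigma> j) else (\<lambda>_. complex_of_real (\<alpha> j))) f"
      by (simp add: prod[OF T] del: of_real_prod)
  qed
  also have "\<dots> = 0"
    using S by (intro swap_identity m f \<alpha>_sum ab p small) (auto dest: vanish)
  finally show ?thesis using nz by simp
qed

text \<open>Links the test products for almost everywhere vanishing with the terms of the exchange
  identity. Because \<pi> carries T to S, the slots of T hold differences, which have mean zero, and
  every other slot holds one interval of mean 2^-n. The resulting power depends on T only through
  its size.\<close>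

lemma tensor_int_walsh_permuted_differences:
  assumes T: "T \<subseteq> {1..m}" and S: "S \<subseteq> {1..m}" and \<pi>: "\<pi> ` {1..m} \<subseteq> {1..m}" "\<And>j. j \<in> {1..m} \<Longrightarrow> \<pi> j \<in> S \<longleftrightarrow> j \<in> T"
    and p: "\<And>i. i \<in> {1..2 * m} \<Longrightarrow> p i < 2 ^ n"
  shows "tensor_int {1..m} ((\<lambda>i. if i \<in> S then dyadic_diff m n p i else indicator (dyadic n (p i))) \<circ> \<pi>) (walsh m f T)
    = (1 / 2 ^ n) ^ (m - card T) * slots T (\<lambda>j. dyadic_diff m n p (\<pi> j))"
proof -
  let ?\<phi> = "(\<lambda>i. if i \<in> S then dyadic_diff m n p i else indicator (dyadic n (p i))) \<circ> \<pi>"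
  have "tensor_int {1..m} ?\<phi> (walsh m f T)
    = (1 / 2 ^ n) ^ (m - card T) * tensor_int {1..m} (\<lambda>j. if j \<in> T then ?\<phi> j else (\<lambda>_. 1)) f"
  proof (rule tensor_int_walsh_balanced[OF f T])
    show "test_fun (?\<phi> j)" for j
      by (simp add: test_fun_dyadic_diff test_fun_indicator)
    fix j
    show "mean (?\<phi> j) = 0" if "j \<in> T"
    proof -
      have j: "j \<in> {1..m}" using that T by auto
      then have "\<pi> j \<in> {1..m}" using \<pi>(1) by blast
      then have "\<pi> j \<in> {1..2 * m}" "m + \<pi> j \<in> {1..2 * m}" by auto
      then show ?thesis using \<pi>(2)[OF j] that p by (simp add: mean_dyadic_diff)
    qed
    show "mean (?\<phi> j) = 1 / 2 ^ n" if "j \<in> {1..m} - T"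
    proof -
      have "\<pi> j \<in> {1..m}" using \<pi>(1) that by blast
      then have "\<pi> j \<in> {1..2 * m}" by auto
      then show ?thesis using \<pi>(2)[of j] that p by (simp add: mean_dyadic)
    qed
  qed
  also have "tensor_int {1..m} (\<lambda>j. if j \<in> T then ?\<phi> j else (\<lambda>_. 1)) f = slots T (\<lambda>j. dyadic_diff m n p (\<pi> j))"
    unfolding slots_def using \<pi>(2) by (intro tensor_int_cong) auto
  finally show ?thesis .
qed

lemma differences_fold:
  "(\<lambda>i. if i \<in> S then (\<lambda>x. indicator (dyadic n (p i)) x - indicator (dyadic n (p (m + i))) x)
          else indicator (dyadic n (p i)))
    = (\<lambda>i. if i \<in> S then dyadic_diff m n p i else indicator (dyadic n (p i)))"
  by (auto simp: dyadic_diff_def fun_eq_iff)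

text \<open>For t in S other than i and j, only exchange t touches cell t, so \<sigma> t = t; the
  exchanges i and j are left for the cells i and j. Thus T = S, and \<sigma> is the identity or the
  transposition. Both have coefficient 1: the identity takes the positive side everywhere, the
  transposition takes the negative side exactly twice. The two terms therefore add up to zero, which
  is antisymmetry.\<close>

lemma AE_walsh_alternating:
  assumes S: "S \<subseteq> {1..m}" "card S = k" and ij: "i \<in> S" "j \<in> S" "i \<noteq> j"
  shows "AE x in cube {1..m}. walsh m f S (swap_coords i j x) = - walsh m f S x"
proof -
  define H where "H x = walsh m f S (swap_coords i j x) + walsh m f S x" for x
  let ?\<tau> = "Transposition.transpose i j"
  have fin: "finite S" using S finite_subset by blast
  have ijm: "i \<in> {1..m}" "j \<in> {1..m}" using ij S by auto
  note W = integrable_walsh[OF S(1) f]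
  note Wsw = integrable_swap[OF _ ijm W]
  have test: "tensor_int {1..m} \<phi> H = tensor_int {1..m} (\<phi> \<circ> ?\<tau>) (walsh m f S) + tensor_int {1..m} \<phi> (walsh m f S)"
    if "\<And>k. k \<in> {1..m} \<Longrightarrow> test_fun (\<phi> k)" for \<phi>
  proof -
    have "tensor_int {1..m} \<phi> H = tensor_int {1..m} \<phi> (\<lambda>x. walsh m f S (swap_coords i j x)) + tensor_int {1..m} \<phi> (walsh m f S)"
      unfolding H_def using that W Wsw by (intro tensor_int_add) auto
    also have "tensor_int {1..m} \<phi> (\<lambda>x. walsh m f S (swap_coords i j x)) = tensor_int {1..m} (\<phi> \<circ> ?\<tau>) (walsh m f S)"
      using that by (intro tensor_int_swap W ijm) auto
    finally show ?thesis .
  qed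
  have \<tau>: "?\<tau> r \<in> {1..m} \<longleftrightarrow> r \<in> {1..m}" "?\<tau> r \<in> S \<longleftrightarrow> r \<in> S" for r
    using ij ijm by (auto simp: Transposition.transpose_def)
  obtain n0 where n0: "\<And>n j. n \<ge> n0 \<Longrightarrow> j \<in> {1..m} \<Longrightarrow> 2 * real m / 2 ^ n \<le> \<alpha> j"
    using eventually_small[of m \<alpha>] \<alpha>_pos by blast
  have "AE x in cube {1..m}. H x = 0"
  proof (rule AE_zero_if_differences_vanish[OF S(1)])
    show "integrable (cube {1..m}) H"
      unfolding H_def using W Wsw by simp
    fix \<phi> :: "nat \<Rightarrow> real \<Rightarrow> complex" and r
    assume \<phi>: "\<And>k. k \<in> {1..m} \<Longrightarrow> test_fun (\<phi> k)" "r \<in> S" "\<phi> r = (\<lambda>_. 1)"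
    have "tensor_int {1..m} (\<phi> \<circ> ?\<tau>) (walsh m f S) = 0"
      using \<phi> \<tau> by (intro tensor_int_walsh_one[OF f S(1), of _ "?\<tau> r"]) auto
    moreover have "tensor_int {1..m} \<phi> (walsh m f S) = 0"
      using \<phi> by (intro tensor_int_walsh_one[OF f S(1), of _ r]) auto
    ultimately show "tensor_int {1..m} \<phi> H = 0" using test \<phi> by simp
  next
    fix n and p :: "nat \<Rightarrow> nat"
    assume n: "n \<ge> n0" and p: "inj_on p {1..2 * m}" "\<And>i. i \<in> {1..2 * m} \<Longrightarrow> p i < 2 ^ n"
    let ?\<phi> = "\<lambda>i. if i \<in> S then dyadic_diff m n p i else indicator (dyadic n (p i))"
    let ?a = "\<lambda>r. if r = i then j else i"
    let ?h = "\<lambda>T \<sigma>. (\<Prod>t\<in>T. of_bool (\<sigma> t = t) - of_bool (?a (\<sigma> t) = t)) *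
      (slots T (\<lambda>t. dyadic_diff m n p (\<sigma> t)) / complex_of_real (\<Prod>j\<in>T. \<alpha> j))"
    let ?Y = "{(S, restrict id S), (S, restrict ?\<tau> S)}"
    have "0 = (\<Sum>T | T \<subseteq> {1..m} \<and> card T = card S. \<Sum>\<sigma> | \<sigma> \<in> T \<rightarrow>\<^sub>E S \<and> bij_betw \<sigma> T S. ?h T \<sigma>)"
      using swap_identity_slots[OF S _ _ p n0[OF n], of ?a "\<lambda>r. r"] S ijm by auto
    also have "\<dots> = (\<Sum>z\<in>?Y. ?h (fst z) (snd z))"
    proof (rule sum_bijections_eq[OF fin])
      have "bij_betw (restrict id S) S S" by (simp add: bij_betw_def inj_on_def)
      moreover have "bij_betw (restrict ?\<tau> S) S S"
        using ij by (simp add: bij_betw_def Transposition.transpose_image_eq inj_on_restrict_eq)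
      ultimately show "?Y \<subseteq> (SIGMA T:{T. T \<subseteq> {1..m} \<and> card T = card S}. {\<sigma>. \<sigma> \<in> T \<rightarrow>\<^sub>E S \<and> bij_betw \<sigma> T S})"
        using S(1) \<tau> by auto
      fix T \<sigma> assume T: "T \<subseteq> {1..m}" "card T = card S" and \<sigma>: "\<sigma> \<in> T \<rightarrow>\<^sub>E S" "bij_betw \<sigma> T S"
        and notin: "(T, \<sigma>) \<notin> ?Y"
      have "(\<Prod>t\<in>T. of_bool (\<sigma> t = t) - of_bool (?a (\<sigma> t) = t)) = (0 :: complex)"
      proof (rule ccontr)
        assume prod: "(\<Prod>t\<in>T. of_bool (\<sigma> t = t) - of_bool (?a (\<sigma> t) = t)) \<noteq> (0 :: complex)"
        have nz: "\<sigma> t = t \<or> ?a (\<sigma> t) = t" if "t \<in> T" for t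
        proof (rule ccontr)
          assume "\<not> (\<sigma> t = t \<or> ?a (\<sigma> t) = t)"
          then have "\<exists>t\<in>T. of_bool (\<sigma> t = t) - of_bool (?a (\<sigma> t) = t) = (0 :: complex)"
            using that by (intro bexI[of _ t]) auto
          then have "(\<Prod>t\<in>T. of_bool (\<sigma> t = t) - of_bool (?a (\<sigma> t) = t)) = (0 :: complex)"
            by (intro prod_zero finite_subset[OF T(1)]) auto
          with prod show False by contradiction
        qed
        have \<sigma>S: "\<sigma> t \<in> S" if "t \<in> T" for t using \<sigma>(1) that by auto
        \<comment> \<open>A slot with nonzero factor is a value of \<sigma>, hence in S, or a value
          of \<open>?a\<close>, hence i or j.\<close>
        have "T \<subseteq> S"
          using nz \<sigma>S ij by (metis subsetI)
        then have TS: "T = S" using T(2) fin by (simp add: card_subset_eq)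
        have other: "\<sigma> t = t" if "t \<in> S" "t \<noteq> i" "t \<noteq> j" for t
          using nz[of t] that TS by (auto split: if_splits)
        have inj: "inj_on \<sigma> S" using \<sigma>(2) TS by (simp add: bij_betw_def)
        \<comment> \<open>All other elements of S are already taken by their own slots, so
          injectivity leaves only i and j.\<close>
        have \<sigma>i: "\<sigma> i = i \<or> \<sigma> i = j"
          using other[of "\<sigma> i"] \<sigma>S[of i] ij TS inj_onD[OF inj, of "\<sigma> i" i] by auto
        have \<sigma>j: "\<sigma> j = i \<or> \<sigma> j = j"
          using other[of "\<sigma> j"] \<sigma>S[of j] ij TS inj_onD[OF inj, of "\<sigma> j" j] by auto
        have ne: "\<sigma> i \<noteq> \<sigma> j" using inj_onD[OF inj, of i j] ij by auto
        have "\<sigma> = restrict id S \<or> \<sigma> = restrict ?\<tau> S"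
        proof (cases "\<sigma> i = i")
          case True
          then have "\<sigma> j = j" using \<sigma>j ne by auto
          then have "\<sigma> t = t" if "t \<in> S" for t using other[of t] True that by auto
          then have "\<sigma> = restrict id S"
            using \<sigma>(1) TS by (auto simp: fun_eq_iff PiE_iff extensional_def)
          then show ?thesis ..
        next
          case False
          then have "\<sigma> i = j" "\<sigma> j = i" using \<sigma>i \<sigma>j ne by auto
          then have "\<sigma> t = ?\<tau> t" if "t \<in> S" for t
            using other[of t] that by (auto simp: Transposition.transpose_def)
          then have "\<sigma> = restrict ?\<tau> S"
            using \<sigma>(1) TS by (auto simp: fun_eq_iff PiE_iff extensional_def)
          then show ?thesis ..
        qed
        then show False using notin TS by auto
      qed
      then show "?h T \<sigma> = 0" by simp
    qed
    also have "\<dots> = (slots S (dyadic_diff m n p) + slots S (\<lambda>t. dyadic_diff m n p (?\<tau> t))) / complex_of_real (\<Prod>j\<in>S. \<alpha> j)"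
    proof -
      have "restrict id S i \<noteq> restrict ?\<tau> S i" using ij by simp
      then have ne: "restrict id S \<noteq> restrict ?\<tau> S" by metis
      have 1: "(\<Prod>t\<in>S. of_bool (restrict id S t = t) - of_bool (?a (restrict id S t) = t)) = (1 :: complex)"
        using ij by (intro prod.neutral) auto
      have "(\<Prod>t\<in>S. of_bool (restrict ?\<tau> S t = t) - of_bool (?a (restrict ?\<tau> S t) = t))
          = (\<Prod>t\<in>S. if t \<in> {i, j} then - 1 else 1 :: complex)"
        using ij by (intro prod.cong refl) (auto simp: Transposition.transpose_def)
      also have "\<dots> = (\<Prod>t\<in>{i, j}. - 1)"
        using ij fin by (intro prod.mono_neutral_cong_right) auto
      also have "\<dots> = 1" using ij by simp
      finally have 2: "(\<Prod>t\<in>S. of_bool (restrict ?\<tau> S t = t) - of_bool (?a (restrict ?\<tau> S t) = t)) = (1 :: complex)" .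
      have "slots S (\<lambda>t. dyadic_diff m n p (restrict id S t)) = slots S (dyadic_diff m n p)"
        "slots S (\<lambda>t. dyadic_diff m n p (restrict ?\<tau> S t)) = slots S (\<lambda>t. dyadic_diff m n p (?\<tau> t))"
        by (intro slots_cong; simp)+
      then show ?thesis using ne 1 2 by (simp add: add_divide_distrib del: of_real_prod restrict_apply)
    qed
    finally have zero: "slots S (dyadic_diff m n p) + slots S (\<lambda>t. dyadic_diff m n p (?\<tau> t)) = 0"
    proof -
      have "(\<Prod>j\<in>S. \<alpha> j) \<noteq> 0" using \<alpha>_pos S(1) fin by fastforce
      moreover assume "0 = (slots S (dyadic_diff m n p) + slots S (\<lambda>t. dyadic_diff m n p (?\<tau> t))) / complex_of_real (\<Prod>j\<in>S. \<alpha> j)"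
      ultimately show ?thesis by (simp del: of_real_prod)
    qed
    have "tensor_int {1..m} ?\<phi> H = tensor_int {1..m} (?\<phi> \<circ> ?\<tau>) (walsh m f S) + tensor_int {1..m} (?\<phi> \<circ> id) (walsh m f S)"
      by (subst test) (auto simp: test_fun_dyadic_diff test_fun_indicator)
    also have "\<dots> = (1 / 2 ^ n) ^ (m - card S) * (slots S (\<lambda>t. dyadic_diff m n p (?\<tau> t)) + slots S (\<lambda>t. dyadic_diff m n p (id t)))"
      unfolding distrib_left using \<tau>
      by (intro arg_cong2[where f="(+)"] tensor_int_walsh_permuted_differences S(1) p) auto
    also have "\<dots> = 0" using zero by (simp add: add.commute)
    finally show "tensor_int {1..m} (\<lambda>i. if i \<in> S
          then (\<lambda>x. indicator (dyadic n (p i)) x - indicator (dyadic n (p (m + i))) x)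
          else indicator (dyadic n (p i))) H = 0"
      unfolding differences_fold .
  qed
  then show ?thesis by (rule eventually_mono) (simp add: H_def eq_neg_iff_add_eq_0)
qed

text \<open>With every exchange made between its own cell and cell l, a surviving \<sigma> fixes
  each slot of T other than l. Hence T lies in \<open>insert l S\<close> and, by its size, omits
  exactly one i; \<sigma> sends l to that i. If i = l, this is S with the identity and coefficient
  1. For i in S the slot l lies on the negative side, so the coefficient is -1 and the term belongs
  on the right of (iii).\<close>

lemma AE_walsh_relation:
  assumes S: "S \<subseteq> {1..m}" "card S = k" and l: "l \<in> {1..m} - S"
  shows "AE x in cube {1..m}. walsh m f S x / complex_of_real (\<Prod>i\<in>S. \<alpha> i) =
      (\<Sum>i\<in>S. walsh m f (insert l S - {i}) (swap_coords l i x)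
        / complex_of_real (\<Prod>j\<in>insert l S - {i}. \<alpha> j))"
proof -
  define Q where "Q i = insert l S - {i}" for i
  define w where "w T = complex_of_real (\<Prod>j\<in>T. \<alpha> j)" for T
  define H where "H x = walsh m f S x / w S - (\<Sum>i\<in>S. walsh m f (Q i) (swap_coords l i x) / w (Q i))" for x
  let ?\<tau> = "\<lambda>i. Transposition.transpose l i"
  have fin: "finite S" using S finite_subset by blast
  have lm: "l \<in> {1..m}" "l \<notin> S" using l by auto
  have im: "i \<in> {1..m}" if "i \<in> S" for i using that S by auto
  have Q: "Q i \<subseteq> {1..m}" for i using S lm by (auto simp: Q_def)
  have cardQ: "card (Q i) = card S" if "i \<in> insert l S" for i
    using that fin lm by (simp add: Q_def card_Diff_singleton card_insert_if)
  note W = integrable_walsh[OF S(1) f]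
  have Wsw: "integrable (cube {1..m}) (\<lambda>x. walsh m f (Q i) (swap_coords l i x))" if "i \<in> S" for i
    using that by (intro integrable_swap lm im integrable_walsh Q f) auto
  have H: "integrable (cube {1..m}) H"
    unfolding H_def using W Wsw
    by (intro Bochner_Integration.integrable_diff Bochner_Integration.integrable_sum integrable_divide) auto
  have test: "tensor_int {1..m} \<phi> H = tensor_int {1..m} \<phi> (walsh m f S) / w S
      - (\<Sum>i\<in>S. tensor_int {1..m} (\<phi> \<circ> ?\<tau> i) (walsh m f (Q i)) / w (Q i))"
    if \<phi>: "\<And>k. k \<in> {1..m} \<Longrightarrow> test_fun (\<phi> k)" for \<phi>
  proof -
    have "tensor_int {1..m} \<phi> H = tensor_int {1..m} \<phi> (\<lambda>x. walsh m f S x / w S)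
        - tensor_int {1..m} \<phi> (\<lambda>x. \<Sum>i\<in>S. walsh m f (Q i) (swap_coords l i x) / w (Q i))"
      unfolding H_def using W Wsw \<phi>
      by (intro tensor_int_diff Bochner_Integration.integrable_sum integrable_divide) auto
    also have "tensor_int {1..m} \<phi> (\<lambda>x. \<Sum>i\<in>S. walsh m f (Q i) (swap_coords l i x) / w (Q i))
        = (\<Sum>i\<in>S. tensor_int {1..m} \<phi> (\<lambda>x. walsh m f (Q i) (swap_coords l i x) / w (Q i)))"
      using Wsw \<phi> by (intro tensor_int_sum integrable_divide) auto
    also have "\<dots> = (\<Sum>i\<in>S. tensor_int {1..m} (\<phi> \<circ> ?\<tau> i) (walsh m f (Q i)) / w (Q i))"
    proof (intro sum.cong refl)
      fix i assume "i \<in> S"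
      then have "tensor_int {1..m} \<phi> (\<lambda>x. walsh m f (Q i) (swap_coords l i x)) = tensor_int {1..m} (\<phi> \<circ> ?\<tau> i) (walsh m f (Q i))"
        using \<phi> by (intro tensor_int_swap lm im integrable_walsh Q f) auto
      then show "tensor_int {1..m} \<phi> (\<lambda>x. walsh m f (Q i) (swap_coords l i x) / w (Q i))
          = tensor_int {1..m} (\<phi> \<circ> ?\<tau> i) (walsh m f (Q i)) / w (Q i)"
        by (simp add: tensor_int_divide)
    qed
    finally show ?thesis by (simp add: tensor_int_divide)
  qed
  obtain n0 where n0: "\<And>n j. n \<ge> n0 \<Longrightarrow> j \<in> {1..m} \<Longrightarrow> 2 * real m / 2 ^ n \<le> \<alpha> j"
    using eventually_small[of m \<alpha>] \<alpha>_pos by blast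
  have "AE x in cube {1..m}. H x = 0"
  proof (rule AE_zero_if_differences_vanish[OF S(1) H])
    fix \<phi> :: "nat \<Rightarrow> real \<Rightarrow> complex" and r
    assume \<phi>: "\<And>k. k \<in> {1..m} \<Longrightarrow> test_fun (\<phi> k)" "r \<in> S" "\<phi> r = (\<lambda>_. 1)"
    have "tensor_int {1..m} (\<phi> \<circ> ?\<tau> i) (walsh m f (Q i)) = 0" if i: "i \<in> S" for i
    proof (rule tensor_int_walsh_one[OF f Q])
      show "test_fun ((\<phi> \<circ> ?\<tau> i) k)" if "k \<in> {1..m}" for k
        using \<phi>(1) that lm im[OF i] by (auto simp: Transposition.transpose_def)
      show "?\<tau> i r \<in> Q i" using \<phi>(2) i lm by (auto simp: Q_def Transposition.transpose_def)
      show "(\<phi> \<circ> ?\<tau> i) (?\<tau> i r) = (\<lambda>_. 1)" using \<phi>(3) by simp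
    qed
    moreover have "tensor_int {1..m} \<phi> (walsh m f S) = 0"
      using \<phi> by (intro tensor_int_walsh_one[OF f S(1), of _ r]) auto
    ultimately show "tensor_int {1..m} \<phi> H = 0" using test[OF \<phi>(1)] by simp
  next
    fix n and p :: "nat \<Rightarrow> nat"
    assume n: "n \<ge> n0" and p: "inj_on p {1..2 * m}" "\<And>i. i \<in> {1..2 * m} \<Longrightarrow> p i < 2 ^ n"
    let ?\<phi> = "\<lambda>i. if i \<in> S then dyadic_diff m n p i else indicator (dyadic n (p i))"
    let ?h = "\<lambda>T \<sigma>. (\<Prod>t\<in>T. of_bool (\<sigma> t = t) - of_bool (l = t)) *
      (slots T (\<lambda>t. dyadic_diff m n p (\<sigma> t)) / complex_of_real (\<Prod>j\<in>T. \<alpha> j))"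
    \<comment> \<open>The survivors are indexed by the omitted element; i = l gives S itself, the
      transposition of l with itself being the identity.\<close>
    define y where "y i = (Q i, restrict (?\<tau> i) (Q i))" for i
    have inj_y: "inj_on y (insert l S)"
      using lm by (auto simp: y_def Q_def inj_on_def)
    have yl: "y l = (S, restrict id S)"
      using lm by (auto simp: y_def Q_def fun_eq_iff restrict_def)
    have image: "?\<tau> i ` Q i = S" if "i \<in> insert l S" for i
    proof
      show "?\<tau> i ` Q i \<subseteq> S"
        using that lm by (auto simp: Q_def Transposition.transpose_def)
      show "S \<subseteq> ?\<tau> i ` Q i"
      proof
        fix t assume "t \<in> S"
        then have "?\<tau> i t \<in> Q i" using that lm by (auto simp: Q_def Transposition.transpose_def)
        then show "t \<in> ?\<tau> i ` Q i" by (rule rev_image_eqI) simp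
      qed
    qed
    have "0 = (\<Sum>T | T \<subseteq> {1..m} \<and> card T = card S. \<Sum>\<sigma> | \<sigma> \<in> T \<rightarrow>\<^sub>E S \<and> bij_betw \<sigma> T S. ?h T \<sigma>)"
      using swap_identity_slots[OF S _ _ p n0[OF n], of "\<lambda>_. l" "\<lambda>r. r"] S lm by auto
    also have "\<dots> = (\<Sum>z\<in>y ` insert l S. ?h (fst z) (snd z))"
    proof (rule sum_bijections_eq[OF fin])
      show "y ` insert l S \<subseteq> (SIGMA T:{T. T \<subseteq> {1..m} \<and> card T = card S}. {\<sigma>. \<sigma> \<in> T \<rightarrow>\<^sub>E S \<and> bij_betw \<sigma> T S})"
      proof (rule image_subsetI)
        fix i assume i: "i \<in> insert l S"
        have "restrict (?\<tau> i) (Q i) \<in> Q i \<rightarrow>\<^sub>E S" using image[OF i] by auto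
        moreover have "bij_betw (restrict (?\<tau> i) (Q i)) (Q i) S"
          using image[OF i] by (simp add: bij_betw_def inj_on_restrict_eq)
        ultimately show "y i \<in> (SIGMA T:{T. T \<subseteq> {1..m} \<and> card T = card S}. {\<sigma>. \<sigma> \<in> T \<rightarrow>\<^sub>E S \<and> bij_betw \<sigma> T S})"
          using Q cardQ[OF i] by (simp add: y_def)
      qed
      fix T \<sigma> assume T: "T \<subseteq> {1..m}" "card T = card S" and \<sigma>: "\<sigma> \<in> T \<rightarrow>\<^sub>E S" "bij_betw \<sigma> T S"
        and notin: "(T, \<sigma>) \<notin> y ` insert l S"
      have "(\<Prod>t\<in>T. of_bool (\<sigma> t = t) - of_bool (l = t)) = (0 :: complex)"
      proof (rule ccontr)
        assume prod: "(\<Prod>t\<in>T. of_bool (\<sigma> t = t) - of_bool (l = t)) \<noteq> (0 :: complex)"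
        have fixed: "\<sigma> t = t" if "t \<in> T" "t \<noteq> l" for t
        proof (rule ccontr)
          assume "\<sigma> t \<noteq> t"
          then have "\<exists>t\<in>T. of_bool (\<sigma> t = t) - of_bool (l = t) = (0 :: complex)"
            using that by (intro bexI[of _ t]) auto
          then have "(\<Prod>t\<in>T. of_bool (\<sigma> t = t) - of_bool (l = t)) = (0 :: complex)"
            by (intro prod_zero finite_subset[OF T(1)]) auto
          with prod show False by contradiction
        qed
        have \<sigma>S: "\<sigma> t \<in> S" if "t \<in> T" for t using \<sigma>(1) that by auto
        have sub: "T \<subseteq> insert l S" using fixed \<sigma>S by (metis insertCI subsetI)
        have "T \<noteq> insert l S" using T(2) fin lm by auto
        then obtain i where i: "i \<in> insert l S" "i \<notin> T" using sub by blast
        have TQ: "T = Q i"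
          using i sub T(2) cardQ[OF i(1)] fin by (intro card_subset_eq) (auto simp: Q_def)
        have "\<sigma> t = ?\<tau> i t" if "t \<in> Q i" for t
        proof (cases "t = l")
          case True
          then have "i \<noteq> l" "i \<in> S" using that i by (auto simp: Q_def)
          \<comment> \<open>Surjectivity onto S requires a preimage of i. A fixed slot could only be
            i itself, which is not in T, so the preimage is l.\<close>
          then obtain t' where t': "t' \<in> T" "\<sigma> t' = i" using \<sigma>(2) by (metis bij_betw_imp_surj_on imageE)
          then have "t' = l" using fixed[of t'] i(2) by metis
          then show ?thesis using True t' by simp
        next
          case False
          then have "t \<noteq> i" using that by (auto simp: Q_def)
          then show ?thesis using fixed[of t] False that TQ by (simp add: Transposition.transpose_def)
        qed
        then have "\<sigma> = restrict (?\<tau> i) (Q i)"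
          using \<sigma>(1) TQ by (auto simp: fun_eq_iff PiE_iff extensional_def)
        then show False using notin TQ i by (auto simp: y_def)
      qed
      then show "?h T \<sigma> = 0" by simp
    qed
    also have "\<dots> = (\<Sum>i\<in>insert l S. ?h (fst (y i)) (snd (y i)))"
      unfolding sum.reindex[OF inj_y] comp_def ..
    also have "\<dots> = ?h (fst (y l)) (snd (y l)) + (\<Sum>i\<in>S. ?h (fst (y i)) (snd (y i)))"
      using fin lm by (intro sum.insert)
    also have "?h (fst (y l)) (snd (y l)) = slots S (dyadic_diff m n p) / w S"
    proof -
      have "(\<Prod>t\<in>S. of_bool (restrict id S t = t) - of_bool (l = t)) = (1 :: complex)"
        using lm by (intro prod.neutral) auto
      moreover have "slots S (\<lambda>t. dyadic_diff m n p (restrict id S t)) = slots S (dyadic_diff m n p)"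
        by (intro slots_cong) simp
      ultimately show ?thesis by (simp add: yl w_def del: of_real_prod restrict_apply)
    qed
    also have "(\<Sum>i\<in>S. ?h (fst (y i)) (snd (y i))) = (\<Sum>i\<in>S. - (slots (Q i) (\<lambda>t. dyadic_diff m n p (?\<tau> i t)) / w (Q i)))"
    proof (intro sum.cong refl)
      fix i assume i: "i \<in> S"
      have "(\<Prod>t\<in>Q i. of_bool (restrict (?\<tau> i) (Q i) t = t) - of_bool (l = t)) = (\<Prod>t\<in>Q i. if t = l then - 1 else 1 :: complex)"
        using i lm by (intro prod.cong refl) (auto simp: Q_def Transposition.transpose_def)
      also have "\<dots> = - 1" using i lm fin by (subst prod.delta) (auto simp: Q_def)
      finally have "(\<Prod>t\<in>Q i. of_bool (restrict (?\<tau> i) (Q i) t = t) - of_bool (l = t)) = (- 1 :: complex)" .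
      moreover have "slots (Q i) (\<lambda>t. dyadic_diff m n p (restrict (?\<tau> i) (Q i) t)) = slots (Q i) (\<lambda>t. dyadic_diff m n p (?\<tau> i t))"
        by (intro slots_cong) simp
      ultimately show "?h (fst (y i)) (snd (y i)) = - (slots (Q i) (\<lambda>t. dyadic_diff m n p (?\<tau> i t)) / w (Q i))"
        by (simp add: y_def w_def del: of_real_prod restrict_apply)
    qed
    finally have zero: "slots S (dyadic_diff m n p) / w S = (\<Sum>i\<in>S. slots (Q i) (\<lambda>t. dyadic_diff m n p (?\<tau> i t)) / w (Q i))"
      by (simp add: sum_negf)
    let ?c = "(1 / 2 ^ n) ^ (m - card S) :: complex"
    have "tensor_int {1..m} ?\<phi> H = tensor_int {1..m} (?\<phi> \<circ> id) (walsh m f S) / w S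
      - (\<Sum>i\<in>S. tensor_int {1..m} (?\<phi> \<circ> ?\<tau> i) (walsh m f (Q i)) / w (Q i))"
      by (subst test) (auto simp: test_fun_dyadic_diff test_fun_indicator)
    also have "tensor_int {1..m} (?\<phi> \<circ> id) (walsh m f S) = ?c * slots S (\<lambda>t. dyadic_diff m n p (id t))"
      by (intro tensor_int_walsh_permuted_differences S(1) p) auto
    also have "(\<Sum>i\<in>S. tensor_int {1..m} (?\<phi> \<circ> ?\<tau> i) (walsh m f (Q i)) / w (Q i))
        = (\<Sum>i\<in>S. ?c * (slots (Q i) (\<lambda>t. dyadic_diff m n p (?\<tau> i t)) / w (Q i)))"
    proof (intro sum.cong refl)
      fix i assume i: "i \<in> S"
      have "tensor_int {1..m} (?\<phi> \<circ> ?\<tau> i) (walsh m f (Q i)) = (1 / 2 ^ n) ^ (m - card (Q i)) * slots (Q i) (\<lambda>t. dyadic_diff m n p (?\<tau> i t))"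
      proof (rule tensor_int_walsh_permuted_differences[OF Q S(1)])
        show "?\<tau> i ` {1..m} \<subseteq> {1..m}" using lm im[OF i] by (auto simp: Transposition.transpose_def)
        show "?\<tau> i j \<in> S \<longleftrightarrow> j \<in> Q i" if "j \<in> {1..m}" for j
          using i lm by (auto simp: Q_def Transposition.transpose_def)
      qed (rule p)
      then show "tensor_int {1..m} (?\<phi> \<circ> ?\<tau> i) (walsh m f (Q i)) / w (Q i) = ?c * (slots (Q i) (\<lambda>t. dyadic_diff m n p (?\<tau> i t)) / w (Q i))"
        using cardQ i by simp
    qed
    also have "?c * slots S (\<lambda>t. dyadic_diff m n p (id t)) / w S
        - (\<Sum>i\<in>S. ?c * (slots (Q i) (\<lambda>t. dyadic_diff m n p (?\<tau> i t)) / w (Q i))) = 0"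
    proof -
      have "?c * slots S (\<lambda>t. dyadic_diff m n p (id t)) / w S = ?c * (slots S (dyadic_diff m n p) / w S)"
        by simp
      then show ?thesis unfolding zero sum_distrib_left by simp
    qed
    finally show "tensor_int {1..m} (\<lambda>i. if i \<in> S
          then (\<lambda>x. indicator (dyadic n (p i)) x - indicator (dyadic n (p (m + i))) x)
          else indicator (dyadic n (p i))) H = 0"
      unfolding differences_fold .
  qed
  then show ?thesis by (rule eventually_mono) (simp add: H_def Q_def w_def del: of_real_prod)
qed

end

section \<open>The equivalence\<close>

lemma tensor_int_alternating_on:
  assumes f: "integrable (cube {1..m}) f" and S: "S \<subseteq> {1..m}"
    and alt: "alternating_on m S (walsh m f S)" and ij: "i \<in> S" "j \<in> S" "i \<noteq> j"
    and \<phi>: "\<And>k. k \<in> {1..m} \<Longrightarrow> test_fun (\<phi> k)"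
  shows "tensor_int {1..m} (\<phi> \<circ> Transposition.transpose i j) (walsh m f S) = - tensor_int {1..m} \<phi> (walsh m f S)"
proof -
  have ijm: "i \<in> {1..m}" "j \<in> {1..m}" using ij S by auto
  note W = integrable_walsh[OF S f]
  have "tensor_int {1..m} (\<phi> \<circ> Transposition.transpose i j) (walsh m f S)
      = tensor_int {1..m} \<phi> (\<lambda>x. walsh m f S (swap_coords i j x))"
    using \<phi> by (intro tensor_int_swap[symmetric] ijm W) auto
  also have "\<dots> = tensor_int {1..m} \<phi> (\<lambda>x. (- 1) * walsh m f S x)"
    using alt ij \<phi> W integrable_swap[OF _ ijm W]
    by (intro tensor_int_cong_AE) (auto simp: alternating_on_def)
  finally show ?thesis unfolding tensor_int_cmult by simp
qed

lemma tensor_int_relation: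
  assumes f: "integrable (cube {1..m}) f" and S: "S \<subseteq> {1..m}" and l: "l \<in> {1..m} - S"
    and rel: "AE x in cube {1..m}. walsh m f S x / w S =
      (\<Sum>i\<in>S. walsh m f (insert l S - {i}) (swap_coords l i x) / w (insert l S - {i}))"
    and \<phi>: "\<And>k. k \<in> {1..m} \<Longrightarrow> test_fun (\<phi> k)"
  shows "tensor_int {1..m} \<phi> (walsh m f S) / w S =
      (\<Sum>i\<in>S. tensor_int {1..m} (\<phi> \<circ> Transposition.transpose l i) (walsh m f (insert l S - {i}))
        / w (insert l S - {i}))"
proof -
  have lm: "l \<in> {1..m}" using l by simp
  have im: "i \<in> {1..m}" if "i \<in> S" for i using that S by auto
  have sub: "insert l S - {i} \<subseteq> {1..m}" for i using l S by auto
  have sw: "integrable (cube {1..m}) (\<lambda>x. walsh m f (insert l S - {i}) (swap_coords l i x))" if "i \<in> S" for i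
    using that by (intro integrable_swap lm im integrable_walsh sub f) auto
  have "tensor_int {1..m} \<phi> (walsh m f S) / w S = tensor_int {1..m} \<phi> (\<lambda>x. walsh m f S x / w S)"
    by (simp add: tensor_int_divide)
  also have "\<dots> = tensor_int {1..m} \<phi> (\<lambda>x. \<Sum>i\<in>S. walsh m f (insert l S - {i}) (swap_coords l i x) / w (insert l S - {i}))"
    using \<phi> rel sw integrable_walsh[OF S f]
    by (intro tensor_int_cong_AE Bochner_Integration.integrable_sum integrable_divide) auto
  also have "\<dots> = (\<Sum>i\<in>S. tensor_int {1..m} \<phi> (\<lambda>x. walsh m f (insert l S - {i}) (swap_coords l i x) / w (insert l S - {i})))"
    using \<phi> sw by (intro tensor_int_sum integrable_divide) auto
  also have "\<dots> = (\<Sum>i\<in>S. tensor_int {1..m} (\<phi> \<circ> Transposition.transpose l i) (walsh m f (insert l S - {i}))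
        / w (insert l S - {i}))"
  proof (intro sum.cong refl)
    fix i assume "i \<in> S"
    then have "tensor_int {1..m} \<phi> (\<lambda>x. walsh m f (insert l S - {i}) (swap_coords l i x))
        = tensor_int {1..m} (\<phi> \<circ> Transposition.transpose l i) (walsh m f (insert l S - {i}))"
      using \<phi> by (intro tensor_int_swap lm im integrable_walsh sub f) auto
    then show "tensor_int {1..m} \<phi> (\<lambda>x. walsh m f (insert l S - {i}) (swap_coords l i x) / w (insert l S - {i}))
        = tensor_int {1..m} (\<phi> \<circ> Transposition.transpose l i) (walsh m f (insert l S - {i})) / w (insert l S - {i})"
      by (simp add: tensor_int_divide)
  qed
  finally show ?thesis .
qed

section \<open>The empty component and sums over levels\<close>

lemma walsh_empty_const: "walsh m f {} x = walsh m f {} y"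
  using partial_int_restrict[of m "{}" f x] partial_int_restrict[of m "{}" f y]
  by (simp add: walsh_def restrict_def)

lemma tensor_int_const_one: "tensor_int I (\<lambda>_ _. 1) (\<lambda>_. c) = c"
  by (simp add: tensor_int_def prob_space.prob_space[OF prob_space_cube])

text \<open>F at the empty set is constant, so its test integral is that constant times the product
  of the means, and one product with nonzero means determines it.\<close>

lemma walsh_empty_eq_0:
  assumes f: "integrable (cube {1..m}) f" and \<phi>: "\<And>k. k \<in> {1..m} \<Longrightarrow> test_fun (\<phi> k)"
    and mean: "\<And>k. k \<in> {1..m} \<Longrightarrow> mean (\<phi> k) \<noteq> 0" and zero: "tensor_int {1..m} \<phi> (walsh m f {}) = 0"
  shows "walsh m f {} x = 0"
proof -
  have const: "walsh m f {} = (\<lambda>_. walsh m f {} x)"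
    using walsh_empty_const by blast
  have "tensor_int {1..m} (\<lambda>_ _. 1) (walsh m f {}) = walsh m f {} x"
    by (subst const) (rule tensor_int_const_one)
  moreover have "tensor_int {1..m} (\<lambda>_ _. 1) (walsh m f {}) = tensor_int {1..m} (\<lambda>_ _. 1) f"
    by (subst tensor_int_walsh_slots[OF f]) auto
  moreover have "tensor_int {1..m} (\<lambda>_ _. 1) f = 0"
    using zero mean by (subst (asm) tensor_int_walsh_slots[OF f _ \<phi>]) auto
  ultimately show ?thesis by simp
qed

lemma sum_levels_Suc:
  fixes h :: "nat set \<Rightarrow> complex"
  shows "(\<Sum>T | T \<subseteq> {1..m} \<and> card T \<le> Suc k. h T)
    = (\<Sum>T | T \<subseteq> {1..m} \<and> card T \<le> k. h T) + (\<Sum>T | T \<subseteq> {1..m} \<and> card T = Suc k. h T)"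
proof -
  have "{T. T \<subseteq> {1..m} \<and> card T \<le> Suc k} = {T. T \<subseteq> {1..m} \<and> card T \<le> k} \<union> {T. T \<subseteq> {1..m} \<and> card T = Suc k}"
    by auto
  moreover have "finite {T. T \<subseteq> {1..m} \<and> card T \<le> k}" "finite {T. T \<subseteq> {1..m} \<and> card T = Suc k}"
    by simp_all
  moreover have "{T. T \<subseteq> {1..m} \<and> card T \<le> k} \<inter> {T. T \<subseteq> {1..m} \<and> card T = Suc k} = {}"
    by auto
  ultimately show ?thesis by (simp only: sum.union_disjoint)
qed

lemma sum_levels_0:
  fixes h :: "nat set \<Rightarrow> complex"
  shows "(\<Sum>T | T \<subseteq> {1..m} \<and> card T \<le> 0. h T) = h {}"
proof -
  have "T \<in> {T. T \<subseteq> {1..m} \<and> card T \<le> 0} \<longleftrightarrow> T \<in> {{}}" for T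
    using finite_subset[of T "{1..m}"] by auto
  then have "{T. T \<subseteq> {1..m} \<and> card T \<le> 0} = {{}}" by (rule set_eqI)
  then show ?thesis by simp
qed

lemma sum_levels_all:
  fixes h :: "nat set \<Rightarrow> complex"
  shows "(\<Sum>T | T \<subseteq> {1..m} \<and> card T \<le> m. h T) = (\<Sum>T\<in>Pow {1..m}. h T)"
proof -
  have "card T \<le> m" if "T \<subseteq> {1..m}" for T
    using card_mono[OF _ that] by simp
  then have "{T. T \<subseteq> {1..m} \<and> card T \<le> m} = Pow {1..m}" by auto
  then show ?thesis by simp
qed

theorem mainTheorem1:
  fixes m :: nat and \<alpha> :: "nat \<Rightarrow> real" and f :: "(nat \<Rightarrow> real) \<Rightarrow> complex"
  assumes "m \<ge> 1"
    and "\<forall>i\<in>{1..m}. 0 < \<alpha> i \<and> \<alpha> i < 1"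
    and "(\<Sum>i\<in>{1..m}. \<alpha> i) = 1"
    and "integrable (cube {1..m}) f"
  shows "(\<forall>A :: nat \<Rightarrow> real set.
            (\<forall>i\<in>{1..m}. A i \<in> sets lebesgue) \<and> disjoint_family_on A {1..m} \<and>
            (\<Union>i\<in>{1..m}. A i) = {0..1} \<and> (\<forall>i\<in>{1..m}. measure lebesgue (A i) = \<alpha> i)
            \<longrightarrow> (LINT x : PiE {1..m} A | cube {1..m}. f x) = 0)
    \<longleftrightarrow>
         ((AE x in cube {1..m}. walsh m f {} x = 0) \<and>
          (\<forall>S. S \<subseteq> {1..m} \<and> card S \<ge> 2 \<longrightarrow> alternating_on m S (walsh m f S)) \<and>
          (\<forall>S l. S \<subseteq> {1..m} \<and> 1 \<le> card S \<and> card S \<le> m - 1 \<and> l \<in> {1..m} - S \<longrightarrow>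
             (AE x in cube {1..m}.
                walsh m f S x / complex_of_real (\<Prod>i\<in>S. \<alpha> i) =
                (\<Sum>i\<in>S. walsh m f (insert l S - {i}) (swap_coords l i x)
                          / complex_of_real (\<Prod>j\<in>insert l S - {i}. \<alpha> j)))))"
    (is "?integrals \<longleftrightarrow> ?empty \<and> ?alternating \<and> ?relation")
proof -
  let ?I = "{1..m}"
  let ?t = "\<lambda>A T. tensor_int ?I (\<lambda>i. indicator (A i)) (walsh m f T)"
  note f = assms(4)
  have pos: "0 < \<alpha> i" if "i \<in> ?I" for i using assms(2) that by blast
  have integrals: "?integrals \<longleftrightarrow> (\<forall>A. prescribed_partition m \<alpha> A \<longrightarrow> (\<Sum>T | T \<subseteq> ?I \<and> card T \<le> m. ?t A T) = 0)"
  proof -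
    have "(LINT x : PiE ?I A | cube ?I. f x) = (\<Sum>T | T \<subseteq> ?I \<and> card T \<le> m. ?t A T)"
      if "prescribed_partition m \<alpha> A" for A
      unfolding sum_levels_all tensor_int_indicator[OF finite_atLeastAtMost, symmetric]
      by (rule tensor_int_eq_sum_walsh[OF f prescribed_partition_test_fun[OF that]])
    then show ?thesis unfolding prescribed_partition_def by auto
  qed
  \<comment> \<open>Vanishing of a single level, with (ii) and (iii) brought into tested form. It
    serves both directions of the equivalence.\<close>
  have level: "(\<Sum>S | S \<subseteq> ?I \<and> card S = k. ?t A S) = 0"
    if A: "prescribed_partition m \<alpha> A" and k: "1 \<le> k" "k \<le> m"
      and alt: "\<And>S. S \<subseteq> ?I \<Longrightarrow> card S = k \<Longrightarrow> 2 \<le> k \<Longrightarrow> alternating_on m S (walsh m f S)"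
      and rel: "\<And>S l. S \<subseteq> ?I \<Longrightarrow> card S = k \<Longrightarrow> l \<in> ?I - S \<Longrightarrow>
        AE x in cube ?I. walsh m f S x / complex_of_real (\<Prod>i\<in>S. \<alpha> i) =
          (\<Sum>i\<in>S. walsh m f (insert l S - {i}) (swap_coords l i x) / complex_of_real (\<Prod>j\<in>insert l S - {i}. \<alpha> j))"
    for A k
  proof (rule sum_walsh_level_eq_0[OF f pos A k])
    fix S i j and \<phi> :: "nat \<Rightarrow> real \<Rightarrow> complex"
    assume S: "S \<subseteq> ?I" "card S = k" "i \<in> S" "j \<in> S" "i \<noteq> j" and \<phi>: "\<And>k. k \<in> ?I \<Longrightarrow> test_fun (\<phi> k)"
    have "card {i, j} \<le> card S" using S finite_subset[OF S(1)] by (intro card_mono) auto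
    then show "tensor_int ?I (\<phi> \<circ> Transposition.transpose i j) (walsh m f S) = - tensor_int ?I \<phi> (walsh m f S)"
      using S \<phi> by (intro tensor_int_alternating_on[OF f S(1) alt]) auto
  next
    fix S l and \<phi> :: "nat \<Rightarrow> real \<Rightarrow> complex"
    assume S: "S \<subseteq> ?I" "card S = k" "l \<in> ?I - S" and \<phi>: "\<And>k. k \<in> ?I \<Longrightarrow> test_fun (\<phi> k)"
    show "tensor_int ?I \<phi> (walsh m f S) / complex_of_real (\<Prod>i\<in>S. \<alpha> i) =
        (\<Sum>i\<in>S. tensor_int ?I (\<phi> \<circ> Transposition.transpose l i) (walsh m f (insert l S - {i}))
          / complex_of_real (\<Prod>j\<in>insert l S - {i}. \<alpha> j))"
      using tensor_int_relation[where w="\<lambda>T. complex_of_real (\<Prod>j\<in>T. \<alpha> j)", OF f S(1,3) rel[OF S] \<phi>] .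
  qed
  show ?thesis
  proof
    assume ?integrals
    have levels: "\<forall>A. prescribed_partition m \<alpha> A \<longrightarrow> (\<Sum>T | T \<subseteq> ?I \<and> card T \<le> k. ?t A T) = 0"
      if "k \<le> m" for k
      using that
    proof (induction k rule: inc_induct)
      case base
      then show ?case using \<open>?integrals\<close> integrals by blast
    next
      case (step k)
      interpret vanishing_top_levels m \<alpha> f "Suc k"
        using assms(1,3) f pos step.IH by unfold_locales auto
      show ?case
      proof (intro allI impI)
        fix A assume A: "prescribed_partition m \<alpha> A"
        \<comment> \<open>The exchange argument has just given (ii) and (iii) at level k + 1, so
          this level vanishes on its own and can be removed from the sum.\<close>
        have "(\<Sum>S | S \<subseteq> ?I \<and> card S = Suc k. ?t A S) = 0"
          using A step.hyps
          by (intro level AE_walsh_relation) (auto simp: alternating_on_def intro: AE_walsh_alternating)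
        then show "(\<Sum>T | T \<subseteq> ?I \<and> card T \<le> k. ?t A T) = 0"
          using step.IH A sum_levels_Suc[of "?t A" m k] by simp
      qed
    qed
    have top: "vanishing_top_levels m \<alpha> f k" if "k \<le> m" for k
      using assms(1,3) f pos levels[OF that] by unfold_locales auto
    \<comment> \<open>At level 0 the vanishing says something only if some partition with these
      measures exists; one suffices, since its cells have the nonzero means \<alpha> i.\<close>
    obtain A where A: "prescribed_partition m \<alpha> A"
      using exists_partition_of_measures[of ?I "{0..1}" \<alpha>] assms(1,3) pos
      unfolding prescribed_partition_def by (auto simp: less_imp_le)
    have ?empty
    proof (rule AE_I2)
      have "?t A {} = 0"
        using levels[of 0] A sum_levels_0[of "?t A" m] by simp
      then show "walsh m f {} x = 0" for x
        using prescribed_partition_test_fun[OF A] prescribed_partition_mean[OF A] pos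
        by (intro walsh_empty_eq_0[OF f, of "\<lambda>i. indicator (A i)"]) (auto simp: less_imp_neq[symmetric])
    qed
    moreover have ?alternating
    proof (intro allI impI)
      fix S assume S: "S \<subseteq> ?I \<and> 2 \<le> card S"
      then have "card S \<le> m" using card_mono[of ?I S] by simp
      then show "alternating_on m S (walsh m f S)"
        unfolding alternating_on_def using S vanishing_top_levels.AE_walsh_alternating[OF top] by blast
    qed
    moreover have ?relation
    proof (intro allI impI)
      fix S l assume S: "S \<subseteq> ?I \<and> 1 \<le> card S \<and> card S \<le> m - 1 \<and> l \<in> ?I - S"
      then have "card S \<le> m" using diff_le_self le_trans by blast
      then show "AE x in cube ?I. walsh m f S x / complex_of_real (\<Prod>i\<in>S. \<alpha> i) =
          (\<Sum>i\<in>S. walsh m f (insert l S - {i}) (swap_coords l i x) / complex_of_real (\<Prod>j\<in>insert l S - {i}. \<alpha> j))"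
        using S by (intro vanishing_top_levels.AE_walsh_relation[OF top]) auto
    qed
    ultimately show "?empty \<and> ?alternating \<and> ?relation" by blast
  next
    assume conds: "?empty \<and> ?alternating \<and> ?relation"
    show ?integrals
      unfolding integrals
    proof (intro allI impI)
      fix A assume A: "prescribed_partition m \<alpha> A"
      have "(\<Sum>T | T \<subseteq> ?I \<and> card T \<le> k. ?t A T) = 0" if "k \<le> m" for k
        using that
      proof (induction k)
        case 0
        have "?t A {} = tensor_int ?I (\<lambda>i. indicator (A i)) (\<lambda>_. 0)"
          using conds prescribed_partition_test_fun[OF A] integrable_walsh[OF _ f]
          by (intro tensor_int_cong_AE) auto
        then show ?case unfolding sum_levels_0 by (simp add: tensor_int_def)
      next
        case (Suc k)
        have "(\<Sum>S | S \<subseteq> ?I \<and> card S = Suc k. ?t A S) = 0"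
        proof (rule level[OF A])
          show "alternating_on m S (walsh m f S)" if "S \<subseteq> ?I" "card S = Suc k" "2 \<le> Suc k" for S
            using conds that by auto
          fix S l assume S: "S \<subseteq> ?I" "card S = Suc k" "l \<in> ?I - S"
          \<comment> \<open>An l outside S forces S to have at most m - 1 elements, the range in
            which (iii) is assumed.\<close>
          then have "card (insert l S) \<le> card ?I" by (intro card_mono) auto
          then have "S \<subseteq> ?I \<and> 1 \<le> card S \<and> card S \<le> m - 1 \<and> l \<in> ?I - S"
            using S finite_subset[OF S(1)] by simp
          from conds[THEN conjunct2, THEN conjunct2, rule_format, OF this]
          show "AE x in cube ?I. walsh m f S x / complex_of_real (\<Prod>i\<in>S. \<alpha> i) =
            (\<Sum>i\<in>S. walsh m f (insert l S - {i}) (swap_coords l i x) / complex_of_real (\<Prod>j\<in>insert l S - {i}. \<alpha> j))" .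
        qed (use Suc.prems in auto)
        then show ?case using Suc sum_levels_Suc[of "?t A" m k] by simp
      qed
      then show "(\<Sum>T | T \<subseteq> ?I \<and> card T \<le> m. ?t A T) = 0" by simp
    qed
  qed
qed

end
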